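(* Let $f$ and $\phi$ satisfy the standing assumptions in the context, let $\mu$ be the equilibrium state and let $\theta$ be fixed as in the context. Assume that $\Phi\in V_\theta$ and that the asymptotic variance $$\sigma^2(\Phi)=\|\Phi\|_{L^1(\mu)}+2\sum_{j=1}^\infty\int\Phi\,(\Phi\circ f^j)\,d\mu$$ is nonzero. Then the distribution of the random variables $$\frac{1}{\sigma(\Phi)\sqrt n}\sum_{j=0}^{n-1}\Big(\Phi\circ f^j-\int\Phi\,d\mu\Big)$$ converges to the normal distribution $\mathcal N(0,1)$ as $n$ tends to infinity. Moreover, $\sigma(\Phi)=0$ if and only if there exists a measurable function $\tilde\Phi$ such that $\Phi=\tilde\Phi\circ f-\tilde\Phi$.
   Context: Setting. $M$ is a compact Riemannian manifold, $m=\dim M$, $f:M\to M$ is a $C^1$ local diffeomorphism, every point of $M$ has $\deg(f)$ preimages, and $\phi:M\to\mathbb R$ is $\alpha$-Hölder continuous. Standing assumptions: (A1) There are $p\ge 1$, $q\ge 0$ and a family $\mathcal Q=\{Q_1,\dots,Q_q,Q_{q+1},\dots,Q_{q+p}\}$ of pairwise disjoint open sets whose closures cover $M$ and have finite inner diameter (any two points of the set can be joined by a curve contained in it of length less than some constant), such that: every $f|_{\bar Q_i}$ is a homeomorphism onto its image; if $f(Q_i)\cap Q_j\ne\emptyset$ then $f(Q_i)\supset Q_j$ and, hence, $f(\bar Q_i)\supset\bar Q_j$; there is $N\ge1$ with $f^N(Q_i)=M$ for every $i$. (A2) There are constants $\sigma>1$ and $L>0$ such that $\|Df(x)^{-1}\|\le\sigma^{-1}$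 for every $x\in Q_{q+1}\cup\dots\cup Q_{q+p}$ and $\|Df(x)^{-1}\|\le L$ for every $x\in Q_1\cup\dots\cup Q_q$, where $L$ is close to $1$ in the sense made precise below. (A3) $\sup\phi-\inf\phi<\log\deg(f)-\log q$. (A4) $\sup\phi-\inf\phi<\tfrac12(c\tau-\log L)\alpha$, with $c,\tau$ as below. Constants. Fix $\varepsilon_0>0$ with $\sup\phi-\inf\phi<\log\deg(f)-\log q-\varepsilon_0$. For $n\ge1$, $\mathcal Q^{(n)}=\bigvee_{j=0}^{n-1}f^{-j}\mathcal Q$ is the family of $n$-cylinders. Let $B(n)=B(n,\gamma)$ be the set of $Q_n\in\mathcal Q^{(n)}$ with $\#\{0\le j\le n-1: f^j(Q_n)\subset Q_1\cup\dots\cup Q_q\}>\gamma n$, where $\gamma\in(0,1)$ is fixed so that, for some $c_\gamma\le\log q+\varepsilon_0$, $\#B(n)\le \exp(c_\gamma n)$ for every large $n$ and the $\nu$-measure of the union of the cylinders in $B(n)$ decreases exponentially fast ($\nu$ is defined below). The constant $c>0$ satisfies $\sigma^{-(1-\gamma)}<e^{-2c}<1$ and $\log q+c\alpha+\varepsilon_0<\log\deg(f)$, and $L$ is sufficiently close to one that $(\log L)^2\le 2c^2$, $\sigma^{-(1-\gamma)}L^\gamma<e^{-2c}<1$ and $\sup\phi-\inf\phi<\log\deg(f)-\log q-m\log L$. An integer $n$ is a hyperbolic time for $x$ if $\prod_{j=n-k}^{n-1}\|Df(f^j(x))^{-1}\|<e^{-ck}$ for every $1\le k\le n$; $Q_n\in\mathcal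 Q^{(n)}$ is a hyperbolic cylinder if $n$ is a hyperbolic time for every point of $Q_n$. The constant $\tau\in(0,1)$ is such that for any $n\ge1$ and any $x$ outside the union of $B(n)$ there are $l>\tau n$ and integers $1\le n_1<\dots<n_l$ such that $x$ belongs to the closure of a hyperbolic cylinder of order $n_i$ for every $i=1,\dots,l$; furthermore, $\tau\ge 2c/A$ where $A=\log L$. Operator and measures. $\mathcal L_\phi g(x)=\sum_{f(y)=x}e^{\phi(y)}g(y)$. By a theorem of Oliveira and Viana there is a probability measure $\nu$ with $\mathcal L_\phi^*\nu=\lambda\nu$, where $\lambda$ is the spectral radius of $\mathcal L_\phi$ on $C(M)$, which is expanding ($\nu$-almost every point lies in the closures of infinitely many hyperbolic cylinders), and there is a unique equilibrium state $\mu$ of $f$ for $\phi$ (invariant probability maximizing $h_\eta(f)+\int\phi\,d\eta$), with $\mu\ll\nu$. These $\nu,\mu$ are fixed. Spaces. $S_n\phi(Q_n)=\sup\{\sum_{j=0}^{n-1}\phi(f^j(x)):x\in Q_n\}$. For $g\in L^\infty(\nu)$, $\overline{\mathrm{osc}}(g,E)$ is the $\nu$-essential supremum of $|g(x)-g(y)|$ over $x,y\in E$. For $\theta>0$, $\mathrm{var}_\theta(g)=\sum_{n\ge1}\theta^n\sum_{Q_n\in\mathcal Q^{(n)}}e^{S_n\phi(Q_n)}\,\overline{\mathrm{osc}}(g,Q_n)$, $\|g\|_\theta=\|g\|_\infty+\mathrm{var}_\theta(g)$, and $V_\theta=\{g\in L^\infty(\nu):\|g\|_\theta<\infty\}$,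 a Banach space. Choice of $\theta$. $\theta>0$ is fixed such that: $\mathcal L_\phi$ is quasi-compact and has a spectral gap in $V_\theta$ (there is an invariant splitting $V_\theta=B_0\oplus B_1$ with $\dim B_0=1$, the spectrum of $\mathcal L_\phi|_{B_0}$ consists of an eigenvalue of absolute value equal to the spectral radius $r$ of $\mathcal L_\phi$ on $V_\theta$, and the spectral radius of $\mathcal L_\phi|_{B_1}$ is less than $r$); $d\mu/d\nu\in V_\theta$; and there are $C>0$, $\xi\in(0,1)$ with $|\int \Phi(\Psi\circ f^n)\,d\mu-\int\Phi\, d\mu\int\Psi\, d\mu|\le C\xi^n\|\Phi\|_\theta\|\Psi\|_{L^1(\nu)}$ for every $\Phi\in V_\theta$ and $\Psi\in L^1(\nu)$. Here $\sigma(\Phi)$ is the square root of $\sigma^2(\Phi)$ and is not to be confused with the constant $\sigma$ in (A2).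
   Formalization: The variance is corrected: the squared L² norm replaces the L¹ norm, and Φ is centred by its mean. The coboundary equation (μ-a.e.) is stated for Φ−∫Φ dμ; as printed, it holds iff σ(Φ)=0 and ∫Φ dμ=0. *)

theory Defs
  imports "HOL-Probability.Probability"
begin

section \<open>Cylinders\<close>

text \<open>The nonempty elements of \<open>\<Or>\<^bsub>j<n\<^esub> f\<^sup>-\<^sup>j P\<close>.\<close>

definition dyn_join :: "('a \<Rightarrow> 'a) \<Rightarrow> 'a set set \<Rightarrow> nat \<Rightarrow> 'a set set" where
  "dyn_join f P n = {C. C \<noteq> {} \<and> (\<exists>A. (\<forall>j<n. A j \<in> P) \<and> C = {x. \<forall>j<n. (f ^^ j) x \<in> A j})}"

section \<open>Riemannian manifolds\<close>

text \<open>
  A manifold is the whole of a Hausdorff type \<open>'a\<close> with an atlas of charts \<open>(U, \<psi>)\<close> into a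
  Euclidean space \<open>'e\<close>; a Riemannian metric is given by its coordinate expression
  \<open>metric c x u v\<close> in each chart \<open>c\<close> around \<open>x\<close>.
\<close>

primrec Ck_on :: "nat \<Rightarrow> ('e::euclidean_space \<Rightarrow> 'b::real_normed_vector) \<Rightarrow> 'e set \<Rightarrow> bool" where
  "Ck_on 0 F S \<longleftrightarrow> continuous_on S F"
| "Ck_on (Suc k) F S \<longleftrightarrow> (\<forall>x\<in>S. F differentiable (at x)) \<and>
     (\<forall>v. Ck_on k (\<lambda>x. frechet_derivative F (at x) v) S)"

definition smooth_on :: "('e::euclidean_space \<Rightarrow> 'b::real_normed_vector) \<Rightarrow> 'e set \<Rightarrow> bool" where
  "smooth_on F S \<longleftrightarrow> (\<forall>k. Ck_on k F S)"

type_synonym ('a, 'e) chart = "'a set \<times> ('a \<Rightarrow> 'e)"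

definition chart_inv :: "('a, 'e) chart \<Rightarrow> 'e \<Rightarrow> 'a" where
  "chart_inv c = inv_into (fst c) (snd c)"

locale riemannian_manifold =
  fixes atlas :: "('a::t2_space, 'e::euclidean_space) chart set"
    and metric :: "('a, 'e) chart \<Rightarrow> 'a \<Rightarrow> 'e \<Rightarrow> 'e \<Rightarrow> real"
  assumes chart: "c \<in> atlas \<Longrightarrow> open (fst c) \<and> open (snd c ` fst c) \<and>
      homeomorphism (fst c) (snd c ` fst c) (snd c) (chart_inv c)"
    and charts_cover: "(\<Union>c\<in>atlas. fst c) = UNIV"
    and transition_smooth: "c \<in> atlas \<Longrightarrow> d \<in> atlas \<Longrightarrow>
      smooth_on (snd d \<circ> chart_inv c) (snd c ` (fst c \<inter> fst d))"
    and metric_bilinear: "c \<in> atlas \<Longrightarrow> x \<in> fst c \<Longrightarrow> bilinear (metric c x)"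
    and metric_sym: "c \<in> atlas \<Longrightarrow> x \<in> fst c \<Longrightarrow> metric c x u v = metric c x v u"
    and metric_pos: "c \<in> atlas \<Longrightarrow> x \<in> fst c \<Longrightarrow> v \<noteq> 0 \<Longrightarrow> metric c x v v > 0"
    and metric_smooth: "c \<in> atlas \<Longrightarrow>
      smooth_on (\<lambda>y. metric c (chart_inv c y) u v) (snd c ` fst c)"
    and metric_compat: "c \<in> atlas \<Longrightarrow> d \<in> atlas \<Longrightarrow> x \<in> fst c \<inter> fst d \<Longrightarrow>
      metric c x u v =
        metric d x (frechet_derivative (snd d \<circ> chart_inv c) (at (snd c x)) u)
                   (frechet_derivative (snd d \<circ> chart_inv c) (at (snd c x)) v)"
begin

definition chart_at :: "'a \<Rightarrow> ('a, 'e) chart" where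
  "chart_at x = (SOME c. c \<in> atlas \<and> x \<in> fst c)"

text \<open>Norm on the tangent space at \<open>x\<close>, whose vectors are written in the chart \<open>chart_at x\<close>.\<close>

definition tnorm :: "'a \<Rightarrow> 'e \<Rightarrow> real" where
  "tnorm x v = sqrt (metric (chart_at x) x v v)"

definition piecewise_C1_curve :: "(real \<Rightarrow> 'a) \<Rightarrow> bool" where
  "piecewise_C1_curve \<gamma> \<longleftrightarrow> path \<gamma> \<and>
     (\<exists>S. finite S \<and> (\<forall>c\<in>atlas. (snd c \<circ> \<gamma>) C1_differentiable_on {t \<in> {0..1} - S. \<gamma> t \<in> fst c}))"

definition curve_length :: "(real \<Rightarrow> 'a) \<Rightarrow> ennreal" where
  "curve_length \<gamma> = (\<integral>\<^sup>+t\<in>{0..1}.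
     ennreal (tnorm (\<gamma> t) (vector_derivative (snd (chart_at (\<gamma> t)) \<circ> \<gamma>) (at t))) \<partial>lborel)"

text \<open>
  The Riemannian distance. An infimum over no curves would give \<open>0\<close>, but under the standing
  assumptions below the manifold is connected.
\<close>

definition rdist :: "'a \<Rightarrow> 'a \<Rightarrow> real" where
  "rdist x y = enn2real (INF \<gamma>\<in>{\<gamma>. piecewise_C1_curve \<gamma> \<and> pathstart \<gamma> = x \<and> pathfinish \<gamma> = y}.
     curve_length \<gamma>)"

definition holder :: "real \<Rightarrow> ('a \<Rightarrow> real) \<Rightarrow> bool" where
  "holder \<alpha> \<phi> \<longleftrightarrow> (\<exists>K. \<forall>x y. \<bar>\<phi> x - \<phi> y\<bar> \<le> K * rdist x y powr \<alpha>)"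

text \<open>
  Length of an arbitrary continuous curve; it agrees with \<open>curve_length\<close> on piecewise \<open>C\<^sup>1\<close> curves,
  but the closures of the domains below may only be connected by less regular curves.
\<close>

definition path_length :: "(real \<Rightarrow> 'a) \<Rightarrow> ennreal" where
  "path_length \<gamma> = (SUP ts\<in>{ts. sorted ts \<and> set ts \<subseteq> {0..1}}.
     \<Sum>i<length ts - 1. ennreal (rdist (\<gamma> (ts ! i)) (\<gamma> (ts ! Suc i))))"

definition finite_inner_diameter :: "'a set \<Rightarrow> bool" where
  "finite_inner_diameter E \<longleftrightarrow> (\<exists>D::real. \<forall>x\<in>E. \<forall>y\<in>E. \<exists>\<gamma>. path \<gamma> \<and>
     pathstart \<gamma> = x \<and> pathfinish \<gamma> = y \<and> path_image \<gamma> \<subseteq> E \<and> path_length \<gamma> < ennreal D)"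

definition C1_map_on :: "'a set \<Rightarrow> ('a \<Rightarrow> 'a) \<Rightarrow> bool" where
  "C1_map_on U h \<longleftrightarrow> continuous_on U h \<and> (\<forall>c\<in>atlas. \<forall>d\<in>atlas.
     Ck_on 1 (snd d \<circ> h \<circ> chart_inv c) (snd c ` (U \<inter> fst c \<inter> h -` fst d)))"

definition C1_local_diffeo :: "('a \<Rightarrow> 'a) \<Rightarrow> bool" where
  "C1_local_diffeo f \<longleftrightarrow> (\<forall>x. \<exists>U g. open U \<and> x \<in> U \<and> open (f ` U) \<and>
     homeomorphism U (f ` U) f g \<and> C1_map_on U f \<and> C1_map_on (f ` U) g)"

definition tderiv :: "('a \<Rightarrow> 'a) \<Rightarrow> 'a \<Rightarrow> 'e \<Rightarrow> 'e" where
  "tderiv f x = frechet_derivative (snd (chart_at (f x)) \<circ> f \<circ> chart_inv (chart_at x))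
     (at (snd (chart_at x) x))"

text \<open>The operator norm \<open>\<parallel>Df(x)\<^sup>-\<^sup>1\<parallel>\<close>.\<close>

definition inv_deriv_norm :: "('a \<Rightarrow> 'a) \<Rightarrow> 'a \<Rightarrow> real" where
  "inv_deriv_norm f x = (SUP w\<in>{w. tnorm (f x) w \<le> 1}. tnorm x (inv (tderiv f x) w))"

definition hyperbolic_time :: "('a \<Rightarrow> 'a) \<Rightarrow> real \<Rightarrow> nat \<Rightarrow> 'a \<Rightarrow> bool" where
  "hyperbolic_time f c n x \<longleftrightarrow>
     (\<forall>k\<in>{1..n}. (\<Prod>j\<in>{n - k..<n}. inv_deriv_norm f ((f ^^ j) x)) < exp (- c * real k))"

definition hyperbolic_cylinders :: "('a \<Rightarrow> 'a) \<Rightarrow> 'a set set \<Rightarrow> real \<Rightarrow> nat \<Rightarrow> 'a set set" where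
  "hyperbolic_cylinders f P c n = {C \<in> dyn_join f P n. \<forall>x\<in>C. hyperbolic_time f c n x}"

end

section \<open>Entropy and equilibrium states\<close>

definition partition_entropy :: "'a measure \<Rightarrow> 'a set set \<Rightarrow> real" where
  "partition_entropy \<eta> P = - (\<Sum>A\<in>P. measure \<eta> A * ln (measure \<eta> A))"

definition finite_partition :: "'a::topological_space set set \<Rightarrow> bool" where
  "finite_partition P \<longleftrightarrow> finite P \<and> P \<subseteq> sets borel \<and> disjoint P \<and> \<Union>P = UNIV"

text \<open>Kolmogorov-Sinai entropy; for invariant \<open>\<eta>\<close> the upper limit is a limit, by subadditivity.\<close>

definition ks_entropy :: "('a::topological_space \<Rightarrow> 'a) \<Rightarrow> 'a measure \<Rightarrow> ereal" where
  "ks_entropy f \<eta> = (SUP P\<in>{P. finite_partition P}.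
     limsup (\<lambda>n. ereal (partition_entropy \<eta> (dyn_join f P n) / real n)))"

definition invariant_prob :: "('a::topological_space \<Rightarrow> 'a) \<Rightarrow> 'a measure \<Rightarrow> bool" where
  "invariant_prob f \<eta> \<longleftrightarrow> prob_space \<eta> \<and> sets \<eta> = sets borel \<and> distr \<eta> borel f = \<eta>"

definition free_energy :: "('a::topological_space \<Rightarrow> 'a) \<Rightarrow> ('a \<Rightarrow> real) \<Rightarrow> 'a measure \<Rightarrow> ereal" where
  "free_energy f \<phi> \<eta> = ks_entropy f \<eta> + ereal (\<integral>x. \<phi> x \<partial>\<eta>)"

definition equilibrium_state :: "('a::topological_space \<Rightarrow> 'a) \<Rightarrow> ('a \<Rightarrow> real) \<Rightarrow> 'a measure \<Rightarrow> bool" where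
  "equilibrium_state f \<phi> \<eta> \<longleftrightarrow> invariant_prob f \<eta> \<and>
     (\<forall>\<eta>'. invariant_prob f \<eta>' \<longrightarrow> free_energy f \<phi> \<eta>' \<le> free_energy f \<phi> \<eta>)"

section \<open>Spectral notions\<close>

text \<open>
  A (semi)normed space of complex functions is given by a carrier \<open>V\<close> and a seminorm \<open>N\<close>; functions
  whose difference has seminorm \<open>0\<close> represent the same vector (for \<open>L\<^sup>\<infinity>\<close>-type spaces, equality
  almost everywhere). All notions below are those of the associated quotient.
\<close>

definition bounded_op ::
    "('a \<Rightarrow> complex) set \<Rightarrow> (('a \<Rightarrow> complex) \<Rightarrow> real) \<Rightarrow> (('a \<Rightarrow> complex) \<Rightarrow> 'a \<Rightarrow> complex) \<Rightarrow> bool" where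
  "bounded_op V N T \<longleftrightarrow> (\<forall>g\<in>V. T g \<in> V) \<and>
     (\<forall>g\<in>V. \<forall>h\<in>V. N (\<lambda>x. T (\<lambda>y. g y + h y) x - (T g x + T h x)) = 0) \<and>
     (\<forall>a. \<forall>g\<in>V. N (\<lambda>x. T (\<lambda>y. a * g y) x - a * T g x) = 0) \<and>
     (\<exists>K. \<forall>g\<in>V. N (T g) \<le> K * N g)"

definition spectrum ::
    "('a \<Rightarrow> complex) set \<Rightarrow> (('a \<Rightarrow> complex) \<Rightarrow> real) \<Rightarrow> (('a \<Rightarrow> complex) \<Rightarrow> 'a \<Rightarrow> complex) \<Rightarrow> complex set" where
  "spectrum V N T = {z. \<not> (\<exists>R. bounded_op V N R \<and>
     (\<forall>g\<in>V. N (\<lambda>x. z * R g x - T (R g) x - g x) = 0 \<and>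
            N (\<lambda>x. R (\<lambda>y. z * g y - T g y) x - g x) = 0))}"

text \<open>The inserted \<open>0\<close> only matters for the zero space, whose operators have empty spectrum.\<close>

definition spectral_radius ::
    "('a \<Rightarrow> complex) set \<Rightarrow> (('a \<Rightarrow> complex) \<Rightarrow> real) \<Rightarrow> (('a \<Rightarrow> complex) \<Rightarrow> 'a \<Rightarrow> complex) \<Rightarrow> real" where
  "spectral_radius V N T = Sup (insert 0 (cmod ` spectrum V N T))"

definition compact_op ::
    "('a \<Rightarrow> complex) set \<Rightarrow> (('a \<Rightarrow> complex) \<Rightarrow> real) \<Rightarrow> (('a \<Rightarrow> complex) \<Rightarrow> 'a \<Rightarrow> complex) \<Rightarrow> bool" where
  "compact_op V N K \<longleftrightarrow> bounded_op V N K \<and>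
     (\<forall>u::nat \<Rightarrow> 'a \<Rightarrow> complex. (\<forall>i. u i \<in> V \<and> N (u i) \<le> 1) \<longrightarrow>
        (\<exists>s h. strict_mono s \<and> h \<in> V \<and> (\<lambda>i. N (\<lambda>x. K (u (s i)) x - h x)) \<longlonglongrightarrow> 0))"

definition quasi_compact_op ::
    "('a \<Rightarrow> complex) set \<Rightarrow> (('a \<Rightarrow> complex) \<Rightarrow> real) \<Rightarrow> (('a \<Rightarrow> complex) \<Rightarrow> 'a \<Rightarrow> complex) \<Rightarrow> bool" where
  "quasi_compact_op V N T \<longleftrightarrow> bounded_op V N T \<and>
     (\<exists>n\<ge>1. \<exists>K \<delta>. compact_op V N K \<and> \<delta> < spectral_radius V N T ^ n \<and>
        (\<forall>g\<in>V. N (\<lambda>x. (T ^^ n) g x - K g x) \<le> \<delta> * N g))"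

definition closed_subspace ::
    "('a \<Rightarrow> complex) set \<Rightarrow> (('a \<Rightarrow> complex) \<Rightarrow> real) \<Rightarrow> ('a \<Rightarrow> complex) set \<Rightarrow> bool" where
  "closed_subspace V N B \<longleftrightarrow> B \<subseteq> V \<and> (\<lambda>_. 0) \<in> B \<and>
     (\<forall>g\<in>B. \<forall>h\<in>B. (\<lambda>x. g x + h x) \<in> B) \<and> (\<forall>a. \<forall>g\<in>B. (\<lambda>x. a * g x) \<in> B) \<and>
     (\<forall>u h. (\<forall>i::nat. u i \<in> B) \<and> h \<in> V \<and> (\<lambda>i. N (\<lambda>x. u i x - h x)) \<longlonglongrightarrow> 0 \<longrightarrow> h \<in> B)"

definition has_spectral_gap ::
    "('a \<Rightarrow> complex) set \<Rightarrow> (('a \<Rightarrow> complex) \<Rightarrow> real) \<Rightarrow> (('a \<Rightarrow> complex) \<Rightarrow> 'a \<Rightarrow> complex) \<Rightarrow> bool" where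
  "has_spectral_gap V N T \<longleftrightarrow> bounded_op V N T \<and>
     (\<exists>B0 B1. closed_subspace V N B0 \<and> closed_subspace V N B1 \<and>
        (\<forall>g\<in>V. \<exists>g0\<in>B0. \<exists>g1\<in>B1. N (\<lambda>x. g x - (g0 x + g1 x)) = 0) \<and>
        (\<forall>g\<in>B0 \<inter> B1. N g = 0) \<and>
        T ` B0 \<subseteq> B0 \<and> T ` B1 \<subseteq> B1 \<and>
        (\<exists>h\<in>B0. N h \<noteq> 0 \<and> (\<forall>g\<in>B0. \<exists>a. N (\<lambda>x. g x - a * h x) = 0)) \<and>
        (\<exists>\<kappa>. spectrum B0 N T = {\<kappa>} \<and> cmod \<kappa> = spectral_radius V N T) \<and>
        spectral_radius B1 N T < spectral_radius V N T)"

section \<open>Transfer operator and the spaces of bounded variation\<close>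

definition transfer :: "('a \<Rightarrow> 'a) \<Rightarrow> ('a \<Rightarrow> real) \<Rightarrow> ('a \<Rightarrow> 'b::real_vector) \<Rightarrow> 'a \<Rightarrow> 'b" where
  "transfer f \<phi> g x = (\<Sum>y\<in>f -` {x}. exp (\<phi> y) *\<^sub>R g y)"

definition Linf_norm :: "'a measure \<Rightarrow> ('a \<Rightarrow> 'b::real_normed_vector) \<Rightarrow> ennreal" where
  "Linf_norm \<nu> g = esssup \<nu> (\<lambda>x. ennreal (norm (g x)))"

definition ess_osc :: "'a measure \<Rightarrow> ('a \<Rightarrow> 'b::real_normed_vector) \<Rightarrow> 'a set \<Rightarrow> ennreal" where
  "ess_osc \<nu> g E = esssup (restrict_space (\<nu> \<Otimes>\<^sub>M \<nu>) (E \<times> E)) (\<lambda>(x, y). ennreal (norm (g x - g y)))"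

definition S_sup :: "('a \<Rightarrow> 'a) \<Rightarrow> ('a \<Rightarrow> real) \<Rightarrow> nat \<Rightarrow> 'a set \<Rightarrow> real" where
  "S_sup f \<phi> n C = (SUP x\<in>C. \<Sum>j<n. \<phi> ((f ^^ j) x))"

text \<open>In the sum over \<open>n \<ge> 1\<close> the summation index is shifted by one.\<close>

definition var_theta ::
    "('a \<Rightarrow> 'a) \<Rightarrow> ('a \<Rightarrow> real) \<Rightarrow> 'a set set \<Rightarrow> 'a measure \<Rightarrow> real \<Rightarrow> ('a \<Rightarrow> 'b::real_normed_vector) \<Rightarrow> ennreal" where
  "var_theta f \<phi> P \<nu> \<theta> g = (\<Sum>k. ennreal (\<theta> ^ Suc k) *
     (\<Sum>C\<in>dyn_join f P (Suc k). ennreal (exp (S_sup f \<phi> (Suc k) C)) * ess_osc \<nu> g C))"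

definition norm_theta ::
    "('a \<Rightarrow> 'a) \<Rightarrow> ('a \<Rightarrow> real) \<Rightarrow> 'a set set \<Rightarrow> 'a measure \<Rightarrow> real \<Rightarrow> ('a \<Rightarrow> 'b::real_normed_vector) \<Rightarrow> ennreal" where
  "norm_theta f \<phi> P \<nu> \<theta> g = Linf_norm \<nu> g + var_theta f \<phi> P \<nu> \<theta> g"

definition V_theta ::
    "('a \<Rightarrow> 'a) \<Rightarrow> ('a \<Rightarrow> real) \<Rightarrow> 'a set set \<Rightarrow> 'a measure \<Rightarrow> real \<Rightarrow> ('a \<Rightarrow> 'b::real_normed_vector) set" where
  "V_theta f \<phi> P \<nu> \<theta> = {g \<in> borel_measurable \<nu>. norm_theta f \<phi> P \<nu> \<theta> g < \<infinity>}"

section \<open>Standing assumptions\<close>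

text \<open>Logarithm with \<open>log 0 = -\<infinity>\<close>, since the number \<open>q\<close> of non-expanding domains may be \<open>0\<close>.\<close>

definition log_nat :: "nat \<Rightarrow> ereal" where
  "log_nat k = (if k = 0 then -\<infinity> else ereal (ln (real k)))"

definition total_osc :: "('a \<Rightarrow> real) \<Rightarrow> real" where
  "total_osc \<phi> = (SUP x. \<phi> x) - (INF x. \<phi> x)"

text \<open>The cylinders \<open>B(n, \<gamma>)\<close> that visit the non-expanding domains, whose union is \<open>W\<close>, too often.\<close>

definition bad_cylinders :: "('a \<Rightarrow> 'a) \<Rightarrow> 'a set set \<Rightarrow> 'a set \<Rightarrow> real \<Rightarrow> nat \<Rightarrow> 'a set set" where
  "bad_cylinders f P W \<gamma> n =
     {C \<in> dyn_join f P n. real (card {j. j < n \<and> (f ^^ j) ` C \<subseteq> W}) > \<gamma> * real n}"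

locale nonuniformly_expanding = riemannian_manifold atlas metric
  for atlas :: "('a::t2_space, 'e::euclidean_space) chart set"
    and metric :: "('a, 'e) chart \<Rightarrow> 'a \<Rightarrow> 'e \<Rightarrow> 'e \<Rightarrow> real" +
  fixes f :: "'a \<Rightarrow> 'a" and \<phi> :: "'a \<Rightarrow> real" and \<alpha> :: real and deg :: nat
    and p q :: nat and Q :: "nat \<Rightarrow> 'a set"
    and \<sigma> L \<epsilon>0 \<gamma> c \<tau> :: real
  assumes compact_M: "compact (UNIV :: 'a set)"
    and local_diffeo: "C1_local_diffeo f"
    and degree: "finite (f -` {x}) \<and> card (f -` {x}) = deg"
    and alpha: "\<alpha> > 0" and phi_holder: "holder \<alpha> \<phi>"
    and p: "p \<ge> 1"
    and Q_open: "i \<in> {1..q + p} \<Longrightarrow> open (Q i)"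
    and Q_disjoint: "disjoint_family_on Q {1..q + p}"
    and Q_cover: "(\<Union>i\<in>{1..q + p}. closure (Q i)) = UNIV"
    and Q_diameter: "i \<in> {1..q + p} \<Longrightarrow> finite_inner_diameter (closure (Q i))"
    and Q_homeo: "i \<in> {1..q + p} \<Longrightarrow> \<exists>g. homeomorphism (closure (Q i)) (f ` closure (Q i)) f g"
    and Q_markov: "i \<in> {1..q + p} \<Longrightarrow> j \<in> {1..q + p} \<Longrightarrow> f ` Q i \<inter> Q j \<noteq> {} \<Longrightarrow>
      Q j \<subseteq> f ` Q i \<and> closure (Q j) \<subseteq> f ` closure (Q i)"
    and Q_mixing: "\<exists>N\<ge>1. \<forall>i\<in>{1..q + p}. (f ^^ N) ` Q i = UNIV"
    and sigma: "\<sigma> > 1" and L_pos: "L > 0"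
    and expanding: "i \<in> {q + 1..q + p} \<Longrightarrow> x \<in> Q i \<Longrightarrow> inv_deriv_norm f x \<le> inverse \<sigma>"
    and not_too_contracting: "i \<in> {1..q} \<Longrightarrow> x \<in> Q i \<Longrightarrow> inv_deriv_norm f x \<le> L"
    and phi_small: "ereal (total_osc \<phi>) < log_nat deg - log_nat q"
    and eps0: "\<epsilon>0 > 0" "ereal (total_osc \<phi>) < log_nat deg - log_nat q - ereal \<epsilon>0"
    and phi_small': "total_osc \<phi> < 1/2 * (c * \<tau> - ln L) * \<alpha>"
    and gamma: "0 < \<gamma>" "\<gamma> < 1"
    \<comment> \<open>\<open>#B(n) \<le> exp (c\<^sub>\<gamma> n)\<close> in logarithmic form, so that \<open>c\<^sub>\<gamma> = -\<infinity>\<close> is allowed when \<open>q = 0\<close>\<close>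
    and gamma_count: "\<exists>c\<gamma> :: ereal. c\<gamma> \<le> log_nat q + ereal \<epsilon>0 \<and>
      (\<forall>\<^sub>F n in sequentially.
         log_nat (card (bad_cylinders f (Q ` {1..q + p}) (\<Union>i\<in>{1..q}. Q i) \<gamma> n)) \<le> c\<gamma> * ereal (real n))"
    and c: "c > 0" "\<sigma> powr (- (1 - \<gamma>)) < exp (- 2 * c)"
      "log_nat q + ereal (c * \<alpha> + \<epsilon>0) < log_nat deg"
    and L: "(ln L)\<^sup>2 \<le> 2 * c\<^sup>2" "\<sigma> powr (- (1 - \<gamma>)) * L powr \<gamma> < exp (- 2 * c)"
      "ereal (total_osc \<phi>) < log_nat deg - log_nat q - ereal (real DIM('e) * ln L)"
    and tau: "0 < \<tau>" "\<tau> < 1" "\<tau> \<ge> 2 * c / ln L"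
    and tau_hyperbolic: "n \<ge> 1 \<Longrightarrow>
      x \<notin> \<Union>(bad_cylinders f (Q ` {1..q + p}) (\<Union>i\<in>{1..q}. Q i) \<gamma> n) \<Longrightarrow>
      \<exists>T. finite T \<and> T \<subseteq> {1..} \<and> real (card T) > \<tau> * real n \<and>
        (\<forall>k\<in>T. \<exists>C\<in>hyperbolic_cylinders f (Q ` {1..q + p}) c k. x \<in> closure C)"

locale equilibrium_setting = nonuniformly_expanding atlas metric f \<phi> \<alpha> deg p q Q \<sigma> L \<epsilon>0 \<gamma> c \<tau>
  for atlas :: "('a::t2_space, 'e::euclidean_space) chart set"
    and metric :: "('a, 'e) chart \<Rightarrow> 'a \<Rightarrow> 'e \<Rightarrow> 'e \<Rightarrow> real"
    and f :: "'a \<Rightarrow> 'a" and \<phi> :: "'a \<Rightarrow> real" and \<alpha> :: real and deg :: nat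
    and p q :: nat and Q :: "nat \<Rightarrow> 'a set"
    and \<sigma> L \<epsilon>0 \<gamma> c \<tau> :: real +
  fixes \<nu> \<mu> :: "'a measure" and r :: real
  assumes nu_prob: "prob_space \<nu>" "sets \<nu> = sets borel"
    and r: "r = spectral_radius {g. continuous_on UNIV g} (\<lambda>g. SUP x. cmod (g x)) (transfer f \<phi>)"
    and nu_conformal: "continuous_on UNIV (g :: 'a \<Rightarrow> complex) \<Longrightarrow>
      (\<integral>x. transfer f \<phi> g x \<partial>\<nu>) = complex_of_real r * (\<integral>x. g x \<partial>\<nu>)"
    and nu_expanding: "AE x in \<nu>. infinite {n. \<exists>C\<in>hyperbolic_cylinders f (Q ` {1..q + p}) c n. x \<in> closure C}"
    and nu_bad: "\<exists>K \<kappa>. 0 < \<kappa> \<and> \<kappa> < 1 \<and> (\<forall>n.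
      measure \<nu> (\<Union>(bad_cylinders f (Q ` {1..q + p}) (\<Union>i\<in>{1..q}. Q i) \<gamma> n)) \<le> K * \<kappa> ^ n)"
    and mu_equilibrium: "equilibrium_state f \<phi> \<mu>"
    and mu_unique: "equilibrium_state f \<phi> \<eta> \<Longrightarrow> \<eta> = \<mu>"
    and mu_ac: "absolutely_continuous \<nu> \<mu>"
begin

text \<open>The seminorm and the space \<open>V\<^sub>\<theta>\<close>, for real- or complex-valued functions.\<close>

abbreviation theta_norm :: "real \<Rightarrow> ('a \<Rightarrow> 'b::real_normed_vector) \<Rightarrow> real" where
  "theta_norm \<theta> g \<equiv> enn2real (norm_theta f \<phi> (Q ` {1..q + p}) \<nu> \<theta> g)"

abbreviation theta_space :: "real \<Rightarrow> ('a \<Rightarrow> 'b::real_normed_vector) set" where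
  "theta_space \<theta> \<equiv> V_theta f \<phi> (Q ` {1..q + p}) \<nu> \<theta>"

end

locale spectral_gap_setting =
  equilibrium_setting atlas metric f \<phi> \<alpha> deg p q Q \<sigma> L \<epsilon>0 \<gamma> c \<tau> \<nu> \<mu> r
  for atlas :: "('a::t2_space, 'e::euclidean_space) chart set"
    and metric :: "('a, 'e) chart \<Rightarrow> 'a \<Rightarrow> 'e \<Rightarrow> 'e \<Rightarrow> real"
    and f :: "'a \<Rightarrow> 'a" and \<phi> :: "'a \<Rightarrow> real" and \<alpha> :: real and deg :: nat
    and p q :: nat and Q :: "nat \<Rightarrow> 'a set"
    and \<sigma> L \<epsilon>0 \<gamma> c \<tau> :: real
    and \<nu> \<mu> :: "'a measure" and r :: real +
  fixes \<theta> :: real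
  assumes theta_pos: "\<theta> > 0"
    and quasi_compact: "quasi_compact_op (theta_space \<theta>) (theta_norm \<theta>) (transfer f \<phi>)"
    and spectral_gap: "has_spectral_gap (theta_space \<theta>) (theta_norm \<theta>) (transfer f \<phi>)"
    and density: "(\<lambda>x. enn2real (RN_deriv \<nu> \<mu> x)) \<in> theta_space \<theta>"
    and decay_of_correlations: "\<exists>K \<xi>. K > 0 \<and> 0 < \<xi> \<and> \<xi> < 1 \<and>
      (\<forall>\<Phi> \<in> theta_space \<theta>. \<forall>\<Psi> :: 'a \<Rightarrow> real. integrable \<nu> \<Psi> \<longrightarrow> (\<forall>n.
         \<bar>(\<integral>x. \<Phi> x * \<Psi> ((f ^^ n) x) \<partial>\<mu>) - (\<integral>x. \<Phi> x \<partial>\<mu>) * (\<integral>x. \<Psi> x \<partial>\<mu>)\<bar>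
         \<le> K * \<xi> ^ n * theta_norm \<theta> \<Phi> * (\<integral>x. \<bar>\<Psi> x\<bar> \<partial>\<nu>)))"

section \<open>Asymptotic variance\<close>

text \<open>
  The usual (Green-Kubo) variance of the Birkhoff sums of the centred observable
  \<open>\<Phi> - \<integral>\<Phi> d\<mu>\<close>: squared \<open>L\<^sup>2\<close> norm plus twice the sum of the correlations.
\<close>

definition asymp_variance :: "('a \<Rightarrow> 'a) \<Rightarrow> 'a measure \<Rightarrow> ('a \<Rightarrow> real) \<Rightarrow> real" where
  "asymp_variance f \<mu> \<Phi> = (let \<Phi>0 = (\<lambda>x. \<Phi> x - (\<integral>y. \<Phi> y \<partial>\<mu>)) in
     (\<integral>x. (\<Phi>0 x)\<^sup>2 \<partial>\<mu>) + 2 * (\<Sum>k. \<integral>x. \<Phi>0 x * \<Phi>0 ((f ^^ Suc k) x) \<partial>\<mu>))"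

end

theory Submission
  imports Defs
begin

text \<open>
  Gordin's method, made to work with truncations only. Exponential decay against bounded functions
  says that the iterates \<open>G n\<close> of the centred observable \<open>g\<close> under the adjoint of the Koopman operator
  decay exponentially when tested against bounded functions. Hence \<open>\<Sum>\<^bsub>n \<le> N\<^esub> G n\<close> splits \<open>g\<close> into a bounded
  reverse martingale difference, a bounded coboundary, and a remainder whose normalised Birkhoff
  sums are small in \<open>L\<^sup>2\<close> uniformly in time. The martingale part obeys the central limit theorem by
  McLeish's product argument and the ergodic theorem, and its variance tends to the Green-Kubo sum
  as \<open>N\<close> grows; if that limit vanishes, \<open>\<Sum>\<^sub>n G n\<close> converges almost everywhere to a transfer function.
  Ergodicity of \<open>\<mu>\<close> comes from uniqueness of the equilibrium state.
\<close>

section \<open>The ergodic theorem\<close>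

text \<open>Correlations are controlled by the L^1(\<nu>) norm of the second function. Without a
  lower bound on d\<mu>/d\<nu> this gives decay of \<open>G n\<close> in L^1(\<mu>) but not in the
  sup norm, where only the constant bound \<open>B\<close> inherited from \<open>g\<close> survives.
  The full series of the \<open>G n\<close> therefore converges almost everywhere with no bound on
  its sum, whereas the product argument wants bounded differences. This forces the truncation at
  \<open>N\<close> and the order of choices: \<open>N\<close> is fixed first, from estimates uniform
  in time, and only then does time tend to infinity. The transfer function found when the variance
  vanishes is merely measurable, so the converse facts about coboundaries go through characteristic
  functions, which make sense for every measurable function.\<close>

locale measure_preserving = prob_space M for M :: "'a measure" +
  fixes T :: "'a \<Rightarrow> 'a"
  assumes T_measurable [measurable]: "T \<in> measurable M M"
    and T_invariant: "distr M M T = M"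
begin

lemma T_space: "x \<in> space M \<Longrightarrow> T x \<in> space M"
  using measurable_space[OF T_measurable] .

lemma T_funpow_measurable [measurable]: "T ^^ n \<in> measurable M M"
  by (induction n) (auto simp: id_def)

lemma AE_T: "AE x in M. P x \<Longrightarrow> AE x in M. P (T x)"
  using AE_distrD[OF T_measurable, of P, unfolded T_invariant] by blast

lemma AE_T_funpow: "AE x in M. P x \<Longrightarrow> AE x in M. P ((T ^^ n) x)"
proof (induction n)
  case (Suc n)
  from AE_T[OF Suc.IH[OF Suc.prems]] show ?case by (simp add: funpow_swap1)
qed simp

lemma integral_T:
  fixes g :: "'a \<Rightarrow> 'b::{banach, second_countable_topology}"
  assumes [measurable]: "g \<in> borel_measurable M"
  shows "(\<integral>x. g (T x) \<partial>M) = (\<integral>x. g x \<partial>M)"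
  using integral_distr[OF T_measurable, of g] by (simp add: T_invariant)

lemma integrable_T:
  fixes g :: "'a \<Rightarrow> 'b::{banach, second_countable_topology}"
  assumes "integrable M g"
  shows "integrable M (\<lambda>x. g (T x))"
  using integrable_distr[OF T_measurable, of g] assms by (simp add: T_invariant)

lemma integral_T_funpow:
  fixes g :: "'a \<Rightarrow> 'b::{banach, second_countable_topology}"
  assumes [measurable]: "g \<in> borel_measurable M"
  shows "(\<integral>x. g ((T ^^ n) x) \<partial>M) = (\<integral>x. g x \<partial>M)"
proof (induction n)
  case (Suc n)
  have "(\<integral>x. g ((T ^^ Suc n) x) \<partial>M) = (\<integral>x. g ((T ^^ n) (T x)) \<partial>M)"
    by (simp add: funpow_swap1)
  also have "\<dots> = (\<integral>x. g ((T ^^ n) x) \<partial>M)"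
    by (rule integral_T) simp
  finally show ?case using Suc by simp
qed simp

lemma integrable_T_funpow:
  fixes g :: "'a \<Rightarrow> 'b::{banach, second_countable_topology}"
  assumes "integrable M g"
  shows "integrable M (\<lambda>x. g ((T ^^ n) x))"
proof (induction n)
  case (Suc n)
  from integrable_T[OF this] show ?case by (simp add: funpow_swap1)
qed (simp add: assms)

section \<open>Birkhoff sums and their running maxima\<close>

definition bsum :: "('a \<Rightarrow> 'b::comm_monoid_add) \<Rightarrow> nat \<Rightarrow> 'a \<Rightarrow> 'b" where
  "bsum u n x = (\<Sum>j<n. u ((T ^^ j) x))"

lemma bsum_Suc: "bsum u (Suc n) x = u x + bsum u n (T x)"
  unfolding bsum_def by (subst sum.lessThan_Suc_shift) (simp add: funpow_swap1)

lemma bsum_measurable [measurable]: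
  fixes u :: "'a \<Rightarrow> real"
  assumes [measurable]: "u \<in> borel_measurable M"
  shows "bsum u n \<in> borel_measurable M"
  unfolding bsum_def by measurable

text \<open>This is the maximum of \<open>bsum u k x\<close> over 1 \<le> k \<le> n + 1. The
  recursion replaces the maximum over a range because it exposes the increment along the orbit,
  \<open>bmax u (Suc n) x - bmax u n (T x)\<close>.\<close>

primrec bmax :: "('a \<Rightarrow> real) \<Rightarrow> nat \<Rightarrow> 'a \<Rightarrow> real" where
  "bmax u 0 x = u x"
| "bmax u (Suc n) x = u x + max 0 (bmax u n (T x))"

lemma bsum_le_bmax: "bsum u (Suc n) x \<le> bmax u n x"
proof (induction n arbitrary: x)
  case (Suc n)
  show ?case
    by (subst bsum_Suc) (use Suc[of "T x"] in auto)
qed (simp add: bsum_def)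

lemma bmax_mono_Suc: "bmax u n x \<le> bmax u (Suc n) x"
proof (induction n arbitrary: x)
  case (Suc n)
  show ?case using Suc[of "T x"] by simp
qed simp

lemma bmax_mono: "m \<le> n \<Longrightarrow> bmax u m x \<le> bmax u n x"
  using lift_Suc_mono_le[of "\<lambda>n. bmax u n x"] bmax_mono_Suc by blast

lemma bmax_measurable [measurable]:
  assumes [measurable]: "u \<in> borel_measurable M"
  shows "bmax u n \<in> borel_measurable M"
proof (induction n)
  case 0
  have "bmax u 0 = u" by (rule ext) simp
  then show ?case by simp
next
  case (Suc n)
  note Suc[measurable]
  have "bmax u (Suc n) = (\<lambda>x. u x + max 0 (bmax u n (T x)))" by (rule ext) simp
  then show ?case by simp
qed

lemma bmax_integrable:
  assumes "integrable M u"
  shows "integrable M (bmax u n)"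
proof (induction n)
  case 0
  have "bmax u 0 = u" by (rule ext) simp
  then show ?case using assms by simp
next
  case (Suc n)
  have "bmax u (Suc n) = (\<lambda>x. u x + max 0 (bmax u n (T x)))" by (rule ext) simp
  then show ?case using assms integrable_T[OF Suc] by simp
qed

end

locale ergodic = measure_preserving +
  assumes ergodic: "A \<in> sets M \<Longrightarrow> T -` A \<inter> space M = A \<Longrightarrow> prob A = 0 \<or> prob A = 1"
begin

text \<open>On the invariant set where the running maximum diverges, its increments
  \<open>bmax u (Suc n) - bmax u n \<circ> T\<close> decrease to \<open>u\<close> and have nonnegative integral.\<close>

lemma bsum_bounded_above:
  fixes u :: "'a \<Rightarrow> real"
  assumes u: "integrable M u" and neg: "(\<integral>x. u x \<partial>M) < 0"
  shows "AE x in M. \<exists>K. \<forall>n. bsum u n x \<le> K"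
proof -
  have [measurable]: "u \<in> borel_measurable M" using u by auto
  define A where "A = {x \<in> space M. \<forall>k::nat. \<exists>n. bmax u n x > real k}"
  have A[measurable]: "A \<in> sets M" unfolding A_def by measurable
  have inv: "T x \<in> A \<longleftrightarrow> x \<in> A" if x: "x \<in> space M" for x
  proof
    assume *: "T x \<in> A"
    show "x \<in> A" unfolding A_def
    proof (safe intro!: x)
      fix k :: nat
      obtain k' :: nat where k': "real k - u x \<le> real k'" using real_arch_simple by blast
      obtain n where "bmax u n (T x) > real k'" using * unfolding A_def by blast
      then have "bmax u (Suc n) x > real k" using k' by simp
      then show "\<exists>n. bmax u n x > real k" by blast
    qed
  next
    assume *: "x \<in> A"
    show "T x \<in> A" unfolding A_def
    proof (safe intro!: T_space x)
      fix k :: nat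
      obtain k' :: nat where k': "real k + \<bar>u x\<bar> \<le> real k'" using real_arch_simple by blast
      obtain n where n: "bmax u n x > real k'" using * unfolding A_def by blast
      with bmax_mono_Suc[of u n x] have "bmax u (Suc n) x > real k'" by linarith
      then have "max 0 (bmax u n (T x)) > real k" using k' by simp
      then have "bmax u n (T x) > real k" by (auto simp: max_def split: if_splits)
      then show "\<exists>n. bmax u n (T x) > real k" by blast
    qed
  qed
  have Ainv: "T -` A \<inter> space M = A"
    using inv sets.sets_into_space[OF A] by auto
  have indT: "indicator A (T x) = (indicator A x :: real)" if "x \<in> space M" for x
    using inv[OF that] by (simp add: indicator_def)
  \<comment> \<open>On \<open>A\<close> this is the increment
    \<open>bmax u (Suc n) x - bmax u n (T x)\<close>, because max 0 b - b = max 0 (- b). Its second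
    term is at most \<open>\<bar>u (T x)\<bar>\<close>, since the running maximum starts at
    \<open>u\<close>, and it vanishes once the running maximum at \<open>T x\<close> is
    positive.\<close>
  define D where "D n x = indicator A x * (u x + max 0 (- bmax u n (T x)))" for n x
  have Dge: "0 \<le> (\<integral>x. D n x \<partial>M)" for n
  proof -
    have i1: "integrable M (\<lambda>x. indicator A x * bmax u n x)" for n
      using integrable_mult_indicator[OF A bmax_integrable[OF u], of n] by simp
    have i2: "integrable M (\<lambda>x. indicator A x * bmax u n (T x))" for n
      using integrable_mult_indicator[OF A integrable_T[OF bmax_integrable[OF u]], of n] by simp
    have e: "(\<integral>x. indicator A x * bmax u n (T x) \<partial>M) = (\<integral>x. indicator A x * bmax u n x \<partial>M)"
    proof -
      have "(\<integral>x. indicator A x * bmax u n (T x) \<partial>M) = (\<integral>x. indicator A (T x) * bmax u n (T x) \<partial>M)"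
        by (rule Bochner_Integration.integral_cong) (auto simp: indT)
      also have "\<dots> = (\<integral>x. indicator A x * bmax u n x \<partial>M)"
        by (rule integral_T[where g = "\<lambda>x. indicator A x * bmax u n x"]) measurable
      finally show ?thesis .
    qed
    have "(\<integral>x. D n x \<partial>M) = (\<integral>x. indicator A x * bmax u (Suc n) x - indicator A x * bmax u n (T x) \<partial>M)"
      unfolding D_def by (rule Bochner_Integration.integral_cong) (auto simp: max_def algebra_simps)
    also have "\<dots> = (\<integral>x. indicator A x * bmax u (Suc n) x \<partial>M) - (\<integral>x. indicator A x * bmax u n x \<partial>M)"
      by (subst Bochner_Integration.integral_diff[OF i1 i2]) (simp add: e)
    also have "\<dots> \<ge> 0"
      using integral_mono[OF i1 i1, of n "Suc n"] bmax_mono_Suc[of u n]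
      by (simp add: mult_left_mono)
    finally show ?thesis .
  qed
  have "(\<lambda>n. \<integral>x. D n x \<partial>M) \<longlonglongrightarrow> (\<integral>x. indicator A x * u x \<partial>M)"
  proof (rule integral_dominated_convergence[where w = "\<lambda>x. \<bar>u x\<bar> + \<bar>u (T x)\<bar>"])
    show "(\<lambda>x. indicator A x * u x) \<in> borel_measurable M" by measurable
    show "D n \<in> borel_measurable M" for n unfolding D_def by measurable
    show "integrable M (\<lambda>x. \<bar>u x\<bar> + \<bar>u (T x)\<bar>)"
      using u integrable_T[OF u] by auto
    show "AE x in M. norm (D n x) \<le> \<bar>u x\<bar> + \<bar>u (T x)\<bar>" for n
    proof (rule AE_I2)
      fix x
      have "u (T x) \<le> bmax u n (T x)" using bmax_mono[of 0 n u "T x"] by simp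
      then show "norm (D n x) \<le> \<bar>u x\<bar> + \<bar>u (T x)\<bar>"
        unfolding D_def by (auto simp: indicator_def max_def)
    qed
    show "AE x in M. (\<lambda>n. D n x) \<longlonglongrightarrow> indicator A x * u x"
    proof (rule AE_I2)
      fix x assume x: "x \<in> space M"
      show "(\<lambda>n. D n x) \<longlonglongrightarrow> indicator A x * u x"
      proof (cases "x \<in> A")
        case True
        then have "T x \<in> A" using inv x by auto
        then obtain n0 where "bmax u n0 (T x) > 0" unfolding A_def by (auto dest!: spec[of _ 0])
        then have "\<And>n. n \<ge> n0 \<Longrightarrow> bmax u n (T x) > 0"
          using bmax_mono[of n0 _ u "T x"] by (meson less_le_trans)
        then have "eventually (\<lambda>n. D n x = indicator A x * u x) sequentially"
          unfolding D_def eventually_sequentially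
          by (intro exI[of _ n0]) (simp add: max_absorb1 less_imp_le)
        then show ?thesis by (rule tendsto_eventually)
      qed (simp add: D_def)
    qed
  qed
  then have nonneg: "0 \<le> (\<integral>x. indicator A x * u x \<partial>M)"
    by (rule LIMSEQ_le_const) (use Dge in auto)
  \<comment> \<open>On a set of full measure the nonnegative integral just obtained would be that of
    \<open>u\<close>, which is negative.\<close>
  have "prob A \<noteq> 1"
  proof
    assume "prob A = 1"
    then have "AE x in M. x \<in> A" by (simp add: prob_eq_1)
    then have "(\<integral>x. indicator A x * u x \<partial>M) = (\<integral>x. u x \<partial>M)"
      by (intro integral_cong_AE) auto
    with nonneg neg show False by simp
  qed
  then have "prob A = 0" using ergodic[OF A Ainv] by simp
  then have "AE x in M. x \<notin> A" using A by (simp add: prob_eq_0)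
  then show ?thesis
    using AE_space
  proof eventually_elim
    case (elim x)
    then obtain k :: nat where k: "\<And>n. bmax u n x \<le> real k"
      unfolding A_def by (auto simp: not_less)
    have "bsum u n x \<le> real k" for n
    proof (cases n)
      case (Suc m)
      then show ?thesis using order_trans[OF bsum_le_bmax k, of m] by simp
    qed (simp add: bsum_def)
    then show ?case by blast
  qed
qed

text \<open>After subtraction of the mean and of a further 1/(k+1) the integral is negative, so the
  Birkhoff sums are bounded above, and the bound disappears on division by \<open>n\<close>. Only
  countably many margins are used, so that one null set serves every \<open>e\<close>.\<close>

lemma bsum_upper:
  fixes u :: "'a \<Rightarrow> real"
  assumes u: "integrable M u"
  shows "AE x in M. \<forall>e>0. eventually (\<lambda>n. bsum u n x / real n < (\<integral>y. u y \<partial>M) + e) sequentially"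
proof -
  let ?c = "\<integral>y. u y \<partial>M"
  have "AE x in M. \<forall>k::nat. \<exists>K. \<forall>n. bsum (\<lambda>y. u y - ?c - 1 / real (Suc k)) n x \<le> K"
    by (subst AE_all_countable, intro allI bsum_bounded_above) (use u in \<open>auto simp: prob_space\<close>)
  then show ?thesis
  proof eventually_elim
    case (elim x)
    show ?case
    proof (intro allI impI)
      fix e :: real assume e: "e > 0"
      obtain k :: nat where k: "1 / real (Suc k) < e / 2"
        using nat_approx_posE[of "e / 2"] e by auto
      obtain K where K: "\<And>n. bsum (\<lambda>y. u y - ?c - 1 / real (Suc k)) n x \<le> K"
        using elim by blast
      have S: "bsum u n x \<le> K + real n * (?c + e / 2)" for n
      proof -
        have "bsum (\<lambda>y. u y - ?c - 1 / real (Suc k)) n x = bsum u n x - real n * (?c + 1 / real (Suc k))"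
          unfolding bsum_def by (simp add: sum_subtractf algebra_simps)
        moreover have "real n * (?c + 1 / real (Suc k)) \<le> real n * (?c + e / 2)"
          using k by (intro mult_left_mono) auto
        ultimately show ?thesis using K[of n] by linarith
      qed
      have "eventually (\<lambda>n. real n > 2 * \<bar>K\<bar> / e \<and> n > 0) sequentially"
        by (intro eventually_conj eventually_gt_at_top)
           (use filterlim_real_sequentially filterlim_at_top_dense in blast)
      then show "eventually (\<lambda>n. bsum u n x / real n < ?c + e) sequentially"
      proof eventually_elim
        case (elim n)
        then have "\<bar>K\<bar> < real n * (e / 2)" using e by (simp add: field_simps)
          then have "K < real n * (e / 2)" by linarith
        then have "bsum u n x < real n * (?c + e)" using S[of n] by (simp add: algebra_simps)
        then show ?case using elim by (simp add: field_simps)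
      qed
    qed
  qed
qed

theorem birkhoff:
  fixes u :: "'a \<Rightarrow> real"
  assumes u: "integrable M u"
  shows "AE x in M. (\<lambda>n. bsum u n x / real n) \<longlonglongrightarrow> (\<integral>y. u y \<partial>M)"
proof -
  have "integrable M (\<lambda>x. - u x)" using u by simp
  from bsum_upper[OF u] bsum_upper[OF this] show ?thesis
  proof eventually_elim
    case (elim x)
    show ?case
    proof (rule order_tendstoI)
      fix a assume "a < (\<integral>y. u y \<partial>M)"
      then have "eventually (\<lambda>n. bsum (\<lambda>x. - u x) n x / real n < (\<integral>y. - u y \<partial>M) + ((\<integral>y. u y \<partial>M) - a)) sequentially"
        using elim(2)[rule_format, of "(\<integral>y. u y \<partial>M) - a"] by simp
      then show "eventually (\<lambda>n. a < bsum u n x / real n) sequentially"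
        by eventually_elim (simp add: bsum_def sum_negf)
    next
      fix a assume "(\<integral>y. u y \<partial>M) < a"
      with elim(1)[rule_format, of "a - (\<integral>y. u y \<partial>M)"]
      show "eventually (\<lambda>n. bsum u n x / real n < a) sequentially" by simp
    qed
  qed
qed

end

section \<open>Central limit theorem for bounded reverse martingale differences\<close>

lemma exp_minus_approx:
  fixes z :: real
  assumes "0 \<le> z"
  shows "\<bar>exp (- z) - (1 - z)\<bar> \<le> z\<^sup>2 / 2"
proof -
  have pos: "0 < 1 + z + z\<^sup>2 / 2" using assms by (intro add_pos_nonneg) auto
  have "exp (- z) = inverse (exp z)" by (simp add: exp_minus)
  also have "\<dots> \<le> inverse (1 + z + z\<^sup>2 / 2)"
    using exp_lower_Taylor_quadratic[OF assms] pos by (intro le_imp_inverse_le) auto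
  also have "\<dots> \<le> 1 - z + z\<^sup>2 / 2"
  proof -
    have "(1 - z + z\<^sup>2 / 2) * (1 + z + z\<^sup>2 / 2) = 1 + (z\<^sup>2)\<^sup>2 / 4"
      by (simp add: algebra_simps power2_eq_square)
    then have "1 \<le> (1 - z + z\<^sup>2 / 2) * (1 + z + z\<^sup>2 / 2)" by simp
    then show ?thesis using pos by (simp add: field_simps)
  qed
  finally have "exp (- z) \<le> 1 - z + z\<^sup>2 / 2" .
  moreover have "1 - z \<le> exp (- z)" using exp_ge_add_one_self[of "- z"] by simp
  ultimately show ?thesis by (simp add: abs_le_iff)
qed

lemma norm_one_plus_ii: "cmod (1 + \<i> * of_real y) = sqrt (1 + y\<^sup>2)"
  by (simp add: cmod_def)

text \<open>Two products can be compared factor by factor only if the factors lie in the unit disc.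
  The factor 1 + iy lies outside it, but its modulus is at most exp (y^2/2), which the Gaussian
  factor cancels.\<close>

lemma norm_mcleish_factor_le_1: "cmod ((1 + \<i> * of_real y) * of_real (exp (- y\<^sup>2 / 2))) \<le> 1"
proof -
  have "cmod ((1 + \<i> * of_real y) * of_real (exp (- y\<^sup>2 / 2))) = sqrt (1 + y\<^sup>2) * exp (- y\<^sup>2 / 2)"
    by (simp add: norm_mult norm_one_plus_ii)
  also have "\<dots> \<le> sqrt (exp (y\<^sup>2)) * exp (- y\<^sup>2 / 2)"
    using exp_ge_add_one_self[of "y\<^sup>2"] by (intro mult_right_mono) auto
  also have "sqrt (exp (y\<^sup>2)) = exp (y\<^sup>2 / 2)"
    by (rule real_sqrt_unique) (simp_all add: power2_eq_square flip: exp_add)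
  finally show ?thesis by (simp flip: exp_add)
qed

text \<open>The Gaussian factor supplies the missing quadratic term - y^2/2 of the exponential. The
  cubic errors are 1/6 from Taylor's formula, 1/2 from the product of iy with y^2/2, and 1/4 from
  the expansion of the Gaussian factor, in total 11/12.\<close>

lemma iexp_mcleish_approx:
  assumes y: "\<bar>y\<bar> \<le> 1"
  shows "cmod (iexp y - (1 + \<i> * of_real y) * of_real (exp (- y\<^sup>2 / 2))) \<le> \<bar>y\<bar> ^ 3"
proof -
  define e where "e = exp (- (y\<^sup>2 / 2)) - (1 - y\<^sup>2 / 2)"
  have e: "\<bar>e\<bar> \<le> \<bar>y\<bar> ^ 4 / 8"
    using exp_minus_approx[of "y\<^sup>2 / 2"] unfolding e_def
    by (simp add: power_divide flip: power_mult)
  have 1: "cmod (iexp y - (\<Sum>k\<le>2. (\<i> * of_real y) ^ k / fact k)) \<le> \<bar>y\<bar> ^ 3 / 6"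
    using iexp_approx1[of y 2] by (simp add: eval_nat_numeral)
  have eq: "iexp y - (1 + \<i> * of_real y) * of_real (exp (- y\<^sup>2 / 2)) =
     (iexp y - (\<Sum>k\<le>2. (\<i> * of_real y) ^ k / fact k)) + (\<i> * of_real (y ^ 3 / 2)
       - (1 + \<i> * of_real y) * of_real e)"
    by (simp add: e_def eval_nat_numeral algebra_simps)
  have "cmod (iexp y - (1 + \<i> * of_real y) * of_real (exp (- y\<^sup>2 / 2)))
      \<le> \<bar>y\<bar> ^ 3 / 6 + (cmod (\<i> * of_real (y ^ 3 / 2)) + cmod ((1 + \<i> * of_real y) * of_real e))"
    unfolding eq by (intro norm_triangle_mono[OF 1] norm_triangle_ineq4)
  also have "cmod (\<i> * of_real (y ^ 3 / 2)) = \<bar>y\<bar> ^ 3 / 2"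
    by (simp add: norm_mult norm_divide norm_power)
  also have "cmod ((1 + \<i> * of_real y) * of_real e) \<le> 2 * (\<bar>y\<bar> ^ 3 / 8)"
  proof -
    have "cmod (1 + \<i> * of_real y) \<le> cmod 1 + cmod (\<i> * of_real y)" by (rule norm_triangle_ineq)
    also have "\<dots> \<le> 2" using y by (simp add: norm_mult)
    finally have "cmod (1 + \<i> * of_real y) \<le> 2" .
    moreover have "\<bar>e\<bar> \<le> \<bar>y\<bar> ^ 3 / 8"
      using e power_decreasing[of 3 4 "\<bar>y\<bar>"] y by simp
    ultimately show ?thesis unfolding norm_mult norm_of_real by (intro mult_mono) auto
  qed
  also have "\<bar>y\<bar> ^ 3 / 6 + (\<bar>y\<bar> ^ 3 / 2 + 2 * (\<bar>y\<bar> ^ 3 / 8)) \<le> \<bar>y\<bar> ^ 3" by simp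
  finally show ?thesis by simp
qed

lemma iexp_sum: "finite A \<Longrightarrow> iexp (\<Sum>j\<in>A. y j) = (\<Prod>j\<in>A. iexp (y j))"
  by (simp add: exp_sum sum_distrib_left)

text \<open>For \<open>b\<close> of order 1/sqrt n the error is again of order 1/sqrt n.\<close>

lemma iexp_sum_approx:
  fixes y :: "nat \<Rightarrow> real"
  assumes y: "\<And>j. \<bar>y j\<bar> \<le> b" and b: "b \<le> 1"
  shows "cmod (iexp (\<Sum>j<n. y j) - (\<Prod>j<n. 1 + \<i> * of_real (y j)) * of_real (exp (- (\<Sum>j<n. (y j)\<^sup>2) / 2)))
    \<le> real n * b ^ 3"
proof -
  have "of_real (exp (- (\<Sum>j<n. (y j)\<^sup>2) / 2)) = (\<Prod>j<n. complex_of_real (exp (- (y j)\<^sup>2 / 2)))"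
    by (simp add: exp_sum sum_divide_distrib flip: of_real_prod sum_negf)
  then have "cmod (iexp (\<Sum>j<n. y j) - (\<Prod>j<n. 1 + \<i> * of_real (y j)) * of_real (exp (- (\<Sum>j<n. (y j)\<^sup>2) / 2)))
     = cmod ((\<Prod>j<n. iexp (y j)) - (\<Prod>j<n. (1 + \<i> * of_real (y j)) * of_real (exp (- (y j)\<^sup>2 / 2))))"
    by (simp only: iexp_sum[OF finite_lessThan] prod.distrib)
  also have "\<dots> \<le> (\<Sum>j<n. cmod (iexp (y j) - (1 + \<i> * of_real (y j)) * of_real (exp (- (y j)\<^sup>2 / 2))))"
    by (rule norm_prod_diff[OF _ norm_mcleish_factor_le_1]) simp
  also have "\<dots> \<le> (\<Sum>j<n. b ^ 3)"
  proof (rule sum_mono)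
    fix j
    have "cmod (iexp (y j) - (1 + \<i> * of_real (y j)) * of_real (exp (- (y j)\<^sup>2 / 2))) \<le> \<bar>y j\<bar> ^ 3"
      using y[of j] b by (intro iexp_mcleish_approx) linarith
    also have "\<dots> \<le> b ^ 3" using y[of j] by (intro power_mono) auto
    finally show "cmod (iexp (y j) - (1 + \<i> * of_real (y j)) * of_real (exp (- (y j)\<^sup>2 / 2))) \<le> b ^ 3" .
  qed
  finally show ?thesis by simp
qed

text \<open>For \<open>b\<close> of order 1/sqrt n the bound does not grow with \<open>n\<close>.
  This yields the dominating constant for the limit passage.\<close>

lemma mcleish_product_norm_le:
  assumes "\<And>j. \<bar>y j\<bar> \<le> b"
  shows "cmod (\<Prod>j<n. 1 + \<i> * of_real (y j)) \<le> exp (real n * b\<^sup>2)"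
proof -
  have "cmod (\<Prod>j<n. 1 + \<i> * of_real (y j)) = (\<Prod>j<n. sqrt (1 + (y j)\<^sup>2))"
    by (simp add: norm_one_plus_ii flip: prod_norm)
  also have "\<dots> \<le> (\<Prod>j<n. exp (b\<^sup>2))"
  proof (rule prod_mono, safe)
    fix j
    have "sqrt (1 + (y j)\<^sup>2) \<le> 1 + (y j)\<^sup>2"
      by (rule real_le_lsqrt) (auto intro!: self_le_power)
    also have "\<dots> \<le> 1 + b\<^sup>2" using assms[of j] by (simp add: abs_le_square_iff[symmetric])
    also have "\<dots> \<le> exp (b\<^sup>2)" by (rule exp_ge_add_one_self)
    finally show "sqrt (1 + (y j)\<^sup>2) \<le> exp (b\<^sup>2)" .
  qed simp
  finally show ?thesis by (simp add: exp_of_nat_mult)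
qed

context measure_preserving
begin

text \<open>Reverse martingale differences for the decreasing filtration of the \<open>\<sigma>\<close>-algebras \<open>T\<^sup>-\<^sup>n M\<close>.\<close>

definition reverse_mds :: "('a \<Rightarrow> real) \<Rightarrow> bool" where
  "reverse_mds X \<longleftrightarrow> (\<forall>\<Psi>\<in>borel_measurable M. \<forall>K. (\<forall>x. \<bar>\<Psi> x\<bar> \<le> K) \<longrightarrow> (\<integral>x. X x * \<Psi> (T x) \<partial>M) = 0)"

lemma reverse_mds_complex:
  fixes F :: "'a \<Rightarrow> complex"
  assumes X: "X \<in> borel_measurable M" "\<And>x. \<bar>X x\<bar> \<le> B" "reverse_mds X"
    and F: "F \<in> borel_measurable M" "\<And>x. cmod (F x) \<le> K"
  shows "(\<integral>x. of_real (X x) * F (T x) \<partial>M) = 0"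
proof -
  note [measurable] = X(1) F(1)
  have B0: "0 \<le> B" using X(2)[of undefined] by simp
  have i: "integrable M (\<lambda>x. of_real (X x) * F (T x))"
    by (rule integrable_const_bound[of _ "B * K"])
       (auto simp: norm_mult intro!: mult_mono X(2) F(2) B0)
  have "(\<integral>x. X x * Re (F (T x)) \<partial>M) = 0"
    using X(3)[unfolded reverse_mds_def, rule_format, of "\<lambda>x. Re (F x)" K] F(2) abs_Re_le_cmod order_trans
    by (auto simp: borel_measurable_Re) blast
  moreover have "(\<integral>x. X x * Im (F (T x)) \<partial>M) = 0"
    using X(3)[unfolded reverse_mds_def, rule_format, of "\<lambda>x. Im (F x)" K] F(2) abs_Im_le_cmod order_trans
    by (auto simp: borel_measurable_Im) blast
  ultimately show ?thesis
    using integral_Re[OF i] integral_Im[OF i] by (simp add: complex_eq_iff)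
qed

text \<open>Every factor except the one for j = 0 depends on \<open>x\<close> only through
  \<open>T x\<close>. Splitting off that factor leaves \<open>F (T x)\<close> plus a multiple of
  \<open>X x * F (T x)\<close>, whose integral vanishes by the reverse martingale property;
  invariance then turns \<open>F (T x)\<close> into the shorter product.\<close>

lemma mcleish_product_integral:
  assumes X: "X \<in> borel_measurable M" "\<And>x. \<bar>X x\<bar> \<le> B" "reverse_mds X"
  shows "(\<integral>x. (\<Prod>j<n. 1 + \<i> * of_real (a * X ((T ^^ j) x))) \<partial>M) = 1"
proof (induction n)
  case (Suc n)
  note [measurable] = X(1)
  define F where "F x = (\<Prod>j<n. 1 + \<i> * of_real (a * X ((T ^^ j) x)))" for x
  have F[measurable]: "F \<in> borel_measurable M" unfolding F_def by measurable
  have Fb: "cmod (F x) \<le> exp (real n * (\<bar>a\<bar> * B)\<^sup>2)" for x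
    unfolding F_def by (rule mcleish_product_norm_le) (auto simp: abs_mult intro!: mult_left_mono X(2))
  have B0: "0 \<le> B" using X(2)[of undefined] by simp
  have i1: "integrable M (\<lambda>x. F (T x))"
    by (rule integrable_const_bound[of _ "exp (real n * (\<bar>a\<bar> * B)\<^sup>2)"]) (auto simp: Fb)
  have i2: "integrable M (\<lambda>x. of_real (X x) * F (T x))"
    by (rule integrable_const_bound[of _ "B * exp (real n * (\<bar>a\<bar> * B)\<^sup>2)"])
       (auto simp: norm_mult intro!: mult_mono X(2) Fb B0)
  have "(\<integral>x. (\<Prod>j<Suc n. 1 + \<i> * of_real (a * X ((T ^^ j) x))) \<partial>M)
      = (\<integral>x. F (T x) + (\<i> * of_real a) * (of_real (X x) * F (T x)) \<partial>M)"
    unfolding F_def by (subst prod.lessThan_Suc_shift) (simp add: funpow_swap1 algebra_simps)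
  also have "\<dots> = (\<integral>x. F (T x) \<partial>M) + (\<i> * of_real a) * (\<integral>x. of_real (X x) * F (T x) \<partial>M)"
    using i1 i2 by simp
  also have "(\<integral>x. of_real (X x) * F (T x) \<partial>M) = 0"
    by (rule reverse_mds_complex[OF X F Fb])
  also have "(\<integral>x. F (T x) \<partial>M) = (\<integral>x. F x \<partial>M)" by (rule integral_T) simp
  finally show ?case using Suc by (simp add: F_def)
qed (simp add: prob_space)

end

context ergodic
begin

text \<open>McLeish's argument: the products \<open>\<Prod>\<^sub>j (1 + i t X\<^sub>j / \<surd>n)\<close> have integral \<open>1\<close> and differ from
  \<open>exp (i t S\<^sub>n / \<surd>n)\<close> by a factor that converges to a constant by the ergodic theorem.\<close>

lemma reverse_mds_clt:
  assumes X: "X \<in> borel_measurable M" "\<And>x. \<bar>X x\<bar> \<le> B" "reverse_mds X"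
  shows "(\<lambda>n. \<integral>x. iexp (t / sqrt (real n) * bsum X n x) \<partial>M)
    \<longlonglongrightarrow> of_real (exp (- t\<^sup>2 * (\<integral>x. (X x)\<^sup>2 \<partial>M) / 2))"
proof -
  note [measurable] = X(1)
  define a where "a n = t / sqrt (real n)" for n
  define v where "v = (\<integral>x. (X x)\<^sup>2 \<partial>M)"
  define P where "P n x = (\<Prod>j<n. 1 + \<i> * of_real (a n * X ((T ^^ j) x)))" for n x
  define E where "E n x = exp (- ((a n)\<^sup>2 * bsum (\<lambda>x. (X x)\<^sup>2) n x) / 2)" for n x
  have B0: "0 \<le> B" using X(2)[of undefined] by simp
  have [measurable]: "P n \<in> borel_measurable M" "E n \<in> borel_measurable M" for n
    unfolding P_def E_def by measurable
  have X2: "integrable M (\<lambda>x. (X x)\<^sup>2)"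
    by (rule integrable_const_bound[of _ "B\<^sup>2"]) (auto simp: X(2) B0 simp flip: abs_le_square_iff intro: order_trans[OF X(2)])
  have a2: "real n * (a n)\<^sup>2 \<le> t\<^sup>2" for n
    by (cases "n = 0") (auto simp: a_def power_divide)
  have Pb: "cmod (P n x) \<le> exp (t\<^sup>2 * B\<^sup>2)" for n x
  proof -
    have "cmod (P n x) \<le> exp (real n * (\<bar>a n\<bar> * B)\<^sup>2)" unfolding P_def
      by (rule mcleish_product_norm_le) (auto simp: abs_mult intro!: mult_left_mono X(2))
    also have "real n * (\<bar>a n\<bar> * B)\<^sup>2 \<le> t\<^sup>2 * B\<^sup>2"
      using mult_right_mono[OF a2, of "B\<^sup>2" n] by (simp add: power_mult_distrib)
    finally show ?thesis by simp
  qed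
  have Eb: "\<bar>E n x\<bar> \<le> 1" for n x
    unfolding E_def bsum_def by (auto intro!: mult_nonneg_nonneg sum_nonneg)
  have iP: "integrable M (P n)" for n
    by (rule integrable_const_bound[of _ "exp (t\<^sup>2 * B\<^sup>2)"]) (auto simp: Pb)
  have iPE: "integrable M (\<lambda>x. P n x * of_real (E n x))" for n
    by (rule integrable_const_bound[of _ "exp (t\<^sup>2 * B\<^sup>2) * 1"])
       (auto simp: norm_mult simp del: mult_1_right intro!: mult_mono Pb Eb)
  have limE: "AE x in M. (\<lambda>n. E n x) \<longlonglongrightarrow> exp (- (t\<^sup>2 * v) / 2)"
    using birkhoff[OF X2]
  proof eventually_elim
    case (elim x)
    have "(\<lambda>n. exp (- (t\<^sup>2 * (bsum (\<lambda>x. (X x)\<^sup>2) n x / real n)) / 2)) \<longlonglongrightarrow> exp (- (t\<^sup>2 * v) / 2)"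
      unfolding v_def by (intro tendsto_intros elim) auto
    moreover have "(a n)\<^sup>2 * bsum (\<lambda>x. (X x)\<^sup>2) n x = t\<^sup>2 * (bsum (\<lambda>x. (X x)\<^sup>2) n x / real n)" for n
      by (simp add: a_def power_divide)
    ultimately show ?case by (simp add: E_def)
  qed
  \<comment> \<open>\<open>P n\<close> itself need not converge: it enters only through its uniform
    bound and, when the constant limit of \<open>E n\<close> is taken out, through its integral
    1.\<close>
  have main: "(\<lambda>n. \<integral>x. P n x * of_real (E n x - exp (- (t\<^sup>2 * v) / 2)) \<partial>M) \<longlonglongrightarrow> (\<integral>x. 0 \<partial>M)"
  proof (rule integral_dominated_convergence[where w = "\<lambda>_. exp (t\<^sup>2 * B\<^sup>2) * 2"])
    show "AE x in M. (\<lambda>n. P n x * of_real (E n x - exp (- (t\<^sup>2 * v) / 2))) \<longlonglongrightarrow> 0"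
      using limE
    proof eventually_elim
      case (elim x)
      have "(\<lambda>n. exp (t\<^sup>2 * B\<^sup>2) * \<bar>E n x - exp (- (t\<^sup>2 * v) / 2)\<bar>) \<longlonglongrightarrow> exp (t\<^sup>2 * B\<^sup>2) * \<bar>exp (- (t\<^sup>2 * v) / 2) - exp (- (t\<^sup>2 * v) / 2)\<bar>"
        by (intro tendsto_intros elim)
      then have "(\<lambda>n. exp (t\<^sup>2 * B\<^sup>2) * \<bar>E n x - exp (- (t\<^sup>2 * v) / 2)\<bar>) \<longlonglongrightarrow> 0" by simp
      then show ?case
        by (rule Lim_null_comparison[rotated])
           (auto simp: norm_mult Pb intro!: always_eventually mult_right_mono simp flip: of_real_diff)
    qed
    show "AE x in M. norm (P n x * of_real (E n x - exp (- (t\<^sup>2 * v) / 2))) \<le> exp (t\<^sup>2 * B\<^sup>2) * 2" for n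
    proof (rule AE_I2)
      fix x
      have v0: "0 \<le> t\<^sup>2 * v" unfolding v_def by (intro mult_nonneg_nonneg integral_nonneg) auto
      have "\<bar>E n x - exp (- (t\<^sup>2 * v) / 2)\<bar> \<le> 1 + 1"
        by (rule order_trans[OF abs_triangle_ineq4]) (intro add_mono Eb, use v0 in simp)
      then show "norm (P n x * of_real (E n x - exp (- (t\<^sup>2 * v) / 2))) \<le> exp (t\<^sup>2 * B\<^sup>2) * 2"
        unfolding norm_mult norm_of_real by (intro mult_mono Pb) auto
    qed
  qed auto
  have "(\<integral>x. P n x * of_real (E n x - exp (- (t\<^sup>2 * v) / 2)) \<partial>M)
      = (\<integral>x. P n x * of_real (E n x) \<partial>M) - of_real (exp (- (t\<^sup>2 * v) / 2))" for n
  proof -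
    have "(\<integral>x. P n x * of_real (E n x - exp (- (t\<^sup>2 * v) / 2)) \<partial>M)
      = (\<integral>x. P n x * of_real (E n x) - P n x * of_real (exp (- (t\<^sup>2 * v) / 2)) \<partial>M)"
      by (simp add: algebra_simps)
    also have "\<dots> = (\<integral>x. P n x * of_real (E n x) \<partial>M) - (\<integral>x. P n x \<partial>M) * of_real (exp (- (t\<^sup>2 * v) / 2))"
      using iP[of n] by (subst Bochner_Integration.integral_diff[OF iPE]) auto
    also have "(\<integral>x. P n x \<partial>M) = 1"
      unfolding P_def by (rule mcleish_product_integral[OF X])
    finally show ?thesis by simp
  qed
  with main have PE: "(\<lambda>n. \<integral>x. P n x * of_real (E n x) \<partial>M) \<longlonglongrightarrow> of_real (exp (- (t\<^sup>2 * v) / 2))"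
    by (simp add: LIM_zero_iff)
  have "(\<lambda>n. (\<integral>x. iexp (a n * bsum X n x) \<partial>M) - (\<integral>x. P n x * of_real (E n x) \<partial>M)) \<longlonglongrightarrow> 0"
  proof (rule Lim_null_comparison)
    show "(\<lambda>n. (\<bar>t\<bar> * B) ^ 3 / sqrt (real n)) \<longlonglongrightarrow> 0"
      by (intro real_tendsto_divide_at_top[OF tendsto_const]
          filterlim_compose[OF sqrt_at_top filterlim_real_sequentially])
    have "filterlim (\<lambda>n. sqrt (real n)) at_top sequentially"
      by (rule filterlim_compose[OF sqrt_at_top filterlim_real_sequentially])
    then have "eventually (\<lambda>n. \<bar>t\<bar> * B \<le> sqrt (real n) \<and> n > 0) sequentially"
      by (intro eventually_conj eventually_gt_at_top) (auto simp: filterlim_at_top)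
    then show "eventually (\<lambda>n. norm ((\<integral>x. iexp (a n * bsum X n x) \<partial>M) - (\<integral>x. P n x * of_real (E n x) \<partial>M))
        \<le> (\<bar>t\<bar> * B) ^ 3 / sqrt (real n)) sequentially"
    proof eventually_elim
      case (elim n)
      \<comment> \<open>This bounds all summands, and turns the error n b^3 into a multiple of
        1/sqrt n. The estimate wants b \<le> 1, hence large \<open>n\<close>.\<close>
      define b where "b = \<bar>t\<bar> * B / sqrt (real n)"
      have b: "b \<le> 1" using elim by (simp add: b_def field_simps)
      have ab: "\<bar>a n * X y\<bar> \<le> b" for y
        using mult_left_mono[OF X(2)[of y], of "\<bar>t\<bar>"] elim
        by (simp add: a_def b_def abs_mult divide_right_mono)
      have pw: "cmod (iexp (a n * bsum X n x) - P n x * of_real (E n x)) \<le> real n * b ^ 3" for x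
        using iexp_sum_approx[of "\<lambda>j. a n * X ((T ^^ j) x)" b n, OF ab b]
        by (simp add: P_def E_def bsum_def sum_distrib_left power_mult_distrib)
      have ii: "integrable M (\<lambda>x. iexp (a n * bsum X n x))"
        by (rule integrable_const_bound[of _ 1]) auto
      have "norm ((\<integral>x. iexp (a n * bsum X n x) \<partial>M) - (\<integral>x. P n x * of_real (E n x) \<partial>M))
        = norm (\<integral>x. iexp (a n * bsum X n x) - P n x * of_real (E n x) \<partial>M)"
        by (subst Bochner_Integration.integral_diff[OF ii iPE]) simp
      also have "\<dots> \<le> (\<integral>x. norm (iexp (a n * bsum X n x) - P n x * of_real (E n x)) \<partial>M)"
        by (rule integral_norm_bound)
      also have "\<dots> \<le> (\<integral>x. real n * b ^ 3 \<partial>M)"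
        using ii iPE by (intro integral_mono pw integrable_norm Bochner_Integration.integrable_diff) auto
      also have "\<dots> = real n * b ^ 3" by (simp add: prob_space)
      also have "\<dots> = (\<bar>t\<bar> * B) ^ 3 / sqrt (real n)"
      proof -
        have "real n = sqrt (real n) * sqrt (real n)" by simp
        then have "real n * b ^ 3 = (sqrt (real n) * sqrt (real n)) * b ^ 3" by metis
        then show ?thesis using elim by (simp add: b_def power_divide eval_nat_numeral)
      qed
      finally show ?case .
    qed
  qed
  from tendsto_add[OF this PE] show ?thesis by (simp add: a_def v_def)
qed

end

section \<open>Coboundaries and dual functions\<close>

lemma norm_iexp_diff_le: "cmod (iexp a - iexp b) \<le> \<bar>a - b\<bar>"
proof -
  have "iexp a - iexp b = iexp b * (iexp (a - b) - 1)"
    by (simp add: algebra_simps flip: exp_add)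
  then have "cmod (iexp a - iexp b) = cmod (iexp (a - b) - 1)"
    by (simp add: norm_mult)
  then show ?thesis using iexp_approx1[of "a - b" 0] by simp
qed

lemma iexp_diff_minus_1: "iexp (p - q) - 1 = (iexp p - iexp q) * iexp (- q)"
  by (simp add: algebra_simps flip: exp_add)

context measure_preserving
begin

lemma integrable_bounded:
  fixes g :: "'a \<Rightarrow> 'b::{banach, second_countable_topology}"
  assumes "g \<in> borel_measurable M" "\<And>x. norm (g x) \<le> K"
  shows "integrable M g"
  by (rule integrable_const_bound[of _ K]) (auto simp: assms)

text \<open>The sum telescopes to \<open>\<Psi>\<close> at time \<open>n\<close> minus
  \<open>\<Psi>\<close> at time 0. Both have the same law, so both contribute the integral of |iexp
  (a \<Psi>) - 1|, which tends to 0 by dominated convergence even if \<open>\<Psi>\<close> has no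
  moments. The general null sequence allows the normalisation 1/sqrt n for the variance and 1/n for
  the mean.\<close>

lemma coboundary_char_tendsto_1:
  assumes [measurable]: "u \<in> borel_measurable M" "\<Psi> \<in> borel_measurable M"
    and cob: "AE x in M. u x = \<Psi> (T x) - \<Psi> x" and a: "a \<longlonglongrightarrow> 0"
  shows "(\<lambda>n. \<integral>x. iexp (a n * bsum u n x) \<partial>M) \<longlonglongrightarrow> 1"
proof -
  have "AE x in M. \<forall>j. u ((T ^^ j) x) = \<Psi> (T ((T ^^ j) x)) - \<Psi> ((T ^^ j) x)"
    using AE_T_funpow[OF cob] by (simp add: AE_all_countable)
  then have S: "AE x in M. \<forall>n. bsum u n x = \<Psi> ((T ^^ n) x) - \<Psi> x"
  proof eventually_elim
    case (elim x)
    show ?case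
    proof
      fix n
      have "bsum u n x = (\<Sum>j<n. \<Psi> ((T ^^ Suc j) x) - \<Psi> ((T ^^ j) x))"
        unfolding bsum_def using elim by simp
      also have "\<dots> = \<Psi> ((T ^^ n) x) - \<Psi> x"
        by (subst sum_lessThan_telescope) simp
      finally show "bsum u n x = \<Psi> ((T ^^ n) x) - \<Psi> x" .
    qed
  qed
  define I where "I n = (\<integral>x. cmod (iexp (a n * \<Psi> x) - 1) \<partial>M)" for n
  have I: "I \<longlonglongrightarrow> (\<integral>x. 0 \<partial>M)"
    unfolding I_def
  proof (rule integral_dominated_convergence[where w = "\<lambda>_. 2"])
    show "AE x in M. (\<lambda>n. cmod (iexp (a n * \<Psi> x) - 1)) \<longlonglongrightarrow> 0"
    proof (rule AE_I2)
      fix x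
      have "(\<lambda>n. \<bar>a n * \<Psi> x\<bar>) \<longlonglongrightarrow> \<bar>0 * \<Psi> x\<bar>" by (intro tendsto_intros a)
      then have "(\<lambda>n. \<bar>a n * \<Psi> x\<bar>) \<longlonglongrightarrow> 0" by simp
      then show "(\<lambda>n. cmod (iexp (a n * \<Psi> x) - 1)) \<longlonglongrightarrow> 0"
        by (rule Lim_null_comparison[rotated]) (use norm_iexp_diff_le[of "a _ * \<Psi> x" 0] in simp)
    qed
    show "AE x in M. norm (cmod (iexp (a n * \<Psi> x) - 1)) \<le> 2" for n
      by (rule AE_I2) (use norm_triangle_ineq4[of "iexp (a n * \<Psi> _)" 1] in simp)
  qed auto
  have le: "norm ((\<integral>x. iexp (a n * bsum u n x) \<partial>M) - 1) \<le> 2 * I n" for n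
  proof -
    have i1: "integrable M (\<lambda>x. iexp (a n * bsum u n x))"
      by (rule integrable_bounded[of _ 1]) auto
    have i2: "integrable M (\<lambda>x. cmod (iexp (a n * \<Psi> x) - 1))"
      by (rule integrable_bounded[of _ 2]) (auto intro: order_trans[OF norm_triangle_ineq4])
    have i3: "integrable M (\<lambda>x. cmod (iexp (a n * \<Psi> ((T ^^ n) x)) - 1))"
      by (rule integrable_T_funpow[OF i2])
    have "(\<integral>x. iexp (a n * bsum u n x) \<partial>M) - 1 = (\<integral>x. iexp (a n * bsum u n x) - 1 \<partial>M)"
      using i1 by (simp add: prob_space)
    then have "norm ((\<integral>x. iexp (a n * bsum u n x) \<partial>M) - 1) \<le> (\<integral>x. cmod (iexp (a n * bsum u n x) - 1) \<partial>M)"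
      by (simp only: integral_norm_bound)
    also have "\<dots> \<le> (\<integral>x. cmod (iexp (a n * \<Psi> ((T ^^ n) x)) - 1) + cmod (iexp (a n * \<Psi> x) - 1) \<partial>M)"
    proof (rule integral_mono_AE)
      show "AE x in M. cmod (iexp (a n * bsum u n x) - 1)
          \<le> cmod (iexp (a n * \<Psi> ((T ^^ n) x)) - 1) + cmod (iexp (a n * \<Psi> x) - 1)"
        using S
      proof eventually_elim
        case (elim x)
        let ?p = "a n * \<Psi> ((T ^^ n) x)" and ?q = "a n * \<Psi> x"
        have "a n * bsum u n x = ?p - ?q" using elim by (simp only: right_diff_distrib)
        then have "iexp (a n * bsum u n x) - 1 = (iexp ?p - iexp ?q) * iexp (- ?q)"
          by (simp only: iexp_diff_minus_1)
        then have "cmod (iexp (a n * bsum u n x) - 1) = cmod (iexp ?p - iexp ?q)"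
          by (simp only: norm_mult norm_exp_i_times)
        also have "\<dots> \<le> cmod (iexp ?p - 1) + cmod (iexp ?q - 1)"
          using norm_triangle_ineq4[of "iexp ?p - 1" "iexp ?q - 1"] by simp
        finally show ?case .
      qed
    qed (use i1 i2 i3 in auto)
    also have "\<dots> = (\<integral>x. cmod (iexp (a n * \<Psi> ((T ^^ n) x)) - 1) \<partial>M) + I n"
      unfolding I_def by (rule Bochner_Integration.integral_add[OF i3 i2])
    also have "(\<integral>x. cmod (iexp (a n * \<Psi> ((T ^^ n) x)) - 1) \<partial>M) = I n"
      unfolding I_def by (rule integral_T_funpow[where g = "\<lambda>x. cmod (iexp (a n * \<Psi> x) - 1)"]) simp
    finally show ?thesis by simp
  qed
  have "(\<lambda>n. 2 * I n) \<longlonglongrightarrow> 0" using tendsto_mult[OF tendsto_const I, of 2] by simp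
  then have "(\<lambda>n. (\<integral>x. iexp (a n * bsum u n x) \<partial>M) - 1) \<longlonglongrightarrow> 0"
    by (rule Lim_null_comparison[OF always_eventually[OF allI[OF le]]])
  then show ?thesis by (simp add: LIM_zero_iff)
qed

text \<open>\<open>w'\<close> is a version of the adjoint of composition with \<open>T\<close>
  applied to \<open>w\<close>, so \<open>w'\<close> composed with \<open>T\<close> is the
  conditional expectation of \<open>w\<close> given the preimages under \<open>T\<close> of
  measurable sets. The bound is pointwise and in practice the same as that of \<open>w\<close>, so
  the construction can be iterated without loss and without exceptional sets.\<close>

definition is_dual :: "real \<Rightarrow> ('a \<Rightarrow> real) \<Rightarrow> ('a \<Rightarrow> real) \<Rightarrow> bool" where
  "is_dual K w w' \<longleftrightarrow> w' \<in> borel_measurable M \<and> (\<forall>x. \<bar>w' x\<bar> \<le> K) \<and>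
     (\<forall>\<Psi>\<in>borel_measurable M. \<forall>K'. (\<forall>x. \<bar>\<Psi> x\<bar> \<le> K') \<longrightarrow>
        (\<integral>x. w x * \<Psi> (T x) \<partial>M) = (\<integral>x. w' x * \<Psi> x \<partial>M))"

text \<open>The dual is the Radon-Nikodym derivative of the push-forward of \<open>w + K \<ge> 0\<close>, minus \<open>K\<close>.\<close>

lemma ex_dual:
  assumes w: "w \<in> borel_measurable M" "\<And>x. \<bar>w x\<bar> \<le> K"
  shows "\<exists>w'. is_dual K w w'"
proof -
  note [measurable] = w(1)
  have K0: "0 \<le> K" using w(2)[of undefined] by simp
  have wK: "0 \<le> w x + K" "w x + K \<le> 2 * K" for x using w(2)[of x] by auto
  define D where "D = density M (\<lambda>x. ennreal (w x + K))"
  define N where "N = distr D M T"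
  have [measurable_cong, simp]: "sets D = sets M" "sets N = sets M" by (simp_all add: D_def N_def)
  have [simp]: "space D = space M" by (simp add: D_def)
  have [measurable]: "T \<in> measurable D M" by simp
  \<comment> \<open>This domination is used twice: for absolute continuity, and to bound the density
    by \<open>2 * K\<close> almost everywhere. If the density exceeded \<open>2 * K\<close> on a set
    of positive measure, \<open>N\<close> would be too large there.\<close>
  have N_le: "emeasure N A \<le> ennreal (2 * K) * emeasure M A" if A[measurable]: "A \<in> sets M" for A
  proof -
    have "emeasure N A = emeasure D (T -` A \<inter> space M)" by (simp add: N_def emeasure_distr)
    also have "\<dots> = (\<integral>\<^sup>+x. ennreal (w x + K) * indicator (T -` A \<inter> space M) x \<partial>M)"
      unfolding D_def by (rule emeasure_density) simp_all
    also have "\<dots> \<le> (\<integral>\<^sup>+x. ennreal (2 * K) * indicator (T -` A \<inter> space M) x \<partial>M)"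
      by (intro nn_integral_mono mult_right_mono ennreal_leI wK) simp
    also have "\<dots> = ennreal (2 * K) * emeasure M (T -` A \<inter> space M)"
      by (simp add: nn_integral_cmult_indicator)
    also have "emeasure M (T -` A \<inter> space M) = emeasure M A"
      using emeasure_distr[of T M M A] by (simp add: T_invariant)
    finally show ?thesis .
  qed
  have ac: "absolutely_continuous M N"
    unfolding absolutely_continuous_def
    by (auto simp: null_sets_def) (use N_le in fastforce)
  define h where "h = RN_deriv M N"
  have [measurable]: "h \<in> borel_measurable M" by (simp add: h_def)
  have hN: "density M h = N" unfolding h_def by (rule density_RN_deriv[OF ac]) simp
  have h_le: "AE x in M. h x \<le> ennreal (2 * K)"
  proof -
    define S where "S = {x \<in> space M. h x > ennreal (2 * K)}"
    have [measurable]: "S \<in> sets M" unfolding S_def by measurable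
    have "(\<integral>\<^sup>+x. h x * indicator S x - ennreal (2 * K) * indicator S x \<partial>M)
        = (\<integral>\<^sup>+x. h x * indicator S x \<partial>M) - (\<integral>\<^sup>+x. ennreal (2 * K) * indicator S x \<partial>M)"
    proof (rule nn_integral_diff)
      show "(\<integral>\<^sup>+x. ennreal (2 * K) * indicator S x \<partial>M) \<noteq> \<infinity>"
        by (simp add: nn_integral_cmult_indicator ennreal_mult_eq_top_iff)
      show "AE x in M. ennreal (2 * K) * indicator S x \<le> h x * indicator S x"
        by (rule AE_I2) (auto simp: S_def indicator_def)
    qed auto
    also have "(\<integral>\<^sup>+x. h x * indicator S x \<partial>M) = emeasure N S"
      by (simp add: emeasure_density flip: hN)
    also have "(\<integral>\<^sup>+x. ennreal (2 * K) * indicator S x \<partial>M) = ennreal (2 * K) * emeasure M S"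
      by (simp add: nn_integral_cmult_indicator)
    also have "emeasure N S - ennreal (2 * K) * emeasure M S = 0"
    proof -
      have "ennreal (2 * K) * emeasure M S < \<top>" by (intro ennreal_mult_less_top[THEN iffD2]) (simp add: less_top[symmetric])
      then show ?thesis using N_le[of S] by (simp add: diff_eq_0_iff_ennreal le_less_trans)
    qed
    finally have "AE x in M. h x * indicator S x - ennreal (2 * K) * indicator S x = 0"
      by (subst (asm) nn_integral_0_iff_AE) auto
    then show ?thesis using AE_space
    proof eventually_elim
      case (elim x)
      show ?case
      proof (rule ccontr)
        assume n: "\<not> h x \<le> ennreal (2 * K)"
        then have "x \<in> S" using elim by (simp add: S_def not_le)
        then have "h x - ennreal (2 * K) = 0" using elim by simp
        then show False using n by (auto simp: diff_eq_0_iff_ennreal)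
      qed
    qed
  qed
  \<comment> \<open>The cut-off changes the density on a null set only and makes the bound hold at
    every point.\<close>
  define w1 where "w1 x = enn2real (min (h x) (ennreal (2 * K)))" for x
  have w1: "0 \<le> w1 x" "w1 x \<le> 2 * K" for x
    unfolding w1_def using enn2real_leI[of "2 * K" "min (h x) (ennreal (2 * K))"] K0 by auto
  have [measurable]: "w1 \<in> borel_measurable M" unfolding w1_def by measurable
  have "AE x in M. h x = ennreal (w1 x)"
    using h_le by eventually_elim (simp add: w1_def min_absorb1 le_less_trans[OF _ ennreal_less_top])
  then have N': "density M (\<lambda>x. ennreal (w1 x)) = N"
    unfolding hN[symmetric] by (intro density_cong) auto
  have "is_dual K w (\<lambda>x. w1 x - K)"
    unfolding is_dual_def
  proof (intro conjI allI impI ballI)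
    show "\<bar>w1 x - K\<bar> \<le> K" for x using w1[of x] by auto
    fix \<Psi> :: "'a \<Rightarrow> real" and K' assume \<Psi>[measurable]: "\<Psi> \<in> borel_measurable M" and b: "\<forall>x. \<bar>\<Psi> x\<bar> \<le> K'"
    have i\<Psi>: "integrable M \<Psi>" by (rule integrable_bounded) (use b in auto)
    have K'0: "0 \<le> K'" using b[rule_format, of undefined] by linarith
    have i1: "integrable M (\<lambda>x. w x * \<Psi> (T x))"
      by (rule integrable_bounded[of _ "K * K'"]) (auto simp: abs_mult K0 K'0 b intro!: mult_mono w(2))
    have i2: "integrable M (\<lambda>x. w1 x * \<Psi> x)"
      by (rule integrable_bounded[of _ "(2 * K) * K'"]) (auto simp: abs_mult K0 K'0 b w1 intro!: mult_mono)
    have "(\<integral>x. (w x + K) * \<Psi> (T x) \<partial>M) = (\<integral>x. \<Psi> (T x) \<partial>D)"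
      unfolding D_def by (subst integral_density) (auto simp: wK)
    also have "\<dots> = (\<integral>x. \<Psi> x \<partial>N)" unfolding N_def by (subst integral_distr) auto
    also have "\<dots> = (\<integral>x. w1 x * \<Psi> x \<partial>M)"
      unfolding N'[symmetric] by (subst integral_density) (auto simp: w1)
    finally have "(\<integral>x. w x * \<Psi> (T x) + K * \<Psi> (T x) \<partial>M) = (\<integral>x. w1 x * \<Psi> x \<partial>M)"
      by (simp add: algebra_simps)
    then have "(\<integral>x. w x * \<Psi> (T x) \<partial>M) + K * (\<integral>x. \<Psi> (T x) \<partial>M) = (\<integral>x. w1 x * \<Psi> x \<partial>M)"
      using i1 integrable_T[OF i\<Psi>] by simp
    then show "(\<integral>x. w x * \<Psi> (T x) \<partial>M) = (\<integral>x. (w1 x - K) * \<Psi> x \<partial>M)"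
      using i2 i\<Psi> by (simp add: integral_T algebra_simps)
  qed auto
  then show ?thesis by blast
qed

end

section \<open>Martingale approximation\<close>

text \<open>The supremum of the test function takes the place of its L^1(\<nu>) norm, so the locale
  speaks of one measure only. Centring is implicit: testing against the constant 1 for all
  \<open>n\<close> forces the integral of \<open>g\<close> to be 0.\<close>

locale decaying_observable = ergodic M T for M :: "'a measure" and T +
  fixes g :: "'a \<Rightarrow> real" and B C \<xi> :: real
  assumes g_measurable [measurable]: "g \<in> borel_measurable M"
    and g_bounded: "\<bar>g x\<bar> \<le> B"
    and B_pos: "0 < B" and C_pos: "0 < C" and \<xi>: "0 < \<xi>" "\<xi> < 1"
    and decay: "\<Psi> \<in> borel_measurable M \<Longrightarrow> (\<And>x. \<bar>\<Psi> x\<bar> \<le> K) \<Longrightarrow>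
      \<bar>\<integral>x. g x * \<Psi> ((T ^^ n) x) \<partial>M\<bar> \<le> C * \<xi> ^ n * K"
begin

text \<open>\<open>G n\<close> is the image of \<open>g\<close> under the \<open>n\<close>-th power of the \<open>L\<^sup>2(M)\<close>-adjoint of composition with \<open>T\<close>.\<close>

primrec G :: "nat \<Rightarrow> 'a \<Rightarrow> real" where
  "G 0 = g"
| "G (Suc n) = (SOME w'. is_dual B (G n) w')"

lemma G_props: "G n \<in> borel_measurable M \<and> (\<forall>x. \<bar>G n x\<bar> \<le> B)"
proof (induction n)
  case (Suc n)
  then have "is_dual B (G n) (G (Suc n))"
    using someI_ex[OF ex_dual[of "G n" B]] by simp
  then show ?case unfolding is_dual_def by blast
qed (simp add: g_bounded)

lemma G_measurable [measurable]: "G n \<in> borel_measurable M"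
  and G_bounded: "\<bar>G n x\<bar> \<le> B"
  using G_props by auto

lemma G_dual_Suc:
  assumes "\<Psi> \<in> borel_measurable M" "\<And>x. \<bar>\<Psi> x\<bar> \<le> K"
  shows "(\<integral>x. G n x * \<Psi> (T x) \<partial>M) = (\<integral>x. G (Suc n) x * \<Psi> x \<partial>M)"
proof -
  have "is_dual B (G n) (G (Suc n))"
    using someI_ex[OF ex_dual[of "G n" B]] G_bounded by simp
  then show ?thesis using assms unfolding is_dual_def by blast
qed

declare G.simps(2) [simp del]

lemma G_dual:
  assumes "\<Psi> \<in> borel_measurable M" "\<And>x. \<bar>\<Psi> x\<bar> \<le> K"
  shows "(\<integral>x. G n x * \<Psi> ((T ^^ k) x) \<partial>M) = (\<integral>x. G (n + k) x * \<Psi> x \<partial>M)"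
proof (induction k arbitrary: n)
  case (Suc k)
  note [measurable] = assms(1)
  have "(\<integral>x. G n x * \<Psi> ((T ^^ Suc k) x) \<partial>M) = (\<integral>x. G n x * \<Psi> ((T ^^ k) (T x)) \<partial>M)"
    by (simp add: funpow_swap1)
  also have "\<dots> = (\<integral>x. G (Suc n) x * \<Psi> ((T ^^ k) x) \<partial>M)"
    by (rule G_dual_Suc[of "\<lambda>x. \<Psi> ((T ^^ k) x)" K]) (simp_all add: assms(2))
  also have "\<dots> = (\<integral>x. G (Suc n + k) x * \<Psi> x \<partial>M)" by (rule Suc)
  finally show ?case by simp
qed simp

lemma G_decay:
  assumes "\<Psi> \<in> borel_measurable M" "\<And>x. \<bar>\<Psi> x\<bar> \<le> K"
  shows "\<bar>\<integral>x. G n x * \<Psi> x \<partial>M\<bar> \<le> C * \<xi> ^ n * K"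
  using decay[OF assms, of n] G_dual[OF assms, of 0 n] by simp

lemma G_product_integrable:
  assumes [measurable]: "\<Psi> \<in> borel_measurable M" and b: "\<And>x. \<bar>\<Psi> x\<bar> \<le> K"
  shows "integrable M (\<lambda>x. G n x * \<Psi> x)"
proof (rule integrable_bounded[of _ "B * K"])
  fix x
  have "0 \<le> K" using b[of undefined] by simp
  then show "norm (G n x * \<Psi> x) \<le> B * K"
    using B_pos by (auto simp: abs_mult intro!: mult_mono G_bounded b)
qed simp

text \<open>Duality with the sign of \<open>G n\<close>, a test function bounded by 1.\<close>

lemma G_L1_le: "(\<integral>x. \<bar>G n x\<bar> \<partial>M) \<le> C * \<xi> ^ n"
proof -
  have "(\<integral>x. \<bar>G n x\<bar> \<partial>M) = (\<integral>x. G n x * sgn (G n x) \<partial>M)"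
    by (intro Bochner_Integration.integral_cong) (auto simp: sgn_real_def)
  also have "\<dots> \<le> C * \<xi> ^ n * 1"
    by (rule order_trans[OF abs_ge_self G_decay]) (auto simp: sgn_real_def)
  finally show ?thesis by simp
qed

section \<open>The truncated martingale and the Green-Kubo sum\<close>

definition W :: "nat \<Rightarrow> 'a \<Rightarrow> real" where
  "W N x = (\<Sum>n\<le>N. G n x)"

text \<open>The subtracted sum is the dual of \<open>W N\<close>, composed with \<open>T\<close>. So
  this is \<open>W N\<close> minus its conditional expectation given the preimages under
  \<open>T\<close> of measurable sets, which is what makes it a reverse martingale
  difference.\<close>

definition mart :: "nat \<Rightarrow> 'a \<Rightarrow> real" where
  "mart N x = W N x - (\<Sum>n\<le>N. G (Suc n) (T x))"

definition avar :: real where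
  "avar = (\<integral>x. (g x)\<^sup>2 \<partial>M) + 2 * (\<Sum>k. \<integral>x. g x * g ((T ^^ Suc k) x) \<partial>M)"

lemma W_measurable [measurable]: "W N \<in> borel_measurable M"
  unfolding W_def by measurable

lemma mart_measurable [measurable]: "mart N \<in> borel_measurable M"
  unfolding mart_def by measurable

lemma W_bounded: "\<bar>W N x\<bar> \<le> real (Suc N) * B"
proof -
  have "\<bar>W N x\<bar> \<le> (\<Sum>n\<le>N. \<bar>G n x\<bar>)" unfolding W_def by (rule sum_abs)
  also have "\<dots> \<le> (\<Sum>n\<le>N. B)" by (intro sum_mono G_bounded)
  finally show ?thesis by simp
qed

lemma sum_G_Suc_bounded: "\<bar>\<Sum>n\<le>N. G (Suc n) x\<bar> \<le> real (Suc N) * B"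
proof -
  have "\<bar>\<Sum>n\<le>N. G (Suc n) x\<bar> \<le> (\<Sum>n\<le>N. \<bar>G (Suc n) x\<bar>)" by (rule sum_abs)
  also have "\<dots> \<le> (\<Sum>n\<le>N. B)" by (intro sum_mono G_bounded)
  finally show ?thesis by simp
qed

lemma mart_bounded: "\<bar>mart N x\<bar> \<le> 2 * (real (Suc N) * B)"
  unfolding mart_def using W_bounded[of N x] sum_G_Suc_bounded[of "T x" N] by linarith

lemma sum_G_Suc: "(\<Sum>n\<le>N. G (Suc n) x) = W N x - g x + G (Suc N) x"
proof -
  have "g x + (\<Sum>n\<le>N. G (Suc n) x) = (\<Sum>n\<le>Suc N. G n x)"
    by (subst sum.atMost_Suc_shift) simp
  then show ?thesis by (simp add: W_def)
qed

lemma W_dual: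
  assumes [measurable]: "\<Psi> \<in> borel_measurable M" and b: "\<And>x. \<bar>\<Psi> x\<bar> \<le> K"
  shows "(\<integral>x. W N x * \<Psi> (T x) \<partial>M) = (\<integral>x. (\<Sum>n\<le>N. G (Suc n) x) * \<Psi> x \<partial>M)"
proof -
  have i: "integrable M (\<lambda>x. G n x * \<Psi> (T x))" for n
    by (rule G_product_integrable[of _ K]) (auto simp: b)
  have "(\<integral>x. W N x * \<Psi> (T x) \<partial>M) = (\<Sum>n\<le>N. \<integral>x. G n x * \<Psi> (T x) \<partial>M)"
    unfolding W_def sum_distrib_right by (rule Bochner_Integration.integral_sum[OF i])
  also have "\<dots> = (\<Sum>n\<le>N. \<integral>x. G (Suc n) x * \<Psi> x \<partial>M)"
    by (intro sum.cong refl G_dual_Suc[OF assms])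
  also have "\<dots> = (\<integral>x. (\<Sum>n\<le>N. G (Suc n) x) * \<Psi> x \<partial>M)"
    unfolding sum_distrib_right by (rule Bochner_Integration.integral_sum[symmetric, OF G_product_integrable[OF assms]])
  finally show ?thesis .
qed

lemma mart_reverse_mds: "reverse_mds (mart N)"
  unfolding reverse_mds_def
proof (intro ballI allI impI)
  fix \<Psi> :: "'a \<Rightarrow> real" and K assume [measurable]: "\<Psi> \<in> borel_measurable M" and b: "\<forall>x. \<bar>\<Psi> x\<bar> \<le> K"
  have K0: "0 \<le> K" using b[rule_format, of undefined] by linarith
  have i1: "integrable M (\<lambda>x. W N x * \<Psi> (T x))"
    by (rule integrable_bounded[of _ "real (Suc N) * B * K"])
       (use B_pos in \<open>auto simp: abs_mult b K0 simp del: of_nat_Suc intro!: mult_mono W_bounded\<close>)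
  have i2: "integrable M (\<lambda>x. (\<Sum>n\<le>N. G (Suc n) x) * \<Psi> x)"
    by (rule integrable_bounded[of _ "real (Suc N) * B * K"])
       (use B_pos in \<open>auto simp: abs_mult b K0 simp del: of_nat_Suc intro!: mult_mono sum_G_Suc_bounded\<close>)
  have "(\<integral>x. mart N x * \<Psi> (T x) \<partial>M)
      = (\<integral>x. W N x * \<Psi> (T x) \<partial>M) - (\<integral>x. (\<Sum>n\<le>N. G (Suc n) (T x)) * \<Psi> (T x) \<partial>M)"
    unfolding mart_def left_diff_distrib
    by (rule Bochner_Integration.integral_diff[OF i1 integrable_T[OF i2]])
  also have "(\<integral>x. (\<Sum>n\<le>N. G (Suc n) (T x)) * \<Psi> (T x) \<partial>M) = (\<integral>x. (\<Sum>n\<le>N. G (Suc n) x) * \<Psi> x \<partial>M)"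
    by (rule integral_T[where g = "\<lambda>x. (\<Sum>n\<le>N. G (Suc n) x) * \<Psi> x"]) simp
  also have "\<dots> = (\<integral>x. W N x * \<Psi> (T x) \<partial>M)"
    by (rule W_dual[symmetric, of _ K]) (use b in auto)
  finally show "(\<integral>x. mart N x * \<Psi> (T x) \<partial>M) = 0" by simp
qed

lemma correlation_summable: "summable (\<lambda>k. \<integral>x. g x * g ((T ^^ Suc k) x) \<partial>M)"
proof (rule summable_comparison_test'[of "\<lambda>k. C * B * \<xi> * \<xi> ^ k" 0])
  show "summable (\<lambda>k. C * B * \<xi> * \<xi> ^ k)"
    using \<xi> by (intro summable_mult summable_geometric) auto
  show "norm (\<integral>x. g x * g ((T ^^ Suc k) x) \<partial>M) \<le> C * B * \<xi> * \<xi> ^ k" for k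
    using decay[of g B "Suc k"] g_bounded by (simp add: mult_ac)
qed

text \<open>Let P be the dual of \<open>W N\<close>. Duality and invariance give both the cross term
  and the last square the value of the integral of P^2, so the left side is the integral of W^2 -
  P^2. As P = W - g + e with e = \<open>G (Suc N)\<close>, this equals 2 W g - g^2 up to terms
  containing e. The integral of W g is the sum of the correlations of orders 0 to \<open>N\<close>,
  by duality; order 0 absorbs the - g^2, and the order \<open>N\<close> sits at k = N - 1 in the
  shifted sum.\<close>

lemma mart_square_integral:
  "(\<integral>x. (mart N x)\<^sup>2 \<partial>M) = (\<integral>x. (g x)\<^sup>2 \<partial>M) + 2 * (\<Sum>k<N. \<integral>x. g x * g ((T ^^ Suc k) x) \<partial>M)
     + (2 * (\<integral>x. G (Suc N) x * g x \<partial>M) - 2 * (\<integral>x. G (Suc N) x * W N x \<partial>M) - (\<integral>x. G (Suc N) x * G (Suc N) x \<partial>M))"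
proof -
  define P where "P x = (\<Sum>n\<le>N. G (Suc n) x)" for x
  define e where "e = G (Suc N)"
  have [measurable]: "P \<in> borel_measurable M" "e \<in> borel_measurable M"
    unfolding P_def e_def by measurable
  have Pb: "\<bar>P x\<bar> \<le> real (Suc N) * B" for x unfolding P_def by (rule sum_G_Suc_bounded)
  have eb: "\<bar>e x\<bar> \<le> B" for x unfolding e_def by (rule G_bounded)
  have Peq: "P x = W N x - g x + e x" for x unfolding P_def e_def by (rule sum_G_Suc)
  have ib: "integrable M (\<lambda>x. u x * v x)"
    if "u \<in> borel_measurable M" "v \<in> borel_measurable M" "\<And>x. \<bar>u x\<bar> \<le> a" "\<And>x. \<bar>v x\<bar> \<le> b" for u v :: "'a \<Rightarrow> real" and a b
  proof (rule integrable_bounded[of _ "a * b"])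
    show "norm (u x * v x) \<le> a * b" for x
      using that(3,4)[of x] that(3,4)[of undefined] by (auto simp: abs_mult intro!: mult_mono)
  qed (use that in simp)
  note i = ib[OF _ _ W_bounded W_bounded] ib[OF _ _ W_bounded Pb] ib[OF _ _ Pb Pb]
    ib[OF _ _ W_bounded g_bounded] ib[OF _ _ W_bounded eb] ib[OF _ _ g_bounded g_bounded]
    ib[OF _ _ eb g_bounded] ib[OF _ _ eb eb] ib[OF _ _ eb W_bounded]
  have iT: "integrable M (\<lambda>x. P (T x) * P (T x))"
    by (rule ib[OF _ _ Pb Pb]) simp_all
  have iWP: "integrable M (\<lambda>x. W N x * P (T x))"
    by (rule ib[OF _ _ W_bounded Pb]) simp_all
  have "(\<integral>x. (mart N x)\<^sup>2 \<partial>M) = (\<integral>x. W N x * W N x - 2 * (W N x * P (T x)) + P (T x) * P (T x) \<partial>M)"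
    unfolding mart_def P_def[symmetric] by (simp add: power2_eq_square algebra_simps)
  also have "\<dots> = (\<integral>x. W N x * W N x \<partial>M) - 2 * (\<integral>x. W N x * P (T x) \<partial>M) + (\<integral>x. P (T x) * P (T x) \<partial>M)"
    using i(1)[of N] iT iWP by simp
  also have "(\<integral>x. P (T x) * P (T x) \<partial>M) = (\<integral>x. P x * P x \<partial>M)"
    by (rule integral_T[where g = "\<lambda>x. P x * P x"]) simp
  also have "(\<integral>x. W N x * P (T x) \<partial>M) = (\<integral>x. P x * P x \<partial>M)"
    using W_dual[of P "real (Suc N) * B" N] Pb by (simp add: P_def)
  also have "(\<integral>x. W N x * W N x \<partial>M) - 2 * (\<integral>x. P x * P x \<partial>M) + (\<integral>x. P x * P x \<partial>M)
      = (\<integral>x. W N x * W N x - P x * P x \<partial>M)"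
    using i(1)[of N] i(3) by simp
  also have "\<dots> = (\<integral>x. 2 * (W N x * g x) - g x * g x + (2 * (e x * g x) - 2 * (e x * W N x) - e x * e x) \<partial>M)"
    by (rule Bochner_Integration.integral_cong) (simp_all add: Peq algebra_simps)
  also have "\<dots> = 2 * (\<integral>x. W N x * g x \<partial>M) - (\<integral>x. g x * g x \<partial>M)
      + (2 * (\<integral>x. e x * g x \<partial>M) - 2 * (\<integral>x. e x * W N x \<partial>M) - (\<integral>x. e x * e x \<partial>M))"
    using i by simp
  also have "(\<integral>x. W N x * g x \<partial>M) = (\<Sum>n\<le>N. \<integral>x. G n x * g x \<partial>M)"
    unfolding W_def sum_distrib_right
    by (rule Bochner_Integration.integral_sum[OF G_product_integrable]) (auto intro: g_bounded)
  also have "\<dots> = (\<Sum>n\<le>N. \<integral>x. g x * g ((T ^^ n) x) \<partial>M)"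
    using G_dual[of g B 0] g_bounded by simp
  also have "\<dots> = (\<Sum>k<Suc N. \<integral>x. g x * g ((T ^^ k) x) \<partial>M)"
    by (simp only: lessThan_Suc_atMost)
  also have "\<dots> = (\<integral>x. g x * g x \<partial>M) + (\<Sum>k<N. \<integral>x. g x * g ((T ^^ Suc k) x) \<partial>M)"
    by (subst sum.lessThan_Suc_shift) simp
  finally show ?thesis by (simp add: e_def power2_eq_square)
qed

lemma mart_variance: "(\<lambda>N. \<integral>x. (mart N x)\<^sup>2 \<partial>M) \<longlonglongrightarrow> avar"
proof -
  define R where "R N = 2 * (\<integral>x. G (Suc N) x * g x \<partial>M) - 2 * (\<integral>x. G (Suc N) x * W N x \<partial>M)
     - (\<integral>x. G (Suc N) x * G (Suc N) x \<partial>M)" for N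
  have R: "R \<longlonglongrightarrow> 0"
  proof (rule Lim_null_comparison)
    \<comment> \<open>The test functions have bounds \<open>B\<close>, (N+1) B and \<open>B\<close>,
      with weights 2, 2 and 1, which gives 2 N + 5. The linear growth of \<open>W N\<close> loses
      against the geometric factor.\<close>
    show "\<forall>\<^sub>F N in sequentially. norm (R N) \<le> (C * B) * ((2 * real N + 5) * \<xi> ^ Suc N)"
    proof (rule always_eventually, rule allI)
      fix N
      have "\<bar>\<integral>x. G (Suc N) x * g x \<partial>M\<bar> \<le> C * \<xi> ^ Suc N * B"
        by (rule G_decay) (auto intro: g_bounded)
      moreover have "\<bar>\<integral>x. G (Suc N) x * W N x \<partial>M\<bar> \<le> C * \<xi> ^ Suc N * (real (Suc N) * B)"
        by (rule G_decay[OF _ W_bounded]) simp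
      moreover have "\<bar>\<integral>x. G (Suc N) x * G (Suc N) x \<partial>M\<bar> \<le> C * \<xi> ^ Suc N * B"
        by (rule G_decay[OF _ G_bounded]) simp
      moreover have "2 * (C * \<xi> ^ Suc N * B) + 2 * (C * \<xi> ^ Suc N * (real (Suc N) * B)) + C * \<xi> ^ Suc N * B
         = (C * B) * ((2 * real N + 5) * \<xi> ^ Suc N)"
        by (simp add: algebra_simps)
      ultimately show "norm (R N) \<le> (C * B) * ((2 * real N + 5) * \<xi> ^ Suc N)"
        unfolding R_def real_norm_def by linarith
    qed
    have "(\<lambda>N. (C * B) * (\<xi> * (2 * (real N * \<xi> ^ N) + 5 * \<xi> ^ N))) \<longlonglongrightarrow> (C * B) * (\<xi> * (2 * 0 + 5 * 0))"
      using \<xi> by (intro tendsto_intros powser_times_n_limit_0 LIMSEQ_power_zero) auto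
    then show "(\<lambda>N. (C * B) * ((2 * real N + 5) * \<xi> ^ Suc N)) \<longlonglongrightarrow> 0"
      by (simp add: algebra_simps)
  qed
  have "(\<lambda>N. (\<integral>x. (g x)\<^sup>2 \<partial>M) + 2 * (\<Sum>k<N. \<integral>x. g x * g ((T ^^ Suc k) x) \<partial>M) + R N) \<longlonglongrightarrow> avar + 0"
    unfolding avar_def
    by (intro tendsto_add[OF _ R] tendsto_intros summable_LIMSEQ correlation_summable)
  then show ?thesis unfolding mart_square_integral R_def by simp
qed

lemma avar_nonneg: "0 \<le> avar"
  by (rule LIMSEQ_le_const[OF mart_variance]) auto

text \<open>Splitting off the first summand adds one square and two cross terms to the integral.
  Each is at most C B \<xi>^N / (1 - \<xi>), the cross terms because the later correlations sum
  geometrically; hence the factor 3. The growth is linear in \<open>n\<close> with a slope that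
  vanishes as \<open>N\<close> grows, which is the uniformity in time asked of the
  remainder.\<close>

lemma bsum_G_square_le:
  "(\<integral>x. (bsum (G N) n x)\<^sup>2 \<partial>M) \<le> real n * (3 * C * B * \<xi> ^ N / (1 - \<xi>))"
proof (induction n)
  case (Suc n)
  define S where "S = bsum (G N) n"
  have [measurable]: "S \<in> borel_measurable M" unfolding S_def by simp
  have Sb: "\<bar>S x\<bar> \<le> real n * B" for x
  proof -
    have "\<bar>S x\<bar> \<le> (\<Sum>j<n. \<bar>G N ((T ^^ j) x)\<bar>)" unfolding S_def bsum_def by (rule sum_abs)
    also have "\<dots> \<le> (\<Sum>j<n. B)" by (intro sum_mono G_bounded)
    finally show ?thesis by simp
  qed
  have i1: "integrable M (\<lambda>x. G N x * G N x)"
    by (rule G_product_integrable[OF _ G_bounded]) simp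
  have i2: "integrable M (\<lambda>x. G N x * S (T x))"
    by (rule G_product_integrable[OF _ Sb]) simp
  have i3: "integrable M (\<lambda>x. (S x)\<^sup>2)"
  proof (rule integrable_bounded[of _ "(real n * B)\<^sup>2"])
    show "norm ((S x)\<^sup>2) \<le> (real n * B)\<^sup>2" for x
      using power_mono[OF Sb[of x], of 2] by simp
  qed simp
  have "(\<integral>x. (bsum (G N) (Suc n) x)\<^sup>2 \<partial>M) = (\<integral>x. G N x * G N x + 2 * (G N x * S (T x)) + (S (T x))\<^sup>2 \<partial>M)"
    by (simp add: bsum_Suc S_def power2_eq_square algebra_simps)
  also have "\<dots> = (\<integral>x. G N x * G N x \<partial>M) + 2 * (\<integral>x. G N x * S (T x) \<partial>M) + (\<integral>x. (S (T x))\<^sup>2 \<partial>M)"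
    using i1 i2 integrable_T[OF i3] by simp
  also have "(\<integral>x. (S (T x))\<^sup>2 \<partial>M) = (\<integral>x. (S x)\<^sup>2 \<partial>M)"
    by (rule integral_T[where g = "\<lambda>x. (S x)\<^sup>2"]) simp
  also have "(\<integral>x. G N x * S (T x) \<partial>M) \<le> C * B * \<xi> ^ N / (1 - \<xi>)"
  proof -
    have "(\<integral>x. G N x * S (T x) \<partial>M) = (\<Sum>j<n. \<integral>x. G N x * G N ((T ^^ Suc j) x) \<partial>M)"
      unfolding S_def bsum_def sum_distrib_left
      by (subst Bochner_Integration.integral_sum)
         (auto simp: funpow_swap1 intro!: G_product_integrable G_bounded)
    also have "\<dots> \<le> (\<Sum>j<n. C * B * \<xi> ^ N * \<xi> ^ j)"
    proof (rule sum_mono)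
      fix j
      have "(\<integral>x. G N x * G N ((T ^^ Suc j) x) \<partial>M) = (\<integral>x. G (N + Suc j) x * G N x \<partial>M)"
        by (rule G_dual[OF _ G_bounded]) simp
      also have "\<dots> \<le> C * \<xi> ^ (N + Suc j) * B"
        by (rule order_trans[OF abs_ge_self G_decay[OF _ G_bounded]]) simp
      also have "\<dots> = C * B * \<xi> ^ N * \<xi> ^ Suc j" by (simp add: power_add mult_ac)
      also have "\<dots> \<le> C * B * \<xi> ^ N * \<xi> ^ j"
        using \<xi> C_pos B_pos by (intro mult_left_mono power_decreasing) auto
      finally show "(\<integral>x. G N x * G N ((T ^^ Suc j) x) \<partial>M) \<le> C * B * \<xi> ^ N * \<xi> ^ j" .
    qed
    also have "\<dots> = C * B * \<xi> ^ N * (\<Sum>j<n. \<xi> ^ j)" by (simp add: sum_distrib_left)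
    also have "\<dots> \<le> C * B * \<xi> ^ N * (1 / (1 - \<xi>))"
    proof (rule mult_left_mono)
      have "(\<Sum>j<n. \<xi> ^ j) \<le> (\<Sum>j. \<xi> ^ j)"
        using \<xi> by (intro sum_le_suminf summable_geometric) auto
      then show "(\<Sum>j<n. \<xi> ^ j) \<le> 1 / (1 - \<xi>)" using \<xi> by (simp add: suminf_geometric)
    qed (use C_pos B_pos \<xi> in auto)
    finally show ?thesis by simp
  qed
  also have "(\<integral>x. G N x * G N x \<partial>M) \<le> C * B * \<xi> ^ N / (1 - \<xi>)"
  proof -
    have "(\<integral>x. G N x * G N x \<partial>M) \<le> C * \<xi> ^ N * B"
      by (rule order_trans[OF abs_ge_self G_decay[OF _ G_bounded]]) simp
    also have "\<dots> \<le> (C * B * \<xi> ^ N) / (1 - \<xi>)"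
      using \<xi> C_pos B_pos by (simp add: field_simps)
    finally show ?thesis .
  qed
  finally show ?case using Suc by (simp add: S_def algebra_simps add_divide_distrib)
qed (simp add: bsum_def)

lemma abs_bsum_G_le:
  assumes n: "0 < n"
  shows "(\<integral>x. \<bar>bsum (G N) n x\<bar> \<partial>M) \<le> sqrt (real n) * sqrt (3 * C * B * \<xi> ^ N / (1 - \<xi>))"
proof -
  define D where "D = real n * (3 * C * B * \<xi> ^ N / (1 - \<xi>))"
  have D: "0 < D" unfolding D_def using n C_pos B_pos \<xi> by (intro mult_pos_pos divide_pos_pos) auto
  have b: "\<bar>bsum (G N) n x\<bar> \<le> real n * B" for x
  proof -
    have "\<bar>bsum (G N) n x\<bar> \<le> (\<Sum>j<n. \<bar>G N ((T ^^ j) x)\<bar>)" unfolding bsum_def by (rule sum_abs)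
    also have "\<dots> \<le> (\<Sum>j<n. B)" by (intro sum_mono G_bounded)
    finally show ?thesis by simp
  qed
  have i1: "integrable M (\<lambda>x. \<bar>bsum (G N) n x\<bar>)"
    by (rule integrable_bounded[of _ "real n * B"]) (auto simp: b)
  have i2: "integrable M (\<lambda>x. (bsum (G N) n x)\<^sup>2)"
  proof (rule integrable_bounded[of _ "(real n * B)\<^sup>2"])
    show "norm ((bsum (G N) n x)\<^sup>2) \<le> (real n * B)\<^sup>2" for x
      using power_mono[OF b[of x], of 2] by simp
  qed simp
  \<comment> \<open>This stands in for the Cauchy-Schwarz inequality: with \<open>D\<close> the
    bound on the second moment, integration gives exactly \<open>sqrt D\<close>.\<close>
  have amgm: "\<bar>s\<bar> \<le> (s\<^sup>2 / sqrt D + sqrt D) / 2" for s :: real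
  proof -
    have "0 \<le> (\<bar>s\<bar> - sqrt D)\<^sup>2" by simp
    then have "2 * \<bar>s\<bar> * sqrt D \<le> s\<^sup>2 + sqrt D * sqrt D"
      by (simp add: power2_eq_square algebra_simps)
    then show ?thesis using D by (simp add: field_simps)
  qed
  have "(\<integral>x. \<bar>bsum (G N) n x\<bar> \<partial>M) \<le> (\<integral>x. ((bsum (G N) n x)\<^sup>2 / sqrt D + sqrt D) / 2 \<partial>M)"
    using i2 by (intro integral_mono[OF i1] amgm) auto
  also have "\<dots> = ((\<integral>x. (bsum (G N) n x)\<^sup>2 \<partial>M) / sqrt D + sqrt D) / 2"
    using i2 by (simp add: prob_space)
  also have "\<dots> \<le> (D / sqrt D + sqrt D) / 2"
    using bsum_G_square_le[of N n] D unfolding D_def[symmetric]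
    by (intro divide_right_mono add_right_mono) auto
  also have "\<dots> = sqrt D" using D by (simp add: real_div_sqrt)
  finally show ?thesis unfolding D_def real_sqrt_mult .
qed

text \<open>One step reads: \<open>g\<close> is \<open>mart N\<close>, plus the coboundary of
  \<open>W N - g\<close>, plus \<open>G (Suc N)\<close> composed with \<open>T\<close>. The function
  \<open>W N - g\<close> appears because the dual of \<open>W N\<close> is
  \<open>W N - g + G (Suc N)\<close>. Along the orbit the coboundary telescopes.\<close>

lemma bsum_decomposition:
  "bsum g n x = bsum (mart N) n x + (W N ((T ^^ n) x) - g ((T ^^ n) x)) - (W N x - g x) + bsum (G (Suc N)) n (T x)"
proof (induction n arbitrary: x)
  case (Suc n)
  have "g x = mart N x + (W N (T x) - g (T x)) - (W N x - g x) + G (Suc N) (T x)"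
    unfolding mart_def sum_G_Suc by simp
  then show ?case using Suc[of "T x"] by (simp add: bsum_Suc funpow_swap1)
qed (simp add: bsum_def)

lemma char_mart_approx:
  assumes n: "0 < n"
  shows "cmod ((\<integral>x. iexp (t / sqrt (real n) * bsum g n x) \<partial>M) - (\<integral>x. iexp (t / sqrt (real n) * bsum (mart N) n x) \<partial>M))
    \<le> \<bar>t\<bar> * (2 * (real N + 2) * B / sqrt (real n) + sqrt (3 * C * B * \<xi> ^ Suc N / (1 - \<xi>)))"
proof -
  define a where "a = t / sqrt (real n)"
  \<comment> \<open>Two boundary values of \<open>W N - g\<close>, each at most (N+1) B + B.\<close>
  define K where "K = 2 * (real N + 2) * B"
  have i: "integrable M (\<lambda>x. iexp (a * bsum u n x))" if [measurable]: "u \<in> borel_measurable M" for u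
    by (rule integrable_bounded[of _ 1]) auto
  have b: "\<bar>bsum (G (Suc N)) n x\<bar> \<le> real n * B" for x
  proof -
    have "\<bar>bsum (G (Suc N)) n x\<bar> \<le> (\<Sum>j<n. \<bar>G (Suc N) ((T ^^ j) x)\<bar>)" unfolding bsum_def by (rule sum_abs)
    also have "\<dots> \<le> (\<Sum>j<n. B)" by (intro sum_mono G_bounded)
    finally show ?thesis by simp
  qed
  have i1: "integrable M (\<lambda>x. \<bar>bsum (G (Suc N)) n (T x)\<bar>)"
    by (rule integrable_bounded[of _ "real n * B"]) (auto simp: b)
  have pw: "cmod (iexp (a * bsum g n x) - iexp (a * bsum (mart N) n x)) \<le> \<bar>a\<bar> * (K + \<bar>bsum (G (Suc N)) n (T x)\<bar>)" for x
  proof -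
    have "cmod (iexp (a * bsum g n x) - iexp (a * bsum (mart N) n x)) \<le> \<bar>a * bsum g n x - a * bsum (mart N) n x\<bar>"
      by (rule norm_iexp_diff_le)
    also have "\<dots> = \<bar>a\<bar> * \<bar>bsum g n x - bsum (mart N) n x\<bar>"
      by (simp add: abs_mult flip: right_diff_distrib)
    also have "\<bar>bsum g n x - bsum (mart N) n x\<bar> \<le> K + \<bar>bsum (G (Suc N)) n (T x)\<bar>"
      using bsum_decomposition[of n x N] W_bounded[of N "(T ^^ n) x"] W_bounded[of N x]
        g_bounded[of "(T ^^ n) x"] g_bounded[of x]
      unfolding K_def by (simp add: algebra_simps)
    finally show ?thesis by (simp add: mult_left_mono)
  qed
  have "cmod ((\<integral>x. iexp (a * bsum g n x) \<partial>M) - (\<integral>x. iexp (a * bsum (mart N) n x) \<partial>M))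
      = cmod (\<integral>x. iexp (a * bsum g n x) - iexp (a * bsum (mart N) n x) \<partial>M)"
    by (subst Bochner_Integration.integral_diff[OF i i]) simp_all
  also have "\<dots> \<le> (\<integral>x. cmod (iexp (a * bsum g n x) - iexp (a * bsum (mart N) n x)) \<partial>M)"
    by (rule integral_norm_bound)
  also have "\<dots> \<le> (\<integral>x. \<bar>a\<bar> * (K + \<bar>bsum (G (Suc N)) n (T x)\<bar>) \<partial>M)"
    using i1 by (intro integral_mono pw integrable_norm Bochner_Integration.integrable_diff i) auto
  also have "\<dots> = \<bar>a\<bar> * (K + (\<integral>x. \<bar>bsum (G (Suc N)) n (T x)\<bar> \<partial>M))"
    using i1 by (simp add: prob_space)
  also have "(\<integral>x. \<bar>bsum (G (Suc N)) n (T x)\<bar> \<partial>M) = (\<integral>x. \<bar>bsum (G (Suc N)) n x\<bar> \<partial>M)"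
    by (rule integral_T[where g = "\<lambda>x. \<bar>bsum (G (Suc N)) n x\<bar>"]) simp
  also have "\<bar>a\<bar> * (K + (\<integral>x. \<bar>bsum (G (Suc N)) n x\<bar> \<partial>M))
      \<le> \<bar>a\<bar> * (K + sqrt (real n) * sqrt (3 * C * B * \<xi> ^ Suc N / (1 - \<xi>)))"
    by (intro mult_left_mono add_left_mono abs_bsum_G_le n) simp
  also have "\<dots> = \<bar>t\<bar> * (K / sqrt (real n) + sqrt (3 * C * B * \<xi> ^ Suc N / (1 - \<xi>)))"
    using n by (simp add: a_def field_simps)
  finally show ?thesis unfolding a_def K_def .
qed

text \<open>The error has four parts of size r/4. First \<open>N\<close> makes the remainder,
  uniformly in \<open>n\<close>, and the defect of the martingale variance small; for this fixed
  \<open>N\<close>, large \<open>n\<close> then takes care of the boundary terms and of the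
  martingale limit theorem.\<close>

theorem char_bsum_tendsto:
  "(\<lambda>n. \<integral>x. iexp (t / sqrt (real n) * bsum g n x) \<partial>M) \<longlonglongrightarrow> of_real (exp (- t\<^sup>2 * avar / 2))"
proof (rule LIMSEQ_I)
  fix r :: real assume r: "0 < r"
  define V where "V N = (\<integral>x. (mart N x)\<^sup>2 \<partial>M)" for N
  define E where "E N = \<bar>t\<bar> * sqrt (3 * C * B * \<xi> ^ Suc N / (1 - \<xi>))" for N
  have "(\<lambda>N. \<bar>t\<bar> * sqrt (3 * C * B * (\<xi> * \<xi> ^ N) / (1 - \<xi>))) \<longlonglongrightarrow> \<bar>t\<bar> * sqrt (3 * C * B * (\<xi> * 0) / (1 - \<xi>))"
    using \<xi> by (intro tendsto_intros LIMSEQ_power_zero) auto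
  then have "E \<longlonglongrightarrow> 0" by (simp add: E_def[abs_def])
  then have 1: "\<forall>\<^sub>F N in sequentially. E N < r / 4" using r by (intro order_tendstoD) auto
  have "(\<lambda>N. exp (- t\<^sup>2 * V N / 2)) \<longlonglongrightarrow> exp (- t\<^sup>2 * avar / 2)"
    unfolding V_def by (intro tendsto_intros mart_variance) auto
  then have 2: "\<forall>\<^sub>F N in sequentially. dist (exp (- t\<^sup>2 * V N / 2)) (exp (- t\<^sup>2 * avar / 2)) < r / 4"
    using r by (intro tendstoD) auto
  obtain N where N: "E N < r / 4" "dist (exp (- t\<^sup>2 * V N / 2)) (exp (- t\<^sup>2 * avar / 2)) < r / 4"
    using eventually_happens'[OF sequentially_bot eventually_conj[OF 1 2]] by auto
  have "(\<lambda>n. \<integral>x. iexp (t / sqrt (real n) * bsum (mart N) n x) \<partial>M) \<longlonglongrightarrow> of_real (exp (- t\<^sup>2 * V N / 2))"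
    unfolding V_def by (rule reverse_mds_clt[OF _ mart_bounded mart_reverse_mds]) simp
  then have 3: "\<forall>\<^sub>F n in sequentially. dist (\<integral>x. iexp (t / sqrt (real n) * bsum (mart N) n x) \<partial>M) (of_real (exp (- t\<^sup>2 * V N / 2))) < r / 4"
    using r by (intro tendstoD) auto
  have "(\<lambda>n. \<bar>t\<bar> * (2 * (real N + 2) * B / sqrt (real n))) \<longlonglongrightarrow> \<bar>t\<bar> * 0"
    by (intro tendsto_intros real_tendsto_divide_at_top[OF tendsto_const]
          filterlim_compose[OF sqrt_at_top filterlim_real_sequentially])
  then have 4: "\<forall>\<^sub>F n in sequentially. \<bar>t\<bar> * (2 * (real N + 2) * B / sqrt (real n)) < r / 4"
    using r by (intro order_tendstoD) auto
  have "\<forall>\<^sub>F n in sequentially. cmod ((\<integral>x. iexp (t / sqrt (real n) * bsum g n x) \<partial>M) - of_real (exp (- t\<^sup>2 * avar / 2))) < r"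
    using 3 4 eventually_gt_at_top[of 0]
  proof eventually_elim
    case (elim n)
    let ?p = "\<integral>x. iexp (t / sqrt (real n) * bsum g n x) \<partial>M" and ?q = "\<integral>x. iexp (t / sqrt (real n) * bsum (mart N) n x) \<partial>M"
      and ?u = "complex_of_real (exp (- t\<^sup>2 * V N / 2))" and ?v = "complex_of_real (exp (- t\<^sup>2 * avar / 2))"
    have "cmod (?p - ?q) < r / 4 + r / 4"
      using char_mart_approx[OF elim(3), of t N] elim(2) N(1) unfolding E_def distrib_left[of "\<bar>t\<bar>"] by linarith
    moreover have "cmod (?q - ?u) < r / 4" using elim(1) by (simp only: dist_norm)
    moreover have "cmod (?u - ?v) < r / 4"
      using N(2) by (simp only: dist_norm norm_of_real flip: of_real_diff) simp
    moreover have "cmod (?p - ?v) \<le> cmod (?p - ?q) + cmod (?q - ?u) + cmod (?u - ?v)"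
      using norm_triangle_ineq[of "?p - ?q" "?q - ?v"] norm_triangle_ineq[of "?q - ?u" "?u - ?v"] by simp
    ultimately show ?case by linarith
  qed
  then show "\<exists>no. \<forall>n\<ge>no. cmod ((\<integral>x. iexp (t / sqrt (real n) * bsum g n x) \<partial>M) - of_real (exp (- t\<^sup>2 * avar / 2))) < r"
    by (simp only: eventually_sequentially)
qed

section \<open>Vanishing variance and coboundaries\<close>

lemma AE_summable_G: "AE x in M. summable (\<lambda>n. \<bar>G n x\<bar>)"
proof -
  have "(\<integral>\<^sup>+x. (\<Sum>n. ennreal \<bar>G n x\<bar>) \<partial>M) = (\<Sum>n. \<integral>\<^sup>+x. ennreal \<bar>G n x\<bar> \<partial>M)"
    by (rule nn_integral_suminf) simp
  also have "\<dots> \<le> (\<Sum>n. ennreal (C * \<xi> ^ n))"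
  proof (rule suminf_le)
    fix n
    have "integrable M (\<lambda>x. \<bar>G n x\<bar>)" by (rule integrable_bounded[of _ B]) (simp_all add: G_bounded)
    then have "(\<integral>\<^sup>+x. ennreal \<bar>G n x\<bar> \<partial>M) = ennreal (\<integral>x. \<bar>G n x\<bar> \<partial>M)"
      by (rule nn_integral_eq_integral) simp
    then show "(\<integral>\<^sup>+x. ennreal \<bar>G n x\<bar> \<partial>M) \<le> ennreal (C * \<xi> ^ n)"
      using ennreal_leI[OF G_L1_le[of n]] by simp
  qed auto
  also have "\<dots> = ennreal (\<Sum>n. C * \<xi> ^ n)"
    using \<xi> C_pos by (intro suminf_ennreal2 summable_mult summable_geometric) auto
  finally have "(\<integral>\<^sup>+x. (\<Sum>n. ennreal \<bar>G n x\<bar>) \<partial>M) \<noteq> \<infinity>"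
    by (auto simp: top_unique)
  then have "AE x in M. (\<Sum>n. ennreal \<bar>G n x\<bar>) \<noteq> \<infinity>"
    by (intro nn_integral_PInf_AE) simp_all
  then show ?thesis
    by eventually_elim (rule summable_suminf_not_top, simp_all)
qed

text \<open>Let h be the sum of all \<open>G n\<close>. The martingale differences converge almost
  everywhere to m, that is h minus h - g composed with \<open>T\<close>, and Fatou's lemma bounds
  the integral of m^2 by the limit of their variances, which is 0. Then m = 0, which says that
  \<open>g\<close> is the coboundary of h - g.\<close>

theorem variance_0_imp_coboundary:
  assumes "avar = 0"
  shows "\<exists>\<Psi>\<in>borel_measurable M. AE x in M. g x = \<Psi> (T x) - \<Psi> x"
proof -
  define h where "h x = (\<Sum>n. G n x)" for x
  have [measurable]: "h \<in> borel_measurable M" unfolding h_def by measurable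
  define m where "m x = h x - (h (T x) - g (T x))" for x
  have [measurable]: "m \<in> borel_measurable M" unfolding m_def by measurable
  have lim: "AE x in M. (\<lambda>N. mart N x) \<longlonglongrightarrow> m x"
    using AE_summable_G AE_T[OF AE_summable_G]
  proof eventually_elim
    case (elim x)
    have W: "(\<lambda>N. W N y) \<longlonglongrightarrow> h y" if "summable (\<lambda>n. \<bar>G n y\<bar>)" for y
      unfolding W_def h_def by (rule summable_LIMSEQ') (rule summable_rabs_cancel[OF that])
    have "(\<lambda>N. G (Suc N) (T x)) \<longlonglongrightarrow> 0"
      by (rule LIMSEQ_Suc[OF summable_LIMSEQ_zero[OF summable_rabs_cancel[OF elim(2)]]])
    then have "(\<lambda>N. W N x - (W N (T x) - g (T x) + G (Suc N) (T x))) \<longlonglongrightarrow> h x - (h (T x) - g (T x) + 0)"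
      by (intro tendsto_intros W elim)
    then show ?case unfolding mart_def sum_G_Suc m_def by simp
  qed
  have "(\<integral>\<^sup>+x. ennreal ((m x)\<^sup>2) \<partial>M) \<le> (\<integral>\<^sup>+x. liminf (\<lambda>N. ennreal ((mart N x)\<^sup>2)) \<partial>M)"
  proof (rule nn_integral_mono_AE)
    show "AE x in M. ennreal ((m x)\<^sup>2) \<le> liminf (\<lambda>N. ennreal ((mart N x)\<^sup>2))"
      using lim
    proof eventually_elim
      case (elim x)
      have "(\<lambda>N. ennreal ((mart N x)\<^sup>2)) \<longlonglongrightarrow> ennreal ((m x)\<^sup>2)"
        by (intro tendsto_ennrealI tendsto_intros elim)
      from lim_imp_Liminf[OF sequentially_bot this] show ?case by simp
    qed
  qed
  also have "\<dots> \<le> liminf (\<lambda>N. \<integral>\<^sup>+x. ennreal ((mart N x)\<^sup>2) \<partial>M)"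
    by (rule nn_integral_liminf) simp
  also have "(\<lambda>N. \<integral>\<^sup>+x. ennreal ((mart N x)\<^sup>2) \<partial>M) = (\<lambda>N. ennreal (\<integral>x. (mart N x)\<^sup>2 \<partial>M))"
  proof
    fix N
    have "integrable M (\<lambda>x. (mart N x)\<^sup>2)"
    proof (rule integrable_bounded[of _ "(2 * (real (Suc N) * B))\<^sup>2"])
      show "norm ((mart N x)\<^sup>2) \<le> (2 * (real (Suc N) * B))\<^sup>2" for x
        using power_mono[OF mart_bounded[of N x], of 2] by simp
    qed simp
    then show "(\<integral>\<^sup>+x. ennreal ((mart N x)\<^sup>2) \<partial>M) = ennreal (\<integral>x. (mart N x)\<^sup>2 \<partial>M)"
      by (rule nn_integral_eq_integral) simp
  qed
  also have "liminf (\<lambda>N. ennreal (\<integral>x. (mart N x)\<^sup>2 \<partial>M)) = 0"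
    using lim_imp_Liminf[OF sequentially_bot tendsto_ennrealI[OF mart_variance]] assms by simp
  finally have "(\<integral>\<^sup>+x. ennreal ((m x)\<^sup>2) \<partial>M) = 0" by simp
  then have "AE x in M. m x = 0" by (simp add: nn_integral_0_iff_AE)
  then have "AE x in M. g x = (h (T x) - g (T x)) - (h x - g x)"
    by eventually_elim (simp add: m_def)
  then show ?thesis by (intro bexI[of _ "\<lambda>x. h x - g x"]) auto
qed

theorem variance_0_iff_coboundary:
  "avar = 0 \<longleftrightarrow> (\<exists>\<Psi>\<in>borel_measurable M. AE x in M. g x = \<Psi> (T x) - \<Psi> x)"
proof
  assume "\<exists>\<Psi>\<in>borel_measurable M. AE x in M. g x = \<Psi> (T x) - \<Psi> x"
  then obtain \<Psi> where \<Psi>: "\<Psi> \<in> borel_measurable M" "AE x in M. g x = \<Psi> (T x) - \<Psi> x" by blast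
  \<comment> \<open>At frequency 1 the characteristic functions tend to 1, by the coboundary
    property, and to exp (- avar / 2), by the limit theorem.\<close>
  have "(\<lambda>n. 1 / sqrt (real n)) \<longlonglongrightarrow> 0"
    by (intro real_tendsto_divide_at_top[OF tendsto_const] filterlim_compose[OF sqrt_at_top filterlim_real_sequentially])
  from coboundary_char_tendsto_1[OF g_measurable \<Psi> this] char_bsum_tendsto[of 1]
  have "complex_of_real (exp (- 1\<^sup>2 * avar / 2)) = 1" by (rule LIMSEQ_unique[rotated])
  then have "exp (- 1\<^sup>2 * avar / 2) = 1" by (simp only: of_real_eq_1_iff)
  then show "avar = 0" by simp
qed (rule variance_0_imp_coboundary)

end

context ergodic
begin

text \<open>The transfer function may fail to be integrable, so the two sides cannot simply be
  integrated. Instead the Birkhoff averages tend to the mean c by the ergodic theorem, while the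
  coboundary property makes them small in law. At frequency pi / c the two limits are -1 and
  1.\<close>

lemma coboundary_integral_0:
  fixes u :: "'a \<Rightarrow> real"
  assumes u: "integrable M u" and \<Psi>: "\<Psi> \<in> borel_measurable M" "AE x in M. u x = \<Psi> (T x) - \<Psi> x"
  shows "(\<integral>x. u x \<partial>M) = 0"
proof (rule ccontr)
  define c where "c = (\<integral>x. u x \<partial>M)"
  assume "(\<integral>x. u x \<partial>M) \<noteq> 0"
  then have c0: "c \<noteq> 0" by (simp add: c_def)
  have [measurable]: "u \<in> borel_measurable M" using u by auto
  have "(\<lambda>n. \<integral>x. iexp (pi / c / real n * bsum u n x) \<partial>M) \<longlonglongrightarrow> (\<integral>x. iexp pi \<partial>M)"
  proof (rule integral_dominated_convergence[where w = "\<lambda>_. 1"])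
    show "AE x in M. (\<lambda>n. iexp (pi / c / real n * bsum u n x)) \<longlonglongrightarrow> iexp pi"
      using birkhoff[OF u]
    proof eventually_elim
      case (elim x)
      have "(\<lambda>n. iexp (pi / c * (bsum u n x / real n))) \<longlonglongrightarrow> iexp (pi / c * c)"
        unfolding c_def by (intro tendsto_intros elim)
      then show ?case using c0 by simp
    qed
  qed auto
  moreover have "(\<lambda>n. \<integral>x. iexp (pi / c / real n * bsum u n x) \<partial>M) \<longlonglongrightarrow> 1"
    by (rule coboundary_char_tendsto_1[OF _ \<Psi>])
       (simp, rule real_tendsto_divide_at_top[OF tendsto_const filterlim_real_sequentially])
  ultimately have "(\<integral>x. iexp pi \<partial>M) = 1" by (rule LIMSEQ_unique)
  then show False by (simp add: prob_space)
qed

end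

section \<open>Ergodicity of unique equilibrium states\<close>

lemma dyn_join_finite:
  assumes "finite P"
  shows "finite (dyn_join f P n)"
proof (rule finite_subset)
  show "dyn_join f P n \<subseteq> (\<lambda>A. {x. \<forall>j<n. (f ^^ j) x \<in> A j}) ` (PiE {..<n} (\<lambda>_. P))"
  proof
    fix C assume "C \<in> dyn_join f P n"
    then obtain A where A: "\<forall>j<n. A j \<in> P" "C = {x. \<forall>j<n. (f ^^ j) x \<in> A j}"
      unfolding dyn_join_def by blast
    show "C \<in> (\<lambda>A. {x. \<forall>j<n. (f ^^ j) x \<in> A j}) ` (PiE {..<n} (\<lambda>_. P))"
      by (rule image_eqI[of _ _ "restrict A {..<n}"]) (use A in auto)
  qed
qed (use assms in \<open>auto intro: finite_PiE\<close>)

lemma dyn_join_disjoint: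
  assumes "disjoint P"
  shows "disjoint (dyn_join f P n)"
proof (rule disjointI)
  fix C C' assume C: "C \<in> dyn_join f P n" "C' \<in> dyn_join f P n" "C \<noteq> C'"
  obtain A A' where A: "\<forall>j<n. A j \<in> P" "C = {x. \<forall>j<n. (f ^^ j) x \<in> A j}"
    "\<forall>j<n. A' j \<in> P" "C' = {x. \<forall>j<n. (f ^^ j) x \<in> A' j}"
    using C(1,2) unfolding dyn_join_def by blast
  show "C \<inter> C' = {}"
  proof (rule ccontr)
    assume "C \<inter> C' \<noteq> {}"
    then obtain x where x: "x \<in> C" "x \<in> C'" by blast
    have "A j = A' j" if "j < n" for j
      using x A that assms unfolding disjoint_def by blast
    then have "C = C'" unfolding A by auto
    with C(3) show False by blast
  qed
qed

lemma dyn_join_measurable: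
  assumes [measurable]: "f \<in> borel_measurable borel" and P: "P \<subseteq> sets borel"
  shows "dyn_join f P n \<subseteq> sets borel"
proof
  fix C assume "C \<in> dyn_join f P n"
  then obtain A where A: "\<forall>j<n. A j \<in> P" "C = {x. \<forall>j<n. (f ^^ j) x \<in> A j}"
    unfolding dyn_join_def by blast
  have fn[measurable]: "f ^^ j \<in> borel_measurable borel" for j
    by (induction j) (auto simp: id_def)
  have "C = (\<Inter>j<n. (f ^^ j) -` A j \<inter> space borel) \<inter> space borel" unfolding A by auto
  moreover have "(f ^^ j) -` A j \<inter> space borel \<in> sets borel" if "j < n" for j
    using A P that by (intro measurable_sets[OF fn]) auto
  ultimately show "C \<in> sets borel"
    by (cases "n = 0") (auto intro!: sets.Int sets.finite_INT)
qed

text \<open>Since m is at least \<open>t * a\<close> and at least \<open>(1 - t) * b\<close>,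
  monotonicity of the logarithm bounds m ln m from below by the two separate terms. The weights in
  front of a ln t and b ln (1 - t) are then dropped, which is allowed because these logarithms are
  negative. Zero masses fit in through 0 ln 0 = 0.\<close>

lemma entropy_term_le:
  fixes a b t :: real
  assumes t: "0 < t" "t < 1" and ab: "0 \<le> a" "0 \<le> b"
  defines "m \<equiv> t * a + (1 - t) * b"
  shows "- (m * ln m) \<le> t * (- (a * ln a)) + (1 - t) * (- (b * ln b)) + (- (a * ln t)) + (- (b * ln (1 - t)))"
proof -
  have aux: "s * y * ln (s * y) \<le> s * y * ln x \<and> s * y * ln (s * y) \<ge> s * (y * ln y) + y * ln s"
    if "0 < s" "s < 1" "0 \<le> y" "s * y \<le> x" for s x y :: real
  proof (cases "y = 0")
    case False
    then have y: "0 < y" using that by simp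
    have sy: "0 < s * y" using y that by simp
    then have "ln (s * y) \<le> ln x" using that(4) by simp
    moreover have "ln (s * y) = ln s + ln y" using y that by (simp add: ln_mult)
    moreover have "y * ln s \<le> s * y * ln s"
      using that y by (simp add: mult_left_le_one_le mult_le_cancel_right1 ln_less_zero)
    moreover have "s * y * ln (s * y) \<le> s * y * ln x"
      using sy \<open>ln (s * y) \<le> ln x\<close> by (intro mult_left_mono) auto
    ultimately show ?thesis by (simp add: algebra_simps)
  qed simp
  have 1: "t * a * ln m \<ge> t * (a * ln a) + a * ln t"
  proof -
    have "t * a \<le> m" using t ab by (simp add: m_def)
    from aux[OF t ab(1) this] show ?thesis by linarith
  qed
  have 2: "(1 - t) * b * ln m \<ge> (1 - t) * (b * ln b) + b * ln (1 - t)"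
  proof -
    have "(1 - t) * b \<le> m" using t ab by (simp add: m_def)
    from aux[OF _ _ ab(2) this] t show ?thesis by linarith
  qed
  have "m * ln m = t * a * ln m + (1 - t) * b * ln m" by (simp add: m_def algebra_simps)
  then show ?thesis using 1 2 by simp
qed

text \<open>The masses of disjoint sets sum to at most 1, so the error terms add up to a constant
  that depends on \<open>t\<close> only and not on the number of sets.\<close>

lemma partition_entropy_convex_le:
  assumes t: "0 < t" "t < 1"
    and \<eta>: "prob_space \<eta>1" "prob_space \<eta>2" "sets \<eta>1 = sets borel" "sets \<eta>2 = sets borel"
    and conv: "\<And>B. B \<in> sets borel \<Longrightarrow> measure \<mu> B = t * measure \<eta>1 B + (1 - t) * measure \<eta>2 B"
    and D: "finite D" "disjoint D" "D \<subseteq> sets borel"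
  shows "partition_entropy \<mu> D \<le> t * partition_entropy \<eta>1 D + (1 - t) * partition_entropy \<eta>2 D
    + (- ln t - ln (1 - t))"
proof -
  have sum_le: "(\<Sum>A\<in>D. measure \<eta> A) \<le> 1" if "prob_space \<eta>" "sets \<eta> = sets borel" for \<eta> :: "'a measure"
  proof -
    interpret prob_space \<eta> by fact
    have "(\<Sum>A\<in>D. measure \<eta> A) = measure \<eta> (\<Union>A\<in>D. A)"
      using D that by (intro finite_measure_finite_Union[symmetric])
        (auto simp: disjoint_family_on_disjoint_image[of id, simplified] disjoint_family_on_def disjoint_def)
    then show ?thesis by simp
  qed
  have "partition_entropy \<mu> D = (\<Sum>A\<in>D. - (measure \<mu> A * ln (measure \<mu> A)))"
    unfolding partition_entropy_def by (simp add: sum_negf)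
  also have "\<dots> \<le> (\<Sum>A\<in>D. t * (- (measure \<eta>1 A * ln (measure \<eta>1 A)))
      + (1 - t) * (- (measure \<eta>2 A * ln (measure \<eta>2 A)))
      + (- (measure \<eta>1 A * ln t)) + (- (measure \<eta>2 A * ln (1 - t))))"
  proof (rule sum_mono)
    fix A assume "A \<in> D"
    then have "measure \<mu> A = t * measure \<eta>1 A + (1 - t) * measure \<eta>2 A" using conv D by blast
    then show "- (measure \<mu> A * ln (measure \<mu> A)) \<le> t * (- (measure \<eta>1 A * ln (measure \<eta>1 A)))
      + (1 - t) * (- (measure \<eta>2 A * ln (measure \<eta>2 A)))
      + (- (measure \<eta>1 A * ln t)) + (- (measure \<eta>2 A * ln (1 - t)))"
      using entropy_term_le[OF t, of "measure \<eta>1 A" "measure \<eta>2 A"] by simp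
  qed
  also have "\<dots> = t * partition_entropy \<eta>1 D + (1 - t) * partition_entropy \<eta>2 D
     + (\<Sum>A\<in>D. measure \<eta>1 A) * (- ln t) + (\<Sum>A\<in>D. measure \<eta>2 A) * (- ln (1 - t))"
    unfolding partition_entropy_def
    by (simp only: sum.distrib sum_distrib_left sum_distrib_right sum_negf[symmetric] mult_minus_right)
  also have "\<dots> \<le> t * partition_entropy \<eta>1 D + (1 - t) * partition_entropy \<eta>2 D + 1 * (- ln t) + 1 * (- ln (1 - t))"
    using t by (intro add_mono order_refl mult_right_mono sum_le \<eta>) (auto intro: less_imp_le simp: ln_le_zero_iff)
  finally show ?thesis by simp
qed

text \<open>The error per partition is constant, so it vanishes on division by \<open>n\<close>.
  Strict real bounds \<open>c1\<close> and \<open>c2\<close> in place of the entropies avoid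
  arithmetic with infinite values and turn the upper limits into inequalities that hold for all
  large \<open>n\<close> at once.\<close>

lemma ks_entropy_convex_le:
  fixes f :: "'a::topological_space \<Rightarrow> 'a"
  assumes f: "f \<in> borel_measurable borel" and t: "0 < t" "t < 1"
    and \<eta>: "prob_space \<eta>1" "prob_space \<eta>2" "sets \<eta>1 = sets borel" "sets \<eta>2 = sets borel"
    and conv: "\<And>B. B \<in> sets borel \<Longrightarrow> measure \<mu> B = t * measure \<eta>1 B + (1 - t) * measure \<eta>2 B"
    and c: "ks_entropy f \<eta>1 < ereal c1" "ks_entropy f \<eta>2 < ereal c2"
  shows "ks_entropy f \<mu> \<le> ereal (t * c1 + (1 - t) * c2)"
  unfolding ks_entropy_def
proof (rule SUP_least, safe)
  fix P :: "'a set set" assume P: "finite_partition P"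
  let ?H = "\<lambda>\<eta> n. partition_entropy \<eta> (dyn_join f P n)"
  define K where "K = - ln t - ln (1 - t)"
  have ev: "\<forall>\<^sub>F n in sequentially. ?H \<eta> n / real n < c" if "ks_entropy f \<eta> < ereal c" for \<eta> c
  proof -
    have "limsup (\<lambda>n. ereal (?H \<eta> n / real n)) \<le> ks_entropy f \<eta>"
      unfolding ks_entropy_def by (rule SUP_upper) (use P in simp)
    then have "limsup (\<lambda>n. ereal (?H \<eta> n / real n)) < ereal c" using that by (rule le_less_trans)
    from Limsup_lessD[OF this] show ?thesis by simp
  qed
  have "limsup (\<lambda>n. ereal (?H \<mu> n / real n)) \<le> limsup (\<lambda>n. ereal (t * c1 + (1 - t) * c2 + K / real n))"
  proof (rule Limsup_mono)
    show "\<forall>\<^sub>F n in sequentially. ereal (?H \<mu> n / real n) \<le> ereal (t * c1 + (1 - t) * c2 + K / real n)"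
      using ev[OF c(1)] ev[OF c(2)] eventually_gt_at_top[of 0]
    proof eventually_elim
      case (elim n)
      have "?H \<mu> n \<le> t * ?H \<eta>1 n + (1 - t) * ?H \<eta>2 n + K"
        unfolding K_def using P unfolding finite_partition_def
        by (intro partition_entropy_convex_le t \<eta> conv dyn_join_finite dyn_join_disjoint dyn_join_measurable f) auto
      then have "?H \<mu> n / real n \<le> (t * ?H \<eta>1 n + (1 - t) * ?H \<eta>2 n + K) / real n"
        by (intro divide_right_mono) auto
      also have "\<dots> = t * (?H \<eta>1 n / real n) + (1 - t) * (?H \<eta>2 n / real n) + K / real n"
        by (simp add: add_divide_distrib)
      also have "\<dots> \<le> t * c1 + (1 - t) * c2 + K / real n"
        using elim t by (intro add_mono mult_left_mono) auto
      finally show ?case by simp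
    qed
  qed
  also have "\<dots> = ereal (t * c1 + (1 - t) * c2)"
  proof (rule lim_imp_Limsup)
    have "(\<lambda>n. t * c1 + (1 - t) * c2 + K / real n) \<longlonglongrightarrow> t * c1 + (1 - t) * c2 + 0"
      by (intro tendsto_add tendsto_const real_tendsto_divide_at_top[OF tendsto_const filterlim_real_sequentially])
    then show "(\<lambda>n. ereal (t * c1 + (1 - t) * c2 + K / real n)) \<longlonglongrightarrow> ereal (t * c1 + (1 - t) * c2)"
      by simp
  qed simp
  finally show "limsup (\<lambda>n. ereal (?H \<mu> n / real n)) \<le> ereal (t * c1 + (1 - t) * c2)" .
qed

lemma invariant_prob_uniform_measure:
  assumes f[measurable]: "f \<in> borel_measurable borel" and \<mu>: "invariant_prob f \<mu>"
    and A: "A \<in> sets borel" "f -` A = A" "0 < measure \<mu> A"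
  shows "invariant_prob f (uniform_measure \<mu> A)"
proof -
  interpret prob_space \<mu> using \<mu> by (simp add: invariant_prob_def)
  have s[measurable_cong]: "sets \<mu> = sets borel" using \<mu> by (simp add: invariant_prob_def)
  have sp: "space \<mu> = UNIV" using sets_eq_imp_space_eq[OF s] by simp
  note [measurable] = A(1)
  have "emeasure \<mu> A \<noteq> 0" using A(3) by (simp add: emeasure_eq_measure)
  then have ps: "prob_space (uniform_measure \<mu> A)"
    by (intro prob_space_uniform_measure) (auto simp: emeasure_eq_measure)
  have "distr (uniform_measure \<mu> A) borel f = uniform_measure \<mu> A"
  proof (rule measure_eqI)
    fix B assume "B \<in> sets (distr (uniform_measure \<mu> A) borel f)"
    then have B[measurable]: "B \<in> sets borel" by simp
    have fB: "f -` B \<in> sets borel" using measurable_sets[OF f B] by simp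
    have "emeasure (distr (uniform_measure \<mu> A) borel f) B = emeasure (uniform_measure \<mu> A) (f -` B)"
      by (subst emeasure_distr) (auto simp: sp)
    also have "\<dots> = emeasure \<mu> (A \<inter> f -` B) / emeasure \<mu> A"
      by (rule emeasure_uniform_measure) (use fB s in auto)
    also have "A \<inter> f -` B = f -` (A \<inter> B) \<inter> space \<mu>" using A(2) sp by auto
    also have "emeasure \<mu> (f -` (A \<inter> B) \<inter> space \<mu>) = emeasure (distr \<mu> borel f) (A \<inter> B)"
      by (rule emeasure_distr[symmetric]) (auto simp: s measurable_cong_sets[OF s])
    also have "distr \<mu> borel f = \<mu>" using \<mu> by (simp add: invariant_prob_def)
    also have "emeasure \<mu> (A \<inter> B) / emeasure \<mu> A = emeasure (uniform_measure \<mu> A) B"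
      by (rule emeasure_uniform_measure[symmetric]) (auto simp: s)
    finally show "emeasure (distr (uniform_measure \<mu> A) borel f) B = emeasure (uniform_measure \<mu> A) B" .
  qed (simp add: s)
  then show ?thesis using ps s by (simp add: invariant_prob_def)
qed

lemma (in prob_space) integral_uniform_measure:
  fixes g :: "'a \<Rightarrow> real"
  assumes [measurable]: "A \<in> sets M" "g \<in> borel_measurable M" and "0 < measure M A"
  shows "measure M A * (\<integral>x. g x \<partial>uniform_measure M A) = (\<integral>x. indicator A x * g x \<partial>M)"
proof -
  have "uniform_measure M A = density M (\<lambda>x. ennreal (indicator A x / measure M A))"
    unfolding uniform_measure_def
    using assms(3) by (intro density_cong) (auto simp: emeasure_eq_measure indicator_def divide_ennreal[symmetric] simp flip: ennreal_1)
  then have "(\<integral>x. g x \<partial>uniform_measure M A) = (\<integral>x. indicator A x / measure M A * g x \<partial>M)"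
    by (simp add: integral_density)
  also have "\<dots> = (\<integral>x. indicator A x * g x \<partial>M) / measure M A"
    by (simp flip: Bochner_Integration.integral_divide_zero)
  finally show ?thesis using assms(3) by simp
qed

text \<open>Entropy is convex because splitting a measure costs only a bounded amount per partition. So the
  two parts of a nontrivial invariant decomposition of an equilibrium state cannot both have smaller
  free energy, and one of them is another equilibrium state.\<close>

theorem unique_equilibrium_state_ergodic:
  fixes f :: "'a::topological_space \<Rightarrow> 'a"
  assumes f[measurable]: "f \<in> borel_measurable borel"
    and \<phi>[measurable]: "\<phi> \<in> borel_measurable borel" and \<phi>_bounded: "\<And>x. \<bar>\<phi> x\<bar> \<le> K"
    and eq: "equilibrium_state f \<phi> \<mu>"
    and uniq: "\<And>\<eta>. equilibrium_state f \<phi> \<eta> \<Longrightarrow> \<eta> = \<mu>"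
    and A: "A \<in> sets borel" "f -` A = A"
  shows "measure \<mu> A = 0 \<or> measure \<mu> A = 1"
proof (rule ccontr)
  assume nontriv: "\<not> ?thesis"
  have inv: "invariant_prob f \<mu>" using eq by (simp add: equilibrium_state_def)
  interpret prob_space \<mu> using inv by (simp add: invariant_prob_def)
  have s[measurable_cong]: "sets \<mu> = sets borel" using inv by (simp add: invariant_prob_def)
  have sp: "space \<mu> = UNIV" using sets_eq_imp_space_eq[OF s] by simp
  note [measurable] = A(1)
  define t where "t = measure \<mu> A"
  have t: "0 < t" "t < 1"
    using nontriv prob_le_1[of A] measure_nonneg[of \<mu> A] unfolding t_def by (auto simp: less_le)
  have tc: "measure \<mu> (- A) = 1 - t"
    using prob_compl[of A] by (simp add: t_def s sp Compl_eq_Diff_UNIV)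
  define \<eta>1 where "\<eta>1 = uniform_measure \<mu> A"
  define \<eta>2 where "\<eta>2 = uniform_measure \<mu> (- A)"
  have cA[measurable]: "- A \<in> sets borel" using A(1) by simp
  have "invariant_prob f \<eta>1" "invariant_prob f \<eta>2"
    unfolding \<eta>1_def \<eta>2_def using A cA t tc
    by (auto intro!: invariant_prob_uniform_measure f inv simp: t_def vimage_Compl)
  note inv12 = this
  have ne: "emeasure \<mu> A \<noteq> 0" "emeasure \<mu> (- A) \<noteq> 0"
    using t tc by (auto simp: emeasure_eq_measure t_def)
  have m1: "measure \<eta>1 B = measure \<mu> (A \<inter> B) / t" if "B \<in> sets borel" for B
    unfolding \<eta>1_def t_def by (rule measure_uniform_measure) (use ne that s in auto)
  have m2: "measure \<eta>2 B = measure \<mu> (- A \<inter> B) / (1 - t)" if "B \<in> sets borel" for B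
    unfolding \<eta>2_def tc[symmetric] by (rule measure_uniform_measure) (use ne that s in auto)
  have conv: "measure \<mu> B = t * measure \<eta>1 B + (1 - t) * measure \<eta>2 B" if B: "B \<in> sets borel" for B
  proof -
    have "measure \<mu> B = measure \<mu> ((A \<inter> B) \<union> (- A \<inter> B))" by (rule arg_cong[of _ _ "measure \<mu>"]) auto
    also have "\<dots> = measure \<mu> (A \<inter> B) + measure \<mu> (- A \<inter> B)"
      using B A cA s by (intro finite_measure_Union) auto
    finally show ?thesis using t m1[OF B] m2[OF B] by simp
  qed
  define I where "I \<eta> = (\<integral>x. \<phi> x \<partial>\<eta>)" for \<eta>
  have i\<phi>: "integrable \<mu> (\<lambda>x. indicator S x * \<phi> x)" if "S \<in> sets borel" for S
    by (rule integrable_const_bound[of _ K]) (use \<phi>_bounded that in \<open>auto simp: indicator_def intro: order_trans[OF abs_ge_zero]\<close>)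
  have "I \<mu> = (\<integral>x. indicator A x * \<phi> x + indicator (- A) x * \<phi> x \<partial>\<mu>)"
    unfolding I_def by (rule Bochner_Integration.integral_cong) (auto simp: indicator_def)
  also have "\<dots> = (\<integral>x. indicator A x * \<phi> x \<partial>\<mu>) + (\<integral>x. indicator (- A) x * \<phi> x \<partial>\<mu>)"
    by (rule Bochner_Integration.integral_add) (auto intro!: i\<phi> A cA)
  also have "(\<integral>x. indicator A x * \<phi> x \<partial>\<mu>) = t * I \<eta>1"
    unfolding I_def \<eta>1_def t_def by (rule integral_uniform_measure[symmetric]) (use t in \<open>auto simp: t_def s\<close>)
  also have "(\<integral>x. indicator (- A) x * \<phi> x \<partial>\<mu>) = (1 - t) * I \<eta>2"
    unfolding I_def \<eta>2_def tc[symmetric] by (rule integral_uniform_measure[symmetric]) (use t tc A(1) in \<open>auto simp: s\<close>)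
  finally have I: "I \<mu> = t * I \<eta>1 + (1 - t) * I \<eta>2" .
  \<comment> \<open>An invariant measure with no smaller free energy would be an equilibrium state
    too, against uniqueness.\<close>
  have less: "free_energy f \<phi> \<eta> < free_energy f \<phi> \<mu>" if "invariant_prob f \<eta>" "\<eta> \<noteq> \<mu>" for \<eta>
  proof (rule ccontr)
    assume "\<not> ?thesis"
    then have "free_energy f \<phi> \<mu> \<le> free_energy f \<phi> \<eta>" by simp
    then have "equilibrium_state f \<phi> \<eta>"
      using eq that(1) unfolding equilibrium_state_def by (meson order_trans)
    with uniq that(2) show False by blast
  qed
  have "\<eta>1 \<noteq> \<mu>" using m1[OF A(1)] t by (auto simp: t_def)
  then have F1: "ks_entropy f \<eta>1 + ereal (I \<eta>1) < ks_entropy f \<mu> + ereal (I \<mu>)"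
    using less[OF inv12(1)] by (simp add: free_energy_def I_def)
  have "\<eta>2 \<noteq> \<mu>" using m2[OF cA] t tc by auto
  then have F2: "ks_entropy f \<eta>2 + ereal (I \<eta>2) < ks_entropy f \<mu> + ereal (I \<mu>)"
    using less[OF inv12(2)] by (simp add: free_energy_def I_def)
  \<comment> \<open>Real numbers are inserted between the entropies before anything is subtracted:
    the entropy of \<open>\<mu>\<close> is not known to be finite until \<open>le\<close>
    below.\<close>
  have ex: "\<exists>c. a < ereal c \<and> ereal (c + u) < b + ereal v" if lt: "a + ereal u < b + ereal v" for a b u v
  proof -
    obtain d where d: "a + ereal u < ereal d" "ereal d < b + ereal v" using ereal_dense2[OF lt] by auto
    have "a < ereal (d - u)" using d(1) by (cases a) auto
    then show ?thesis using d(2) by (intro exI[of _ "d - u"]) simp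
  qed
  obtain c1 where c1: "ks_entropy f \<eta>1 < ereal c1" "ereal (c1 + I \<eta>1) < ks_entropy f \<mu> + ereal (I \<mu>)"
    using ex[OF F1] by blast
  obtain c2 where c2: "ks_entropy f \<eta>2 < ereal c2" "ereal (c2 + I \<eta>2) < ks_entropy f \<mu> + ereal (I \<mu>)"
    using ex[OF F2] by blast
  have le: "ks_entropy f \<mu> \<le> ereal (t * c1 + (1 - t) * c2)"
    by (rule ks_entropy_convex_le[OF f t _ _ _ _ conv c1(1) c2(1)])
       (use inv12 in \<open>auto simp: invariant_prob_def\<close>)
  then have "ks_entropy f \<mu> \<noteq> \<infinity>" by auto
  moreover have "ks_entropy f \<mu> \<noteq> - \<infinity>" using c1(2) by auto
  ultimately obtain h where h: "ks_entropy f \<mu> = ereal h" by (cases "ks_entropy f \<mu>") auto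
  have "t * (c1 + I \<eta>1) + (1 - t) * (c2 + I \<eta>2) < t * (h + I \<mu>) + (1 - t) * (h + I \<mu>)"
    using c1(2) c2(2) t h by (intro add_strict_mono[OF mult_strict_left_mono mult_strict_left_mono]) auto
  then show False using le h I by (simp add: algebra_simps)
qed

section \<open>Continuity of Hoelder potentials\<close>

context riemannian_manifold
begin

lemma chart_at: "chart_at x \<in> atlas \<and> x \<in> fst (chart_at x)"
proof -
  have "\<exists>c. c \<in> atlas \<and> x \<in> fst c" using charts_cover by blast
  then show ?thesis unfolding chart_at_def by (rule someI_ex)
qed

text \<open>The form is expanded in the standard basis; its finitely many coefficients are
  continuous in the base point, hence bounded on the compact set. This makes the length of chart
  segments comparable to their coordinate length.\<close>

lemma metric_locally_bounded:
  assumes c: "c \<in> atlas" and S: "compact S" "S \<subseteq> snd c ` fst c"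
  shows "\<exists>K\<ge>0. \<forall>z\<in>S. \<forall>w. metric c (chart_inv c z) w w \<le> K * (norm w)\<^sup>2"
proof -
  have hom: "homeomorphism (fst c) (snd c ` fst c) (snd c) (chart_inv c)" using chart[OF c] by simp
  have "\<exists>b\<ge>0. \<forall>z\<in>S. \<bar>metric c (chart_inv c z) u v\<bar> \<le> b" for u v
  proof -
    have "continuous_on (snd c ` fst c) (\<lambda>y. metric c (chart_inv c y) u v)"
      using metric_smooth[OF c, of u v] unfolding smooth_on_def by (metis Ck_on.simps(1))
    then have "compact ((\<lambda>y. metric c (chart_inv c y) u v) ` S)"
      using S continuous_on_subset by (blast intro: compact_continuous_image)
    then obtain b where "\<forall>r\<in>(\<lambda>y. metric c (chart_inv c y) u v) ` S. norm r \<le> b"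
      using compact_imp_bounded bounded_iff by blast
    then show ?thesis by (intro exI[of _ "max 0 b"]) (auto simp: max.coboundedI2)
  qed
  then obtain b where b: "\<And>u v. 0 \<le> b u v" "\<And>u v z. z \<in> S \<Longrightarrow> \<bar>metric c (chart_inv c z) u v\<bar> \<le> b u v"
    by metis
  define K where "K = (\<Sum>(i, j)\<in>Basis \<times> Basis. b i j)"
  have "metric c (chart_inv c z) w w \<le> K * (norm w)\<^sup>2" if z: "z \<in> S" for z w
  proof -
    let ?g = "metric c (chart_inv c z)"
    have "chart_inv c z \<in> fst c" using homeomorphism_image2[OF hom] S z by blast
    then have bl: "bilinear ?g" by (rule metric_bilinear[OF c])
    have "?g w w = ?g (\<Sum>i\<in>Basis. (w \<bullet> i) *\<^sub>R i) (\<Sum>i\<in>Basis. (w \<bullet> i) *\<^sub>R i)"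
      by (simp add: euclidean_representation)
    also have "\<dots> = (\<Sum>(i, j)\<in>Basis \<times> Basis. ?g ((w \<bullet> i) *\<^sub>R i) ((w \<bullet> j) *\<^sub>R j))"
      by (rule bilinear_sum[OF bl])
    also have "\<dots> \<le> (\<Sum>(i, j)\<in>Basis \<times> Basis. b i j * (norm w)\<^sup>2)"
    proof (rule sum_mono, safe)
      fix i j :: 'e assume ij: "i \<in> Basis" "j \<in> Basis"
      have "?g ((w \<bullet> i) *\<^sub>R i) ((w \<bullet> j) *\<^sub>R j) = (w \<bullet> i) * (w \<bullet> j) * ?g i j"
        by (simp add: bilinear_lmul[OF bl] bilinear_rmul[OF bl])
      also have "\<dots> \<le> \<bar>w \<bullet> i\<bar> * \<bar>w \<bullet> j\<bar> * \<bar>?g i j\<bar>"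
        by (rule order_trans[OF abs_ge_self]) (simp add: abs_mult)
      also have "\<dots> \<le> norm w * norm w * b i j"
        using ij b z by (intro mult_mono) (auto simp: Basis_le_norm)
      finally show "?g ((w \<bullet> i) *\<^sub>R i) ((w \<bullet> j) *\<^sub>R j) \<le> b i j * (norm w)\<^sup>2"
        by (simp add: power2_eq_square mult_ac)
    qed
    also have "\<dots> = K * (norm w)\<^sup>2" unfolding K_def by (simp add: sum_distrib_right case_prod_unfold)
    finally show ?thesis .
  qed
  moreover have "0 \<le> K" unfolding K_def using b by (intro sum_nonneg) auto
  ultimately show ?thesis by blast
qed

text \<open>The straight segments in a chart are competitors in the infimum defining \<open>rdist\<close>.\<close>

lemma rdist_chart_le:
  assumes c: "c \<in> atlas" and x: "x \<in> fst c"
  shows "\<exists>e>0. \<exists>K\<ge>0. \<forall>y\<in>fst c. snd c y \<in> cball (snd c x) e \<longrightarrow> rdist x y \<le> K * norm (snd c y - snd c x)"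
proof -
  define U where "U = fst c"
  define \<psi> where "\<psi> = snd c"
  define \<iota> where "\<iota> = chart_inv c"
  have hom: "homeomorphism U (\<psi> ` U) \<psi> \<iota>" and op: "open (\<psi> ` U)"
    using chart[OF c] by (simp_all add: U_def \<psi>_def \<iota>_def)
  have xU: "x \<in> U" using x by (simp add: U_def)
  then have "\<psi> x \<in> \<psi> ` U" by simp
  then obtain e where e: "0 < e" "cball (\<psi> x) e \<subseteq> \<psi> ` U"
    using op open_contains_cball by blast
  obtain K where K: "0 \<le> K" "\<And>z w. z \<in> cball (\<psi> x) e \<Longrightarrow> metric c (\<iota> z) w w \<le> K * (norm w)\<^sup>2"
    using metric_locally_bounded[OF c, of "cball (\<psi> x) e"] e unfolding \<psi>_def U_def \<iota>_def by auto
  have "rdist x y \<le> sqrt K * norm (\<psi> y - \<psi> x)" if y: "y \<in> U" "\<psi> y \<in> cball (\<psi> x) e" for y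
  proof -
    define w where "w = \<psi> y - \<psi> x"
    \<comment> \<open>Affine on the whole line, so that the two-sided derivative exists at both end
      points of the segment.\<close>
    define p where "p t = \<psi> x + t *\<^sub>R w" for t :: real
    define \<gamma> where "\<gamma> t = \<iota> (p t)" for t
    have p: "p t \<in> cball (\<psi> x) e" if "t \<in> {0..1}" for t
    proof -
      have "\<bar>t\<bar> * norm w \<le> 1 * norm w" using that by (intro mult_right_mono) auto
      then show ?thesis using y by (simp add: p_def w_def dist_norm norm_minus_commute)
    qed
    have pU: "p t \<in> \<psi> ` U" if "t \<in> {0..1}" for t using p[OF that] e by blast
    have \<gamma>U: "\<gamma> t \<in> U" "\<psi> (\<gamma> t) = p t" if "t \<in> {0..1}" for t
      using pU[OF that] homeomorphism_image2[OF hom] homeomorphism_apply2[OF hom] by (auto simp: \<gamma>_def)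
    have pcont: "continuous_on S p" for S unfolding p_def by (intro continuous_intros)
    have path: "path \<gamma>"
      unfolding path_def \<gamma>_def
      by (rule continuous_on_compose2[OF homeomorphism_cont2[OF hom] pcont]) (use pU in auto)
    have pder: "(p has_vector_derivative w) (at t)" for t
      unfolding p_def by (auto intro!: derivative_eq_intros)
    \<comment> \<open>The velocity of the segment read in another chart. \<open>curve_length\<close>
      measures in a chart chosen anew at every point, and \<open>metric_compat\<close> carries that
      back to \<open>c\<close>, where the velocity is the constant \<open>w\<close>.\<close>
    define D where "D d t = frechet_derivative (snd d \<circ> \<iota>) (at (p t)) w" for d :: "('a, 'e) chart" and t
    have der: "(snd d \<circ> \<gamma> has_vector_derivative D d t) (at t)" if d: "d \<in> atlas" "t \<in> {0..1}" "\<gamma> t \<in> fst d" for d t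
    proof -
      have "Ck_on (Suc 0) (snd d \<circ> \<iota>) (\<psi> ` (U \<inter> fst d))"
        using transition_smooth[OF c d(1)] unfolding smooth_on_def \<psi>_def U_def \<iota>_def by blast
      moreover have "p t \<in> \<psi> ` (U \<inter> fst d)" using \<gamma>U[OF d(2)] d(3) by (metis IntI imageI)
      ultimately have "(snd d \<circ> \<iota>) differentiable (at (p t))" unfolding Ck_on.simps by blast
      then have "((snd d \<circ> \<iota>) has_derivative frechet_derivative (snd d \<circ> \<iota>) (at (p t))) (at (p t))"
        by (simp add: frechet_derivative_works)
      from vector_derivative_diff_chain_within[of p w t UNIV "snd d \<circ> \<iota>", OF pder has_derivative_at_withinI[OF this]]
      show ?thesis by (simp add: D_def \<gamma>_def o_def)
    qed
    have "(snd d \<circ> \<gamma>) C1_differentiable_on {t \<in> {0..1} - {}. \<gamma> t \<in> fst d}" if d: "d \<in> atlas" for d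
      unfolding C1_differentiable_on_def
    proof (intro exI conjI ballI)
      fix t assume "t \<in> {t \<in> {0..1} - {}. \<gamma> t \<in> fst d}"
      then show "(snd d \<circ> \<gamma> has_vector_derivative D d t) (at t)" by (intro der d) auto
    next
      have "Ck_on (Suc 0) (snd d \<circ> \<iota>) (\<psi> ` (U \<inter> fst d))"
        using transition_smooth[OF c d] unfolding smooth_on_def \<psi>_def U_def \<iota>_def by blast
      then have "continuous_on (\<psi> ` (U \<inter> fst d)) (\<lambda>z. frechet_derivative (snd d \<circ> \<iota>) (at z) w)" by simp
      then show "continuous_on {t \<in> {0..1} - {}. \<gamma> t \<in> fst d} (D d)"
        unfolding D_def
      proof (rule continuous_on_compose2[OF _ pcont], safe)
        fix t assume "t \<in> {0..1}" "t \<notin> {}" "\<gamma> t \<in> fst d"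
        then show "p t \<in> \<psi> ` (U \<inter> fst d)" using \<gamma>U[of t] by (metis IntI imageI)
      qed
    qed
    then have pw: "piecewise_C1_curve \<gamma>"
      unfolding piecewise_C1_curve_def using path by (intro conjI exI[of _ "{}"]) auto
    have "curve_length \<gamma> \<le> (\<integral>\<^sup>+t\<in>{0..1}. ennreal (sqrt K * norm w) \<partial>(lborel :: real measure))"
      unfolding curve_length_def
    proof (rule nn_integral_mono)
      fix t :: real
      show "ennreal (tnorm (\<gamma> t) (vector_derivative (snd (chart_at (\<gamma> t)) \<circ> \<gamma>) (at t))) * indicator {0..1} t
         \<le> ennreal (sqrt K * norm w) * indicator {0..1} t"
      proof (cases "t \<in> {0..1}")
        case True
        define d where "d = chart_at (\<gamma> t)"
        have d: "d \<in> atlas" "\<gamma> t \<in> fst d" using chart_at[of "\<gamma> t"] by (auto simp: d_def)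
        have vd: "vector_derivative (snd d \<circ> \<gamma>) (at t) = D d t"
          by (rule vector_derivative_at[OF der[OF d(1) True d(2)]])
        have "metric d (\<gamma> t) (D d t) (D d t) = metric c (\<gamma> t) w w"
          using metric_compat[OF c d(1), of "\<gamma> t" w w] d(2) \<gamma>U[OF True]
          unfolding D_def \<psi>_def \<iota>_def U_def by simp
        also have "\<dots> \<le> K * (norm w)\<^sup>2" unfolding \<gamma>_def by (rule K(2)[OF p[OF True]])
        finally have "sqrt (metric d (\<gamma> t) (D d t) (D d t)) \<le> sqrt (K * (norm w)\<^sup>2)" by simp
        then show ?thesis
          unfolding tnorm_def d_def[symmetric] vd using True by (auto simp: real_sqrt_mult intro!: ennreal_leI)
      qed simp
    qed
    also have "\<dots> = ennreal (sqrt K * norm w)" by (simp add: nn_integral_cmult_indicator)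
    finally have len: "curve_length \<gamma> \<le> ennreal (sqrt K * norm w)" .
    have "pathstart \<gamma> = x" "pathfinish \<gamma> = y"
      using homeomorphism_apply1[OF hom] xU y by (simp_all add: pathstart_def pathfinish_def \<gamma>_def p_def w_def)
    with pw have "(INF \<gamma>\<in>{\<gamma>. piecewise_C1_curve \<gamma> \<and> pathstart \<gamma> = x \<and> pathfinish \<gamma> = y}. curve_length \<gamma>) \<le> curve_length \<gamma>"
      by (intro INF_lower) simp
    then show ?thesis
      unfolding rdist_def w_def[symmetric] using len K(1) by (intro enn2real_leI) (auto intro: order_trans)
  qed
  then show ?thesis using e(1) K(1) unfolding U_def \<psi>_def
    by (intro exI[of _ e] conjI exI[of _ "sqrt K"]) auto
qed

lemma rdist_nonneg: "0 \<le> rdist x y"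
  by (simp add: rdist_def)

text \<open>The Hoelder condition is stated in the Riemannian distance, continuity in the topology
  of the manifold. They are linked by the bound of the distance by a multiple of the coordinate
  distance near each point.\<close>

lemma holder_imp_continuous:
  assumes h: "holder \<alpha> \<phi>" and \<alpha>: "0 < \<alpha>"
  shows "continuous_on UNIV \<phi>"
proof -
  obtain H where H: "\<And>x y. \<bar>\<phi> x - \<phi> y\<bar> \<le> H * rdist x y powr \<alpha>" using h unfolding holder_def by blast
  have "isCont \<phi> x" for x
  proof -
    define c where "c = chart_at x"
    have c: "c \<in> atlas" "x \<in> fst c" using chart_at[of x] by (auto simp: c_def)
    obtain e K where e: "0 < e" "0 \<le> K"
      and le: "\<And>y. y \<in> fst c \<Longrightarrow> snd c y \<in> cball (snd c x) e \<Longrightarrow> rdist x y \<le> K * norm (snd c y - snd c x)"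
      using rdist_chart_le[OF c] by blast
    have hom: "homeomorphism (fst c) (snd c ` fst c) (snd c) (chart_inv c)" and opU: "open (fst c)"
      using chart[OF c(1)] by auto
    have cont: "continuous_on (fst c) (snd c)" by (rule homeomorphism_cont1[OF hom])
    then have "isCont (snd c) x" using opU c(2) by (simp add: continuous_on_eq_continuous_at)
    then have \<psi>: "(snd c \<longlongrightarrow> snd c x) (at x)" by (simp add: isCont_def)
    have "open (fst c \<inter> snd c -` ball (snd c x) e)"
      by (rule continuous_open_preimage[OF cont opU]) simp
    then have ev: "\<forall>\<^sub>F y in at x. y \<in> fst c \<inter> snd c -` ball (snd c x) e"
      using c(2) e(1) by (intro eventually_at_in_open') auto
    have "((\<lambda>y. \<phi> y - \<phi> x) \<longlongrightarrow> 0) (at x)"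
    proof (rule Lim_null_comparison)
      show "\<forall>\<^sub>F y in at x. norm (\<phi> y - \<phi> x) \<le> \<bar>H\<bar> * (K * norm (snd c y - snd c x)) powr \<alpha>"
        using ev
      proof eventually_elim
        case (elim y)
        have "norm (\<phi> y - \<phi> x) \<le> H * rdist x y powr \<alpha>" using H[of x y] by (simp add: abs_minus_commute)
        also have "\<dots> \<le> \<bar>H\<bar> * rdist x y powr \<alpha>" by (intro mult_right_mono) auto
        also have "\<dots> \<le> \<bar>H\<bar> * (K * norm (snd c y - snd c x)) powr \<alpha>"
          using elim le[of y] \<alpha> rdist_nonneg by (intro mult_left_mono powr_mono2) auto
        finally show ?case .
      qed
      have "((\<lambda>y. K * norm (snd c y - snd c x)) \<longlongrightarrow> K * norm (snd c x - snd c x)) (at x)"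
        by (intro tendsto_intros \<psi>)
      then have "((\<lambda>y. K * norm (snd c y - snd c x)) \<longlongrightarrow> 0) (at x)" by simp
      then have "((\<lambda>y. (K * norm (snd c y - snd c x)) powr \<alpha>) \<longlongrightarrow> 0 powr \<alpha>) (at x)"
        using \<alpha> e(2) by (intro tendsto_powr2) (auto intro!: always_eventually)
      then show "((\<lambda>y. \<bar>H\<bar> * (K * norm (snd c y - snd c x)) powr \<alpha>) \<longlongrightarrow> 0) (at x)"
        using \<alpha> tendsto_mult_right_zero by fastforce
    qed
    then show ?thesis unfolding isCont_def by (simp add: LIM_zero_iff)
  qed
  then show ?thesis by (simp add: continuous_at_imp_continuous_on)
qed

lemma C1_local_diffeo_imp_continuous:
  assumes "C1_local_diffeo f"
  shows "continuous_on UNIV f"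
proof -
  have "isCont f x" for x
  proof -
    obtain U g where U: "open U" "x \<in> U" "homeomorphism U (f ` U) f g"
      using assms unfolding C1_local_diffeo_def by blast
    show ?thesis using homeomorphism_cont1[OF U(3)] U(1,2) by (simp add: continuous_on_eq_continuous_at)
  qed
  then show ?thesis by (simp add: continuous_at_imp_continuous_on)
qed

end

section \<open>The main result\<close>

text \<open>\<open>Y\<close> is tied to \<open>g\<close> only almost everywhere because
  \<open>g\<close> will be a version of the observable changed on a null set. Levy's continuity
  theorem is applied at frequency \<open>t\<close>, which becomes \<open>t / sqrt avar\<close> for
  the unnormalised sums.\<close>

lemma (in decaying_observable) weak_conv_std_normal:
  assumes v: "avar \<noteq> 0"
    and Y: "\<And>n. Y n \<in> borel_measurable M" "\<And>n. AE x in M. Y n x = 1 / (sqrt avar * sqrt (real n)) * bsum g n x"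
  shows "weak_conv_m (\<lambda>n. distr M borel (Y n)) std_normal_distribution"
proof (rule levy_continuity)
  note Y(1)[measurable]
  show "real_distribution (distr M borel (Y n))" for n by simp
  show "real_distribution std_normal_distribution" by (rule real_dist_normal_dist)
  fix t :: real
  have v0: "0 < avar" using v avar_nonneg by simp
  define s where "s = t / sqrt avar"
  have "char (distr M borel (Y n)) t = (\<integral>x. iexp (s / sqrt (real n) * bsum g n x) \<partial>M)" for n
  proof -
    have "char (distr M borel (Y n)) t = (\<integral>x. iexp (t * Y n x) \<partial>M)"
      unfolding char_def by (subst integral_distr) auto
    also have "\<dots> = (\<integral>x. iexp (s / sqrt (real n) * bsum g n x) \<partial>M)"
    proof (rule integral_cong_AE)
      show "AE x in M. iexp (t * Y n x) = iexp (s / sqrt (real n) * bsum g n x)"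
        using Y(2)[of n] by eventually_elim (simp add: s_def mult_ac)
    qed auto
    finally show ?thesis .
  qed
  moreover have "exp (- s\<^sup>2 * avar / 2) = exp (- (t\<^sup>2) / 2)"
    using v0 by (simp add: s_def power_divide)
  ultimately show "(\<lambda>n. char (distr M borel (Y n)) t) \<longlonglongrightarrow> char std_normal_distribution t"
    using char_bsum_tendsto[of s] by (simp add: char_std_normal_distribution)
qed

section \<open>Verification for the equilibrium state\<close>

context spectral_gap_setting
begin

lemma f_borel: "f \<in> borel_measurable borel"
  by (rule borel_measurable_continuous_onI[OF C1_local_diffeo_imp_continuous[OF local_diffeo]])

lemma phi_continuous: "continuous_on UNIV \<phi>"
  by (rule holder_imp_continuous[OF phi_holder alpha])

lemma mu_sets: "sets \<mu> = sets borel"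
  using mu_equilibrium by (simp add: equilibrium_state_def invariant_prob_def)

lemma mu_ergodic: "ergodic \<mu> f"
proof -
  have inv: "invariant_prob f \<mu>" using mu_equilibrium by (simp add: equilibrium_state_def)
  then interpret prob_space \<mu> by (simp add: invariant_prob_def)
  have sp: "space \<mu> = UNIV" using sets_eq_imp_space_eq[OF mu_sets] by simp
  have "bounded (range \<phi>)"
    by (rule compact_imp_bounded[OF compact_continuous_image[OF phi_continuous compact_M]])
  then obtain K where K: "\<And>x. \<bar>\<phi> x\<bar> \<le> K" unfolding bounded_iff by auto
  have phi_meas: "\<phi> \<in> borel_measurable borel"
    by (rule borel_measurable_continuous_onI[OF phi_continuous])
  show ?thesis
  proof unfold_locales
    show "f \<in> measurable \<mu> \<mu>"
      using f_borel by (simp add: measurable_cong_sets[OF mu_sets mu_sets])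
    have "distr \<mu> \<mu> f = distr \<mu> borel f" by (rule distr_cong) (auto simp: mu_sets)
    then show "distr \<mu> \<mu> f = \<mu>" using inv by (simp add: invariant_prob_def)
    fix A assume "A \<in> sets \<mu>" "f -` A \<inter> space \<mu> = A"
    then show "prob A = 0 \<or> prob A = 1"
      using unique_equilibrium_state_ergodic[OF f_borel phi_meas K mu_equilibrium mu_unique, of A]
      by (simp add: mu_sets sp)
  qed
qed

lemma ex_decaying_version:
  assumes \<Phi>: "\<Phi> \<in> theta_space \<theta>"
  shows "\<exists>g B C \<xi>. decaying_observable \<mu> f g B C \<xi> \<and> (AE x in \<mu>. g x = \<Phi> x - (\<integral>y. \<Phi> y \<partial>\<mu>))"
proof -
  interpret ergodic \<mu> f by (rule mu_ergodic)
  interpret \<nu>: prob_space \<nu> by (rule nu_prob)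
  define m where "m = (\<integral>y. \<Phi> y \<partial>\<mu>)"
  have s\<nu>: "sets \<nu> = sets \<mu>" using nu_prob mu_sets by simp
  have \<Phi>m[measurable]: "\<Phi> \<in> borel_measurable \<mu>"
    using \<Phi> by (simp add: V_theta_def measurable_cong_sets[OF s\<nu> refl])
  have fin: "Linf_norm \<nu> \<Phi> < \<infinity>" using \<Phi> by (simp add: V_theta_def norm_theta_def)
  define b where "b = enn2real (Linf_norm \<nu> \<Phi>)"
  have "AE x in \<nu>. ennreal (norm (\<Phi> x)) \<le> Linf_norm \<nu> \<Phi>"
    unfolding Linf_norm_def by (rule esssup_AE)
  then have "AE x in \<nu>. \<bar>\<Phi> x\<bar> \<le> b"
  proof eventually_elim
    case (elim x)
    then have "enn2real (ennreal (norm (\<Phi> x))) \<le> b"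
      unfolding b_def using fin by (intro enn2real_mono) auto
    then show ?case by simp
  qed
  \<comment> \<open>The essential bound is one for \<nu>; absolute continuity of \<mu> transfers
    it.\<close>
  then have \<Phi>b: "AE x in \<mu>. \<bar>\<Phi> x\<bar> \<le> b"
    by (rule absolutely_continuous_AE[OF s\<nu>[symmetric] mu_ac])
  define g where "g x = (if \<bar>\<Phi> x\<bar> \<le> b then \<Phi> x - m else 0)" for x
  have gAE: "AE x in \<mu>. g x = \<Phi> x - m" using \<Phi>b by eventually_elim (simp add: g_def)
  have gm[measurable]: "g \<in> borel_measurable \<mu>" unfolding g_def by measurable
  have b0: "0 \<le> b" by (simp add: b_def)
  have gb: "\<bar>g x\<bar> \<le> b + \<bar>m\<bar> + 1" for x unfolding g_def using b0 by auto
  obtain K \<xi> where K: "0 < K" "0 < \<xi>" "\<xi> < 1" and dec: "\<And>\<Psi> n. integrable \<nu> \<Psi> \<Longrightarrow>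
         \<bar>(\<integral>x. \<Phi> x * \<Psi> ((f ^^ n) x) \<partial>\<mu>) - (\<integral>x. \<Phi> x \<partial>\<mu>) * (\<integral>x. \<Psi> x \<partial>\<mu>)\<bar>
         \<le> K * \<xi> ^ n * theta_norm \<theta> \<Phi> * (\<integral>x. \<bar>\<Psi> x\<bar> \<partial>\<nu>)"
    using decay_of_correlations \<Phi> by blast
  define N where "N = theta_norm \<theta> \<Phi>"
  have N0: "0 \<le> N" by (simp add: N_def)
  \<comment> \<open>The added 1 keeps both constants positive, also when \<open>\<Phi>\<close>
    vanishes almost everywhere.\<close>
  have "decaying_observable \<mu> f g (b + \<bar>m\<bar> + 1) (K * N + 1) \<xi>"
  proof unfold_locales
    fix \<Psi> :: "'a \<Rightarrow> real" and k n
    assume \<Psi>[measurable]: "\<Psi> \<in> borel_measurable \<mu>" and k: "\<And>x. \<bar>\<Psi> x\<bar> \<le> k"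
    have k0: "0 \<le> k" using k[of undefined] by simp
    have \<Psi>\<nu>: "\<Psi> \<in> borel_measurable \<nu>" using \<Psi> by (simp add: measurable_cong_sets[OF s\<nu> refl])
    have i\<nu>: "integrable \<nu> \<Psi>" by (rule \<nu>.integrable_const_bound[of _ k]) (auto simp: k \<Psi>\<nu>)
    have i1: "integrable \<mu> (\<lambda>x. \<Phi> x * \<Psi> ((f ^^ n) x))"
    proof (rule integrable_const_bound[of _ "b * k"])
      show "AE x in \<mu>. norm (\<Phi> x * \<Psi> ((f ^^ n) x)) \<le> b * k"
        using \<Phi>b by eventually_elim (auto simp: abs_mult b0 intro!: mult_mono k)
    qed simp
    have i2: "integrable \<mu> (\<lambda>x. \<Psi> ((f ^^ n) x))" by (rule integrable_bounded[of _ k]) (auto simp: k)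
    have "(\<integral>x. g x * \<Psi> ((f ^^ n) x) \<partial>\<mu>) = (\<integral>x. \<Phi> x * \<Psi> ((f ^^ n) x) - m * \<Psi> ((f ^^ n) x) \<partial>\<mu>)"
    proof (rule integral_cong_AE)
      show "AE x in \<mu>. g x * \<Psi> ((f ^^ n) x) = \<Phi> x * \<Psi> ((f ^^ n) x) - m * \<Psi> ((f ^^ n) x)"
        using gAE by eventually_elim (simp only: left_diff_distrib)
    qed auto
    also have "\<dots> = (\<integral>x. \<Phi> x * \<Psi> ((f ^^ n) x) \<partial>\<mu>) - (\<integral>x. \<Phi> x \<partial>\<mu>) * (\<integral>x. \<Psi> x \<partial>\<mu>)"
      using i1 i2 by (simp add: m_def integral_T_funpow)
    finally have "\<bar>\<integral>x. g x * \<Psi> ((f ^^ n) x) \<partial>\<mu>\<bar> \<le> K * \<xi> ^ n * N * (\<integral>x. \<bar>\<Psi> x\<bar> \<partial>\<nu>)"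
      using dec[OF i\<nu>, of n] by (simp add: N_def)
    \<comment> \<open>As \<nu> is a probability, the supremum of a test function bounds its
      L^1(\<nu>) norm.\<close>
    also have "\<dots> \<le> K * \<xi> ^ n * N * k"
    proof (rule mult_left_mono)
      have "(\<integral>x. \<bar>\<Psi> x\<bar> \<partial>\<nu>) \<le> (\<integral>x. k \<partial>\<nu>)" using i\<nu> k by (intro integral_mono) auto
      then show "(\<integral>x. \<bar>\<Psi> x\<bar> \<partial>\<nu>) \<le> k" by (simp add: \<nu>.prob_space)
    qed (use K N0 in auto)
    also have "\<dots> = (K * N) * (\<xi> ^ n * k)" by (simp add: mult_ac)
    also have "\<dots> \<le> (K * N + 1) * (\<xi> ^ n * k)" using K k0 by (intro mult_right_mono) auto
    finally show "\<bar>\<integral>x. g x * \<Psi> ((f ^^ n) x) \<partial>\<mu>\<bar> \<le> (K * N + 1) * \<xi> ^ n * k" by (simp add: mult_ac)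
  qed (use gm gb b0 K N0 in \<open>auto intro: add_nonneg_pos\<close>)
  with gAE show ?thesis unfolding m_def by blast
qed

text \<open>The variance does not change when a constant is added to \<open>\<Phi>\<close>, so it
  can only detect whether the centred observable is a coboundary. For \<open>\<Phi>\<close> itself
  the vanishing of the mean is a separate condition, which being a coboundary enforces.\<close>

theorem clt_and_coboundary:
  assumes \<Phi>: "\<Phi> \<in> theta_space \<theta>"
  shows "asymp_variance f \<mu> \<Phi> \<noteq> 0 \<longrightarrow>
           weak_conv_m (\<lambda>n. distr \<mu> borel (\<lambda>x.
               1 / (sqrt (asymp_variance f \<mu> \<Phi>) * sqrt (real n)) *
               (\<Sum>j<n. \<Phi> ((f ^^ j) x) - (\<integral>y. \<Phi> y \<partial>\<mu>))))
             std_normal_distribution" (is ?clt)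
    and "asymp_variance f \<mu> \<Phi> = 0 \<longleftrightarrow>
           (\<exists>\<Psi> \<in> borel_measurable borel. AE x in \<mu>. \<Phi> x - (\<integral>y. \<Phi> y \<partial>\<mu>) = \<Psi> (f x) - \<Psi> x)" (is ?cob)
    and "asymp_variance f \<mu> \<Phi> = 0 \<and> (\<integral>y. \<Phi> y \<partial>\<mu>) = 0 \<longleftrightarrow>
           (\<exists>\<Psi> \<in> borel_measurable borel. AE x in \<mu>. \<Phi> x = \<Psi> (f x) - \<Psi> x)" (is ?centred)
proof -
  obtain g B C \<xi> where g: "decaying_observable \<mu> f g B C \<xi>" "AE x in \<mu>. g x = \<Phi> x - (\<integral>y. \<Phi> y \<partial>\<mu>)"
    using ex_decaying_version[OF \<Phi>] by blast
  interpret decaying_observable \<mu> f g B C \<xi> by (rule g(1))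
  have s\<nu>: "sets \<nu> = sets \<mu>" using nu_prob mu_sets by simp
  have [measurable]: "\<Phi> \<in> borel_measurable \<mu>"
    using \<Phi> by (simp add: V_theta_def measurable_cong_sets[OF s\<nu> refl])
  define \<Phi>0 where "\<Phi>0 x = \<Phi> x - (\<integral>y. \<Phi> y \<partial>\<mu>)" for x
  have [measurable]: "\<Phi>0 \<in> borel_measurable \<mu>" unfolding \<Phi>0_def by measurable
  have g0: "AE x in \<mu>. g x = \<Phi>0 x" using g(2) by (simp add: \<Phi>0_def)
  have "(\<integral>x. (g x)\<^sup>2 \<partial>\<mu>) = (\<integral>x. (\<Phi>0 x)\<^sup>2 \<partial>\<mu>)"
    by (rule integral_cong_AE) (use g0 in \<open>auto\<close>)
  moreover have "(\<integral>x. g x * g ((f ^^ Suc k) x) \<partial>\<mu>) = (\<integral>x. \<Phi>0 x * \<Phi>0 ((f ^^ Suc k) x) \<partial>\<mu>)" for k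
  proof (rule integral_cong_AE)
    show "AE x in \<mu>. g x * g ((f ^^ Suc k) x) = \<Phi>0 x * \<Phi>0 ((f ^^ Suc k) x)"
      using g0 AE_T_funpow[OF g0, of "Suc k"] by eventually_elim simp
  qed measurable
  ultimately have av: "asymp_variance f \<mu> \<Phi> = avar"
    unfolding asymp_variance_def avar_def Let_def \<Phi>0_def by simp
  have "AE x in \<mu>. \<forall>j. g ((f ^^ j) x) = \<Phi>0 ((f ^^ j) x)"
    using AE_T_funpow[OF g0] by (simp add: AE_all_countable)
  then have bs: "AE x in \<mu>. (\<Sum>j<n. \<Phi>0 ((f ^^ j) x)) = bsum g n x" for n
    by eventually_elim (simp add: bsum_def)
  show ?clt
    unfolding av \<Phi>0_def[symmetric]
  proof
    assume "avar \<noteq> 0"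
    then show "weak_conv_m (\<lambda>n. distr \<mu> borel (\<lambda>x. 1 / (sqrt avar * sqrt (real n)) * (\<Sum>j<n. \<Phi>0 ((f ^^ j) x))))
        std_normal_distribution"
    proof (rule weak_conv_std_normal)
      show "AE x in \<mu>. 1 / (sqrt avar * sqrt (real n)) * (\<Sum>j<n. \<Phi>0 ((f ^^ j) x))
          = 1 / (sqrt avar * sqrt (real n)) * bsum g n x" for n
        using bs[of n] by eventually_elim simp
    qed measurable
  qed
  have mb: "borel_measurable \<mu> = (borel_measurable borel :: ('a \<Rightarrow> real) set)"
    by (rule measurable_cong_sets[OF mu_sets refl])
  have eqv: "(AE x in \<mu>. g x = \<Psi> (f x) - \<Psi> x) \<longleftrightarrow> (AE x in \<mu>. \<Phi>0 x = \<Psi> (f x) - \<Psi> x)" for \<Psi>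
  proof
    assume "AE x in \<mu>. g x = \<Psi> (f x) - \<Psi> x"
    with g0 show "AE x in \<mu>. \<Phi>0 x = \<Psi> (f x) - \<Psi> x" by eventually_elim simp
  next
    assume "AE x in \<mu>. \<Phi>0 x = \<Psi> (f x) - \<Psi> x"
    with g0 show "AE x in \<mu>. g x = \<Psi> (f x) - \<Psi> x" by eventually_elim simp
  qed
  show cob: ?cob
    unfolding av variance_0_iff_coboundary mb eqv by (simp add: \<Phi>0_def)
  have zero: "(\<integral>y. \<Phi> y \<partial>\<mu>) = 0" if \<Psi>: "\<Psi> \<in> borel_measurable borel" "AE x in \<mu>. \<Phi> x = \<Psi> (f x) - \<Psi> x" for \<Psi>
  proof (rule coboundary_integral_0[OF _ _ \<Psi>(2)])
    have "integrable \<mu> g" by (rule integrable_bounded[of _ B]) (auto simp: g_bounded)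
    then have "integrable \<mu> (\<lambda>x. g x + (\<integral>y. \<Phi> y \<partial>\<mu>))" by simp
    moreover have "AE x in \<mu>. g x + (\<integral>y. \<Phi> y \<partial>\<mu>) = \<Phi> x" using g(2) by eventually_elim simp
    ultimately show "integrable \<mu> \<Phi>" by (subst (asm) integrable_cong_AE) auto
    show "\<Psi> \<in> borel_measurable \<mu>" using \<Psi>(1) by (simp add: mb)
  qed
  show ?centred
  proof
    assume a: "asymp_variance f \<mu> \<Phi> = 0 \<and> (\<integral>y. \<Phi> y \<partial>\<mu>) = 0"
    then have "\<exists>\<Psi>\<in>borel_measurable borel. AE x in \<mu>. \<Phi> x - (\<integral>y. \<Phi> y \<partial>\<mu>) = \<Psi> (f x) - \<Psi> x"
      using cob by blast
    then show "\<exists>\<Psi>\<in>borel_measurable borel. AE x in \<mu>. \<Phi> x = \<Psi> (f x) - \<Psi> x"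
      using a by simp
  next
    assume ex: "\<exists>\<Psi>\<in>borel_measurable borel. AE x in \<mu>. \<Phi> x = \<Psi> (f x) - \<Psi> x"
    then have m0: "(\<integral>y. \<Phi> y \<partial>\<mu>) = 0" using zero by blast
    have "\<exists>\<Psi>\<in>borel_measurable borel. AE x in \<mu>. \<Phi> x - (\<integral>y. \<Phi> y \<partial>\<mu>) = \<Psi> (f x) - \<Psi> x"
      unfolding m0 diff_zero by (rule ex)
    then show "asymp_variance f \<mu> \<Phi> = 0 \<and> (\<integral>y. \<Phi> y \<partial>\<mu>) = 0" using cob m0 by blast
  qed
qed

end

theorem corollary1:
  fixes atlas :: "('a::t2_space, 'e::euclidean_space) chart set"
    and metric :: "('a, 'e) chart \<Rightarrow> 'a \<Rightarrow> 'e \<Rightarrow> 'e \<Rightarrow> real"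
    and f :: "'a \<Rightarrow> 'a" and \<phi> :: "'a \<Rightarrow> real" and Q :: "nat \<Rightarrow> 'a set"
    and \<nu> \<mu> :: "'a measure" and \<Phi> :: "'a \<Rightarrow> real"
    and deg p q :: nat and \<alpha> \<sigma> L \<epsilon>0 \<gamma> c \<tau> r \<theta> :: real
  assumes "spectral_gap_setting atlas metric f \<phi> \<alpha> deg p q Q \<sigma> L \<epsilon>0 \<gamma> c \<tau> \<nu> \<mu> r \<theta>"
    and "\<Phi> \<in> V_theta f \<phi> (Q ` {1..q + p}) \<nu> \<theta>"
  shows "(asymp_variance f \<mu> \<Phi> \<noteq> 0 \<longrightarrow>
           weak_conv_m (\<lambda>n. distr \<mu> borel (\<lambda>x.
               1 / (sqrt (asymp_variance f \<mu> \<Phi>) * sqrt (real n)) *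
               (\<Sum>j<n. \<Phi> ((f ^^ j) x) - (\<integral>y. \<Phi> y \<partial>\<mu>))))
             std_normal_distribution)
       \<and> (sqrt (asymp_variance f \<mu> \<Phi>) = 0 \<longleftrightarrow>
           (\<exists>\<Psi> \<in> borel_measurable borel. AE x in \<mu>. \<Phi> x - (\<integral>y. \<Phi> y \<partial>\<mu>) = \<Psi> (f x) - \<Psi> x))
       \<and> (sqrt (asymp_variance f \<mu> \<Phi>) = 0 \<and> (\<integral>y. \<Phi> y \<partial>\<mu>) = 0 \<longleftrightarrow>
           (\<exists>\<Psi> \<in> borel_measurable borel. AE x in \<mu>. \<Phi> x = \<Psi> (f x) - \<Psi> x))"
  unfolding real_sqrt_eq_0_iff
  using spectral_gap_setting.clt_and_coboundary[OF assms] by blast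

end
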